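(* Let $q=s+Q'$ with complex-valued $s\in L^1_{loc}(\mathbb{R})$ and $Q,r\in L^2_{loc}(\mathbb{R})$, and let the operators $\mathrm{L},\mathrm{L}_{00},\mathrm{L}_0,\mathrm{L}^+,\mathrm{L}^+_{00},\mathrm{L}^+_0$ in $L^2(\mathbb{R})$, the functions $G_1,G_2$ and the form $[\cdot,\cdot]$ be as defined in the context. Then the following statements hold. ($1^0$) The operators $\mathrm{L}_{00}$ and $\mathrm{L}_{00}^{+}$ are densely defined in $L^2(\mathbb{R})$. ($2^0$) $(\mathrm{L}_{00})^{*}=\mathrm{L}^{+}$ and $(\mathrm{L}_{00}^{+})^{*}=\mathrm{L}$. ($3^0$) The operators $\mathrm{L}$, $\mathrm{L}^{+}$ are closed, and the operators $\mathrm{L}_{00}$, $\mathrm{L}_{00}^{+}$ are closable. ($4^0$) The domains of the minimal operators $\mathrm{L}_0=\overline{\mathrm{L}_{00}}$ and $\mathrm{L}_0^+=\overline{\mathrm{L}_{00}^+}$ are $$\mathrm{Dom}(\mathrm{L}_{0})=\{u\in \mathrm{Dom}(\mathrm{L}) : [u,v]_{-\infty}^{\infty}=0\ \ \forall v\in \mathrm{Dom}(\mathrm{L}^{+})\},$$ $$\mathrm{Dom}(\mathrm{L}_{0}^{+})=\{v\in \mathrm{Dom}(\mathrm{L}^{+}) : [u,v]_{-\infty}^{\infty}=0\ \ \forall u\in \mathrm{Dom}(\mathrm{L})\};$$ moreover, (i) $\mathrm{Dom}(\mathrm{L})\subset W^1_{2,loc}(\mathbb{R})$ and $\mathrm{Dom}(\mathrm{L}^{+})\subset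 W^1_{2,loc}(\mathbb{R})$; (ii) $\mathrm{Dom}(\mathrm{L}_{00})\subset W^1_{2,comp}(\mathbb{R})$ and $\mathrm{Dom}(\mathrm{L}_{00}^{+})\subset W^1_{2,comp}(\mathbb{R})$. ($5^0$) For every $u\in\mathrm{Dom}(\mathrm{L}_{00})$, $$(\mathrm{L}_{00}u,u)_{L^2(\mathbb{R})}=\int_{\mathbb{R}}|u'|^{2}\,dx-\int_{\mathbb{R}}\left(G_{1}u\overline{u}'+G_{2}u'\overline{u}\right)dx+\int_{\mathbb{R}}s|u|^{2}\,dx .$$
   Context: $L^2(\mathbb{R})$ is the complex Hilbert space with $(f,g)_{L^2(\mathbb{R})}=\int_{\mathbb{R}} f\overline{g}\,dx$. $W^k_{2,loc}(\mathbb{R})$ is the local $L^2$-Sobolev space of order $k$, and $W^k_{2,comp}(\mathbb{R})$ is the set of compactly supported functions in $W^k_{2,loc}(\mathbb{R})$. $\mathrm{AC}_{loc}(\mathbb{R})$ is the set of locally absolutely continuous functions. The formal differential expression is $l[u]=-u''+qu+i[(ru)'+ru']$, where $q=s+Q'$ (derivative in the sense of distributions), $s\in L^1_{loc}(\mathbb{R})$, $Q,r\in L^2_{loc}(\mathbb{R})$, all complex-valued. Put $G_1:=Q+ir$, $G_2:=Q-ir$. The expression is defined as a quasi-differential expression via the quasi-derivatives $$u^{[0]}:=u,\quad u^{[1]}:=u'-G_1u,\quad u^{[2]}:=(u^{[1]})'+G_2u^{[1]}+(G_1G_2-s)u,$$ by $l[u]:=-u^{[2]}$ for $u$ with $u,u^{[1]}\in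 \mathrm{AC}_{loc}(\mathbb{R})$. The formally adjoint expression is defined via $$v^{\{0\}}:=v,\quad v^{\{1\}}:=v'-\overline{G_2}v,\quad v^{\{2\}}:=(v^{\{1\}})'+\overline{G_1}v^{\{1\}}+(\overline{G_1G_2}-\overline{s})v,$$ by $l^+[v]:=-v^{\{2\}}$ for $v$ with $v,v^{\{1\}}\in \mathrm{AC}_{loc}(\mathbb{R})$. Maximal operators: $\mathrm{L}u:=l[u]$ with $\mathrm{Dom}(\mathrm{L})=\{u\in L^2(\mathbb{R}): u,u^{[1]}\in\mathrm{AC}_{loc}(\mathbb{R}),\ l[u]\in L^2(\mathbb{R})\}$, and $\mathrm{L}^+v:=l^+[v]$ with $\mathrm{Dom}(\mathrm{L}^+)=\{v\in L^2(\mathbb{R}): v,v^{\{1\}}\in\mathrm{AC}_{loc}(\mathbb{R}),\ l^+[v]\in L^2(\mathbb{R})\}$. Pre-minimal operators: $\mathrm{L}_{00}$ and $\mathrm{L}_{00}^+$ are the restrictions of $\mathrm{L}$ and $\mathrm{L}^+$ to the functions in their domains having compact support in $\mathbb{R}$. Minimal operators: $\mathrm{L}_0$ and $\mathrm{L}_0^+$ are the closures of $\mathrm{L}_{00}$ and $\mathrm{L}_{00}^+$. For $u\in\mathrm{Dom}(\mathrm{L})$, $v\in\mathrm{Dom}(\mathrm{L}^+)$: $[u,v](x):=u(x)\overline{v^{\{1\}}(x)}-u^{[1]}(x)\overline{v(x)}$ and $[u,v]_a^b:=[u,v](b)-[u,v](a)$ for $-\infty\le a<b\le\infty$, where $[u,v](\pm\infty):=\lim_{x\to\pm\infty}[u,v](x)$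 (these limits exist and are finite). *)

theory Defs
  imports "HOL-Analysis.Analysis"
begin

section \<open>The complex Hilbert space of square-integrable functions on the real line\<close>

definition sq_int :: "(real \<Rightarrow> complex) \<Rightarrow> bool" where
  "sq_int f \<longleftrightarrow> f \<in> borel_measurable lebesgue \<and> integrable lebesgue (\<lambda>x. (cmod (f x))\<^sup>2)"

definition l2_eq :: "(real \<Rightarrow> complex) \<Rightarrow> (real \<Rightarrow> complex) \<Rightarrow> bool" where
  "l2_eq f g \<longleftrightarrow> sq_int f \<and> sq_int g \<and> (AE x in lebesgue. f x = g x)"

lemma sq_int_zero: "sq_int (\<lambda>x. 0)"
  by (simp add: sq_int_def)

lemma sq_int_add:
  assumes f: "sq_int f" and g: "sq_int g"
  shows "sq_int (\<lambda>x. f x + g x)"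
proof -
  have [measurable]: "f \<in> borel_measurable lebesgue" "g \<in> borel_measurable lebesgue"
    using f g by (auto simp: sq_int_def)
  have bound: "(cmod (f x + g x))\<^sup>2 \<le> 2 * (cmod (f x))\<^sup>2 + 2 * (cmod (g x))\<^sup>2" for x
  proof -
    have "(cmod (f x + g x))\<^sup>2 \<le> (cmod (f x) + cmod (g x))\<^sup>2"
      by (intro power_mono norm_triangle_ineq) auto
    also have "\<dots> \<le> 2 * (cmod (f x))\<^sup>2 + 2 * (cmod (g x))\<^sup>2"
      using sum_squares_bound[of "cmod (f x)" "cmod (g x)"] by (simp add: power2_sum)
    finally show ?thesis .
  qed
  have "integrable lebesgue (\<lambda>x. 2 * (cmod (f x))\<^sup>2 + 2 * (cmod (g x))\<^sup>2)"
    using f g by (auto simp: sq_int_def)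
  then have "integrable lebesgue (\<lambda>x. (cmod (f x + g x))\<^sup>2)"
    by (rule Bochner_Integration.integrable_bound) (use bound in \<open>auto intro!: AE_I2\<close>)
  then show ?thesis by (simp add: sq_int_def)
qed

lemma sq_int_cmult: "sq_int f \<Longrightarrow> sq_int (\<lambda>x. c * f x)"
  by (auto simp: sq_int_def norm_mult power_mult_distrib)

lemma cnj_measurable:
  fixes h :: "real \<Rightarrow> complex"
  assumes "h \<in> borel_measurable lebesgue"
  shows "(\<lambda>x. cnj (h x)) \<in> borel_measurable lebesgue"
  by (rule measurable_compose[OF assms borel_measurable_continuous_onI]) (rule continuous_on_cnj[OF continuous_on_id])

lemma sq_int_inner:
  assumes f: "sq_int f" and g: "sq_int g"
  shows "integrable lebesgue (\<lambda>x. f x * cnj (g x))"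
proof -
  have [measurable]: "f \<in> borel_measurable lebesgue" "g \<in> borel_measurable lebesgue"
    using f g by (auto simp: sq_int_def)
  have m: "(\<lambda>x. f x * cnj (g x)) \<in> borel_measurable lebesgue"
    using cnj_measurable[of g] by simp
  have "integrable lebesgue (\<lambda>x. (cmod (f x))\<^sup>2 + (cmod (g x))\<^sup>2)"
    using f g by (auto simp: sq_int_def)
  then show ?thesis
  proof (rule Bochner_Integration.integrable_bound[OF _ m])
    show "AE x in lebesgue. cmod (f x * cnj (g x)) \<le> norm ((cmod (f x))\<^sup>2 + (cmod (g x))\<^sup>2)"
    proof (rule AE_I2)
      fix x
      have "2 * cmod (f x) * cmod (g x) \<le> (cmod (f x))\<^sup>2 + (cmod (g x))\<^sup>2"
        by (rule sum_squares_bound)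
      moreover have "0 \<le> cmod (f x) * cmod (g x)" by simp
      ultimately have "cmod (f x) * cmod (g x) \<le> (cmod (f x))\<^sup>2 + (cmod (g x))\<^sup>2"
        by linarith
      then show "cmod (f x * cnj (g x)) \<le> norm ((cmod (f x))\<^sup>2 + (cmod (g x))\<^sup>2)"
        by (simp add: norm_mult)
    qed
  qed
qed

text \<open>Elements are classes modulo equality almost everywhere; \<open>abs_l2 f\<close> is the class of a
  square-integrable function \<open>f\<close>.\<close>

quotient_type l2 = "real \<Rightarrow> complex" / partial: l2_eq
proof (rule part_equivpI)
  show "\<exists>f. l2_eq f f"
    by (rule exI[of _ "\<lambda>x. 0"]) (simp add: l2_eq_def sq_int_zero)
  show "symp l2_eq"
    by (rule sympI) (auto simp: l2_eq_def elim: eventually_mono)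
  show "transp l2_eq"
    by (rule transpI) (auto simp: l2_eq_def elim: eventually_elim2)
qed

lift_definition l2_inner :: "l2 \<Rightarrow> l2 \<Rightarrow> complex"
  is "\<lambda>f g. \<integral>x. f x * cnj (g x) \<partial>lebesgue"
proof -
  fix f f' g g' assume a: "l2_eq f f'" "l2_eq g g'"
  then have "f \<in> borel_measurable lebesgue" "f' \<in> borel_measurable lebesgue"
     "g \<in> borel_measurable lebesgue" "g' \<in> borel_measurable lebesgue"
    by (auto simp: l2_eq_def sq_int_def)
  moreover have "(\<lambda>x. cnj (h x)) \<in> borel_measurable lebesgue"
    if "h \<in> borel_measurable lebesgue" for h :: "real \<Rightarrow> complex"
    using that by (rule cnj_measurable)
  moreover have "AE x in lebesgue. f x * cnj (g x) = f' x * cnj (g' x)"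
    using a by (auto simp: l2_eq_def elim: eventually_elim2)
  ultimately show "(\<integral>x. f x * cnj (g x) \<partial>lebesgue) = (\<integral>x. f' x * cnj (g' x) \<partial>lebesgue)"
    by (intro integral_cong_AE) auto
qed

lift_definition l2_scaleC :: "complex \<Rightarrow> l2 \<Rightarrow> l2" is "\<lambda>c f x. c * f x"
  by (auto simp: l2_eq_def sq_int_cmult elim: eventually_mono)

text \<open>The topology of the Hilbert space is supplied by the library class \<open>real_inner\<close>:
  its real inner product is the real part of \<^const>\<open>l2_inner\<close>, so its norm is the usual one.\<close>

instantiation l2 :: real_vector
begin

lift_definition zero_l2 :: l2 is "\<lambda>x. 0"
  by (simp add: l2_eq_def sq_int_zero)

lift_definition plus_l2 :: "l2 \<Rightarrow> l2 \<Rightarrow> l2" is "\<lambda>f g x. f x + g x"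
  by (auto simp: l2_eq_def sq_int_add elim: eventually_elim2)

lift_definition uminus_l2 :: "l2 \<Rightarrow> l2" is "\<lambda>f x. - f x"
  by (auto simp: l2_eq_def sq_int_def elim: eventually_mono)

definition minus_l2 :: "l2 \<Rightarrow> l2 \<Rightarrow> l2" where "minus_l2 f g = f + - g"

definition scaleR_l2 :: "real \<Rightarrow> l2 \<Rightarrow> l2" where "scaleR_l2 a f = l2_scaleC (of_real a) f"

instance
proof
  fix x y z :: l2 and a b :: real
  show "x + y + z = x + (y + z)"
    by transfer (auto simp: l2_eq_def algebra_simps intro!: sq_int_add)
  show "x + y = y + x"
    by transfer (auto simp: l2_eq_def algebra_simps intro!: sq_int_add)
  show "0 + x = x"
    by transfer (auto simp: l2_eq_def algebra_simps intro!: sq_int_add)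
  show "- x + x = 0"
    by transfer (auto simp: l2_eq_def sq_int_zero)
  show "x - y = x + - y" by (simp add: minus_l2_def)
  show "a *\<^sub>R (x + y) = a *\<^sub>R x + a *\<^sub>R y"
    unfolding scaleR_l2_def
    by transfer (auto simp: l2_eq_def distrib_left intro!: sq_int_add sq_int_cmult)
  show "(a + b) *\<^sub>R x = a *\<^sub>R x + b *\<^sub>R x"
    unfolding scaleR_l2_def
    by transfer (auto simp: l2_eq_def distrib_right intro!: sq_int_add sq_int_cmult)
  show "a *\<^sub>R b *\<^sub>R x = (a * b) *\<^sub>R x"
    unfolding scaleR_l2_def
    by transfer (auto simp: l2_eq_def mult.assoc intro!: sq_int_cmult)
  show "1 *\<^sub>R x = x"
    unfolding scaleR_l2_def
    by transfer (auto simp: l2_eq_def)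
qed

end

instantiation l2 :: real_inner
begin

definition inner_l2 :: "l2 \<Rightarrow> l2 \<Rightarrow> real" where "inner_l2 f g = Re (l2_inner f g)"

definition norm_l2 :: "l2 \<Rightarrow> real" where "norm_l2 f = sqrt (inner f f)"

definition sgn_l2 :: "l2 \<Rightarrow> l2" where "sgn_l2 f = f /\<^sub>R norm f"

definition dist_l2 :: "l2 \<Rightarrow> l2 \<Rightarrow> real" where "dist_l2 f g = norm (f - g)"

definition uniformity_l2 :: "(l2 \<times> l2) filter" where
  "uniformity_l2 = (INF e\<in>{0 <..}. principal {(x, y). dist x y < e})"

definition open_l2 :: "l2 set \<Rightarrow> bool" where
  "open_l2 U = (\<forall>x\<in>U. eventually (\<lambda>(x', y). x' = x \<longrightarrow> y \<in> U) uniformity)"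

instance
proof
  fix x y z :: l2 and a :: real
  show "sgn x = x /\<^sub>R norm x" by (simp add: sgn_l2_def)
  show "dist x y = norm (x - y)" by (simp add: dist_l2_def)
  show "uniformity = (INF e\<in>{0 <..}. principal {(x::l2, y). dist x y < e})"
    by (simp add: uniformity_l2_def)
  show "open U = (\<forall>x\<in>U. eventually (\<lambda>(x', y). x' = x \<longrightarrow> y \<in> U) uniformity)" for U :: "l2 set"
    by (simp add: open_l2_def)
  show "norm x = sqrt (inner x x)" by (simp add: norm_l2_def)
  show "inner x y = inner y x"
    unfolding inner_l2_def
  proof transfer
    fix f g assume "l2_eq f f" "l2_eq g g"
    then have i: "integrable lebesgue (\<lambda>x. f x * cnj (g x))" "integrable lebesgue (\<lambda>x. g x * cnj (f x))"
      by (auto simp: l2_eq_def intro!: sq_int_inner)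
    show "Re (\<integral>x. f x * cnj (g x) \<partial>lebesgue) = Re (\<integral>x. g x * cnj (f x) \<partial>lebesgue)"
      unfolding integral_Re[OF i(1), symmetric] integral_Re[OF i(2), symmetric]
      by (simp add: mult.commute add.commute)
  qed
  show "inner (x + y) z = inner x z + inner y z"
    unfolding inner_l2_def
  proof transfer
    fix f g h assume "l2_eq f f" "l2_eq g g" "l2_eq h h"
    then have "integrable lebesgue (\<lambda>x. f x * cnj (h x))" "integrable lebesgue (\<lambda>x. g x * cnj (h x))"
      by (auto simp: l2_eq_def intro!: sq_int_inner)
    then show "Re (\<integral>x. (f x + g x) * cnj (h x) \<partial>lebesgue)
        = Re (\<integral>x. f x * cnj (h x) \<partial>lebesgue) + Re (\<integral>x. g x * cnj (h x) \<partial>lebesgue)"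
      by (simp add: distrib_right)
  qed
  show "inner (a *\<^sub>R x) y = a * inner x y"
    unfolding inner_l2_def scaleR_l2_def
    by transfer (simp add: mult.assoc)
  have sq: "z * cnj z = of_real ((cmod z)\<^sup>2)" for z
    by (rule complex_norm_square[symmetric])
  show "0 \<le> inner x x"
    unfolding inner_l2_def
  proof transfer
    fix f :: "real \<Rightarrow> complex"
    show "0 \<le> Re (\<integral>x. f x * cnj (f x) \<partial>lebesgue)"
      unfolding sq integral_complex_of_real by (simp add: integral_nonneg_AE)
  qed
  show "(inner x x = 0) = (x = 0)"
    unfolding inner_l2_def
  proof transfer
    fix f assume "l2_eq f f"
    then have "sq_int f" by (simp add: l2_eq_def)
    then have "integrable lebesgue (\<lambda>x. (cmod (f x))\<^sup>2)" by (simp add: sq_int_def)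
    from integral_nonneg_eq_0_iff_AE[OF this]
    show "(Re (\<integral>x. f x * cnj (f x) \<partial>lebesgue) = 0) = l2_eq f (\<lambda>x. 0)"
      unfolding sq integral_complex_of_real
      using \<open>sq_int f\<close> by (simp add: l2_eq_def sq_int_zero)
  qed
qed

end


section \<open>Unbounded operators, represented by their graphs\<close>

type_synonym l2_op = "(l2 \<times> l2) set"

definition linear_operator :: "l2_op \<Rightarrow> bool" where
  "linear_operator T \<longleftrightarrow>
     single_valued T \<and> (0, 0) \<in> T \<and>
     (\<forall>f g f' g'. (f, g) \<in> T \<longrightarrow> (f', g') \<in> T \<longrightarrow> (f + f', g + g') \<in> T) \<and>
     (\<forall>c f g. (f, g) \<in> T \<longrightarrow> (l2_scaleC c f, l2_scaleC c g) \<in> T)"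

definition densely_defined :: "l2_op \<Rightarrow> bool" where
  "densely_defined T \<longleftrightarrow> linear_operator T \<and> closure (Domain T) = UNIV"

definition adjoint_op :: "l2_op \<Rightarrow> l2_op" where
  "adjoint_op T = {(v, w). \<forall>(u, t)\<in>T. l2_inner t v = l2_inner u w}"

definition closed_operator :: "l2_op \<Rightarrow> bool" where
  "closed_operator T \<longleftrightarrow> linear_operator T \<and> closed T"

definition closable_operator :: "l2_op \<Rightarrow> bool" where
  "closable_operator T \<longleftrightarrow> linear_operator T \<and> linear_operator (closure T)"


section \<open>Local function spaces\<close>

definition L1_loc :: "(real \<Rightarrow> complex) \<Rightarrow> bool" where
  "L1_loc f \<longleftrightarrow> (\<forall>a b. set_integrable lebesgue {a..b} f)"

definition L2_loc :: "(real \<Rightarrow> complex) \<Rightarrow> bool" where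
  "L2_loc f \<longleftrightarrow> f \<in> borel_measurable lebesgue \<and>
     (\<forall>a b. set_integrable lebesgue {a..b} (\<lambda>x. (cmod (f x))\<^sup>2))"

definition abs_cont_on :: "real \<Rightarrow> real \<Rightarrow> (real \<Rightarrow> complex) \<Rightarrow> bool" where
  "abs_cont_on a b f \<longleftrightarrow>
     (\<forall>\<epsilon>>0. \<exists>\<delta>>0. \<forall>(n::nat) c d.
        (\<forall>i<n. a \<le> c i \<and> c i \<le> d i \<and> d i \<le> b) \<and>
        disjoint_family_on (\<lambda>i. {c i<..<d i}) {..<n} \<and>
        (\<Sum>i<n. d i - c i) < \<delta>
        \<longrightarrow> (\<Sum>i<n. cmod (f (d i) - f (c i))) < \<epsilon>)"

definition AC_loc :: "(real \<Rightarrow> complex) \<Rightarrow> bool" where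
  "AC_loc f \<longleftrightarrow> (\<forall>a b. abs_cont_on a b f)"

definition compactly_supported :: "(real \<Rightarrow> 'a::zero) \<Rightarrow> bool" where
  "compactly_supported f \<longleftrightarrow> compact (closure {x. f x \<noteq> 0})"

definition test_function :: "(real \<Rightarrow> real) \<Rightarrow> bool" where
  "test_function \<phi> \<longleftrightarrow>
     (\<forall>n x. (deriv ^^ n) \<phi> field_differentiable at x) \<and> compactly_supported \<phi>"

text \<open>\<open>g\<close> is the \<open>j\<close>-th distributional derivative of \<open>f\<close>; real-valued test functions suffice by
  linearity.\<close>

definition weak_deriv :: "nat \<Rightarrow> (real \<Rightarrow> complex) \<Rightarrow> (real \<Rightarrow> complex) \<Rightarrow> bool" where
  "weak_deriv j f g \<longleftrightarrow>
     (\<forall>\<phi>. test_function \<phi> \<longrightarrow>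
        (\<integral>x. f x * of_real ((deriv ^^ j) \<phi> x) \<partial>lebesgue) =
        (- 1) ^ j * (\<integral>x. g x * of_real (\<phi> x) \<partial>lebesgue))"

definition W2_loc :: "nat \<Rightarrow> (real \<Rightarrow> complex) set" where
  "W2_loc k = {f. L2_loc f \<and> (\<forall>j\<le>k. \<exists>g. L2_loc g \<and> weak_deriv j f g)}"

definition W2_comp :: "nat \<Rightarrow> (real \<Rightarrow> complex) set" where
  "W2_comp k = {f \<in> W2_loc k. compactly_supported f}"


section \<open>Quasi-derivatives and the operators they generate\<close>

abbreviation vderiv :: "(real \<Rightarrow> complex) \<Rightarrow> real \<Rightarrow> complex" where
  "vderiv u x \<equiv> vector_derivative u (at x)"

text \<open>The quasi-derivatives are defined for general coefficients \<open>A\<close>, \<open>B\<close>, \<open>c\<close>: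
  \<^item> \<open>u\<^sup>[\<^sup>1\<^sup>] = u' - A u\<close>,
  \<^item> \<open>u\<^sup>[\<^sup>2\<^sup>] = (u\<^sup>[\<^sup>1\<^sup>])' + B u\<^sup>[\<^sup>1\<^sup>] + (A B - c) u\<close>.

  The expression \<open>l\<close> is the case \<open>A = G\<^sub>1\<close>, \<open>B = G\<^sub>2\<close>, \<open>c = s\<close>; the formally adjoint expression is the
  case in which \<open>A\<close>, \<open>B\<close>, \<open>c\<close> are the conjugates of \<open>G\<^sub>2\<close>, \<open>G\<^sub>1\<close>, \<open>s\<close>.

  Since \<open>A\<close> and \<open>u'\<close> are determined only almost everywhere, so is \<open>u' - A u\<close>; membership of the
  first quasi-derivative in \<open>AC\<^sub>l\<^sub>o\<^sub>c\<close> means that it agrees almost everywhere with a locally absolutely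
  continuous function. That function is unique, and \<open>qderiv1\<close> denotes it, so that its point
  values (which enter the boundary form) are meaningful. Where \<open>u\<close> is not differentiable, the
  library's \<^const>\<open>vector_derivative\<close> is an unspecified value; for absolutely continuous functions
  this affects only a null set.\<close>

definition is_qderiv1 :: "(real \<Rightarrow> complex) \<Rightarrow> (real \<Rightarrow> complex) \<Rightarrow> (real \<Rightarrow> complex) \<Rightarrow> bool" where
  "is_qderiv1 A u w \<longleftrightarrow> AC_loc w \<and> (AE x in lebesgue. w x = vderiv u x - A x * u x)"

definition qderiv1 :: "(real \<Rightarrow> complex) \<Rightarrow> (real \<Rightarrow> complex) \<Rightarrow> real \<Rightarrow> complex" where
  "qderiv1 A u = (THE w. is_qderiv1 A u w)"

definition qderiv2 ::
    "(real \<Rightarrow> complex) \<Rightarrow> (real \<Rightarrow> complex) \<Rightarrow> (real \<Rightarrow> complex) \<Rightarrow> (real \<Rightarrow> complex) \<Rightarrow> real \<Rightarrow> complex" where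
  "qderiv2 A B c u x =
     vderiv (qderiv1 A u) x + B x * qderiv1 A u x + (A x * B x - c x) * u x"

definition qexpr ::
    "(real \<Rightarrow> complex) \<Rightarrow> (real \<Rightarrow> complex) \<Rightarrow> (real \<Rightarrow> complex) \<Rightarrow> (real \<Rightarrow> complex) \<Rightarrow> real \<Rightarrow> complex" where
  "qexpr A B c u x = - qderiv2 A B c u x"

text \<open>Domains are sets of genuine functions, namely the (unique) locally absolutely continuous
  representatives; the operators themselves are graphs in the Hilbert space. In names below,
  \<open>Lp\<close> stands for the operator generated by the formally adjoint expression.\<close>

definition max_dom ::
    "(real \<Rightarrow> complex) \<Rightarrow> (real \<Rightarrow> complex) \<Rightarrow> (real \<Rightarrow> complex) \<Rightarrow> (real \<Rightarrow> complex) set" where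
  "max_dom A B c = {u. sq_int u \<and> AC_loc u \<and> (\<exists>w. is_qderiv1 A u w) \<and> sq_int (qexpr A B c u)}"

definition premin_dom ::
    "(real \<Rightarrow> complex) \<Rightarrow> (real \<Rightarrow> complex) \<Rightarrow> (real \<Rightarrow> complex) \<Rightarrow> (real \<Rightarrow> complex) set" where
  "premin_dom A B c = {u \<in> max_dom A B c. compactly_supported u}"

definition qop_on ::
    "(real \<Rightarrow> complex) set \<Rightarrow> (real \<Rightarrow> complex) \<Rightarrow> (real \<Rightarrow> complex) \<Rightarrow> (real \<Rightarrow> complex) \<Rightarrow> l2_op" where
  "qop_on D A B c = (\<lambda>u. (abs_l2 u, abs_l2 (qexpr A B c u))) ` D"

definition G1 :: "(real \<Rightarrow> complex) \<Rightarrow> (real \<Rightarrow> complex) \<Rightarrow> real \<Rightarrow> complex" where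
  "G1 Q r x = Q x + \<i> * r x"

definition G2 :: "(real \<Rightarrow> complex) \<Rightarrow> (real \<Rightarrow> complex) \<Rightarrow> real \<Rightarrow> complex" where
  "G2 Q r x = Q x - \<i> * r x"

context
  fixes s Q r :: "real \<Rightarrow> complex"
begin

definition lexpr :: "(real \<Rightarrow> complex) \<Rightarrow> real \<Rightarrow> complex" where
  "lexpr = qexpr (G1 Q r) (G2 Q r) s"

definition dom_L :: "(real \<Rightarrow> complex) set" where
  "dom_L = max_dom (G1 Q r) (G2 Q r) s"

definition dom_Lp :: "(real \<Rightarrow> complex) set" where
  "dom_Lp = max_dom (cnj \<circ> G2 Q r) (cnj \<circ> G1 Q r) (cnj \<circ> s)"

definition dom_L00 :: "(real \<Rightarrow> complex) set" where
  "dom_L00 = premin_dom (G1 Q r) (G2 Q r) s"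

definition dom_Lp00 :: "(real \<Rightarrow> complex) set" where
  "dom_Lp00 = premin_dom (cnj \<circ> G2 Q r) (cnj \<circ> G1 Q r) (cnj \<circ> s)"

definition op_L :: l2_op where
  "op_L = qop_on dom_L (G1 Q r) (G2 Q r) s"

definition op_Lp :: l2_op where
  "op_Lp = qop_on dom_Lp (cnj \<circ> G2 Q r) (cnj \<circ> G1 Q r) (cnj \<circ> s)"

definition op_L00 :: l2_op where
  "op_L00 = qop_on dom_L00 (G1 Q r) (G2 Q r) s"

definition op_Lp00 :: l2_op where
  "op_Lp00 = qop_on dom_Lp00 (cnj \<circ> G2 Q r) (cnj \<circ> G1 Q r) (cnj \<circ> s)"

definition op_L0 :: l2_op where
  "op_L0 = closure op_L00"

definition op_Lp0 :: l2_op where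
  "op_Lp0 = closure op_Lp00"

end

text \<open>The boundary form \<open>[u, v]\<close> and its increment from minus to plus infinity; on the
  maximal domains both limits exist.\<close>

definition bracket ::
    "(real \<Rightarrow> complex) \<Rightarrow> (real \<Rightarrow> complex) \<Rightarrow> (real \<Rightarrow> complex) \<Rightarrow> (real \<Rightarrow> complex) \<Rightarrow> real \<Rightarrow> complex" where
  "bracket Q r u v x =
     u x * cnj (qderiv1 (cnj \<circ> G2 Q r) v x) - qderiv1 (G1 Q r) u x * cnj (v x)"

definition bracket_inf ::
    "(real \<Rightarrow> complex) \<Rightarrow> (real \<Rightarrow> complex) \<Rightarrow> (real \<Rightarrow> complex) \<Rightarrow> (real \<Rightarrow> complex) \<Rightarrow> complex" where
  "bracket_inf Q r u v = Lim at_top (bracket Q r u v) - Lim at_bot (bracket Q r u v)"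

end

theory Submission
  imports Defs
begin

text \<open>
  Why the theorem holds. Write \<open>A = G\<^sub>1\<close>, \<open>B = G\<^sub>2\<close>, \<open>c = s\<close>. With \<open>w = u\<^sup>[\<^sup>1\<^sup>]\<close>, the equation \<open>l[u] = f\<close> is the
  first-order system \<open>u' = A u + w\<close>, \<open>w' = - B w - (A B - c) u - f\<close>, whose coefficients are only
  locally integrable (\<open>quasi_solution\<close>). The formally adjoint expression has the same shape, with
  \<open>A\<close>, \<open>B\<close>, \<open>c\<close> replaced by the conjugates of \<open>B\<close>, \<open>A\<close>, \<open>c\<close>, and repeating this replacement
  gives back \<open>A\<close>, \<open>B\<close>, \<open>c\<close>. Hence each statement is proved once, for general coefficients, and
  then used for both expressions.

  If \<open>l[u] = f\<close> and \<open>l\<^sup>+[v] = g\<close>, with quasi-derivatives \<open>w\<close> and \<open>z\<close>, the product rule gives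
  \<open>(u cnj z - w cnj v)' = f cnj v - u cnj g\<close> (\<open>Lagrange_identity\<close>): the boundary form is a
  primitive. On the maximal domains the right-hand side is integrable, so the boundary form has
  limits at both ends and \<open>(L u, v) - (u, L\<^sup>+ v)\<close> is its increment over the line. For compactly
  supported \<open>u\<close> the increment vanishes, which shows that \<open>L\<^sup>+\<close> is contained in the adjoint of
  \<open>L\<^sub>0\<^sub>0\<close>.

  The reverse inclusion is the heart of the matter (\<open>adjoint_preminimal_local_solution\<close>). Let
  \<open>(v, g)\<close> belong to the adjoint of \<open>L\<^sub>0\<^sub>0\<close>, fix an interval \<open>[-R, R]\<close>, let \<open>y\<^sub>0\<close> solve
  \<open>l\<^sup>+[y\<^sub>0] = g\<close>, and let \<open>y\<^sub>1\<close>, \<open>y\<^sub>2\<close> be the homogeneous solutions with data \<open>(1, 0)\<close> and \<open>(0, 1)\<close>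
  at \<open>R\<close>. Subtract from \<open>v - y\<^sub>0\<close>, restricted to the interval, its orthogonal projection onto the
  span of \<open>y\<^sub>1\<close>, \<open>y\<^sub>2\<close>, and call the rest \<open>p\<close>. Solve \<open>l[u] = p\<close> with zero data at \<open>-R\<close>. Since
  \<open>p\<close> is orthogonal to \<open>y\<^sub>1\<close> and \<open>y\<^sub>2\<close>, Lagrange's identity makes the data of \<open>u\<close> at \<open>R\<close> vanish
  as well, so that \<open>u\<close>, cut off to the interval, lies in the domain of \<open>L\<^sub>0\<^sub>0\<close>. The adjoint
  relation for this \<open>u\<close>, compared with Lagrange's identity for \<open>u\<close> and \<open>y\<^sub>0\<close>, says that \<open>p\<close> is
  orthogonal to \<open>v - y\<^sub>0\<close>. So \<open>p\<close> is orthogonal to itself, and \<open>v\<close> agrees on the interval with a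
  solution of \<open>l\<^sup>+[y] = g\<close>. The solutions for growing \<open>R\<close> glue together.

  The other statements about the operators are Hilbert space theory. A linear graph whose adjoint
  is single-valued is densely defined, and its double adjoint is its closure; thus \<open>L\<^sub>0\<close> is the
  adjoint of \<open>L\<^sup>+\<close>, and the description of its domain is Lagrange's identity over the whole line.
  The formula for \<open>(L\<^sub>0\<^sub>0 u, u)\<close> comes from integrating the derivative of \<open>w cnj u\<close>.

  Three bodies of theory carry this argument: the fundamental theorem of calculus for absolutely
  continuous functions (a monotone absolutely continuous function is the distribution function of
  a measure that has a Radon-Nikodym density, and the general case reduces to this one through the
  variation), global solvability of linear systems with locally integrable coefficients (Banach's
  fixed point theorem in a weighted sup norm), and completeness of the space \<open>l2\<close>.
\<close>

section \<open>Primitives and their derivatives\<close>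

text \<open>Disjoint intervals inside \<open>[a, b]\<close>, ordered from left to right, have increments of a monotone
  function that telescope up to nonnegative gaps. For the identity this bounds the total length.\<close>

lemma mono_sum_disjoint_intervals_le:
  fixes H :: "real \<Rightarrow> real" and c d :: "'i \<Rightarrow> real"
  assumes "finite J" and "mono H" and "a \<le> b"
    and "\<And>j. j \<in> J \<Longrightarrow> a \<le> c j \<and> c j \<le> d j \<and> d j \<le> b"
    and "disjoint_family_on (\<lambda>j. {c j<..<d j}) J"
  shows "(\<Sum>j\<in>J. H (d j) - H (c j)) \<le> H b - H a"
  using assms
proof (induction "card J" arbitrary: J b)
  case 0
  then show ?case by (auto simp: monoD)
next
  case (Suc n)
  then have "J \<noteq> {}" by auto
  \<comment> \<open>\<open>j\<close> has the largest left end point: all other intervals lie to its left, inside \<open>[a, c j]\<close>.\<close>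
  obtain j where j: "j \<in> J" "\<And>i. i \<in> J \<Longrightarrow> c i \<le> c j"
  proof -
    have "Max (c ` J) \<in> c ` J" using \<open>J \<noteq> {}\<close> Suc.prems(1) by (intro Max_in) auto
    then obtain j where "j \<in> J" "Max (c ` J) = c j" by auto
    moreover have "c i \<le> Max (c ` J)" if "i \<in> J" for i using that Suc.prems(1) by (intro Max_ge) auto
    ultimately show ?thesis using that by metis
  qed
  have card: "n = card (J - {j})" using Suc.hyps(2) j Suc.prems(1) by simp
  have dis: "disjoint_family_on (\<lambda>j. {c j<..<d j}) (J - {j})"
    using Suc.prems(5) by (rule disjoint_family_on_mono[rotated]) auto
  have split: "(\<Sum>j\<in>J. H (d j) - H (c j)) = H (d j) - H (c j) + (\<Sum>i\<in>J - {j}. H (d i) - H (c i))"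
    using Suc.prems(1) j(1) by (rule sum.remove)
  show ?case
  proof (cases "c j < d j")
    case True
    have "d i \<le> c j" if "i \<in> J - {j}" for i
    proof (rule ccontr)
      assume "\<not> d i \<le> c j"
      with True have "(c j + min (d i) (d j)) / 2 \<in> {c i<..<d i} \<inter> {c j<..<d j}"
        using j(2)[of i] that by (auto simp: min_def field_simps)
      moreover have "{c i<..<d i} \<inter> {c j<..<d j} = {}"
        using Suc.prems(5) that j(1) by (auto simp: disjoint_family_on_def)
      ultimately show False by blast
    qed
    then have "(\<Sum>i\<in>J - {j}. H (d i) - H (c i)) \<le> H (c j) - H a"
      using Suc.prems j by (intro Suc.hyps(1)[OF card _ _ _ _ dis]) auto
    moreover have "H (d j) \<le> H b" using Suc.prems j by (intro monoD[OF Suc.prems(2)]) auto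
    ultimately show ?thesis using split by linarith
  next
    case False
    then have "d j = c j" using Suc.prems(4)[OF j(1)] by auto
    moreover have "(\<Sum>i\<in>J - {j}. H (d i) - H (c i)) \<le> H b - H a"
      using Suc.prems by (intro Suc.hyps(1)[OF card _ _ _ _ dis]) auto
    ultimately show ?thesis using split by simp
  qed
qed

text \<open>The indefinite Lebesgue integral, written with the gauge integral. The value type is general
  because densities are real, solutions are complex, and first-order systems are pair-valued.\<close>

definition primitive_of :: "(real \<Rightarrow> 'a::euclidean_space) \<Rightarrow> (real \<Rightarrow> 'a) \<Rightarrow> bool" where
  "primitive_of u g \<longleftrightarrow> (\<forall>a b. g absolutely_integrable_on {a..b}) \<and>
     (\<forall>a b. a \<le> b \<longrightarrow> u b - u a = integral {a..b} g)"

lemma right_left_derivative_imp_vector_derivative: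
  fixes u :: "real \<Rightarrow> 'a::real_normed_vector"
  assumes r: "\<And>e. e > 0 \<Longrightarrow> \<exists>d>0. \<forall>h. 0 < h \<and> h < d \<longrightarrow> norm ((u (x + h) - u x) /\<^sub>R h - g) < e"
    and l: "\<And>e. e > 0 \<Longrightarrow> \<exists>d>0. \<forall>h. 0 < h \<and> h < d \<longrightarrow> norm ((u x - u (x - h)) /\<^sub>R h - g) < e"
  shows "(u has_vector_derivative g) (at x)"
  unfolding has_vector_derivative_def has_derivative_at_alt
proof (intro conjI allI impI)
  show "bounded_linear (\<lambda>t. t *\<^sub>R g)" by (simp add: bounded_linear_scaleR_left)
  fix e :: real assume e: "e > 0"
  obtain d1 where d1: "d1 > 0" "\<And>h. 0 < h \<Longrightarrow> h < d1 \<Longrightarrow> norm ((u (x + h) - u x) /\<^sub>R h - g) < e"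
    using r[OF e] by blast
  obtain d2 where d2: "d2 > 0" "\<And>h. 0 < h \<Longrightarrow> h < d2 \<Longrightarrow> norm ((u x - u (x - h)) /\<^sub>R h - g) < e"
    using l[OF e] by blast
  have *: "norm (w - h *\<^sub>R g) \<le> e * h" if "norm (w /\<^sub>R h - g) < e" "h > 0" for w :: 'a and h :: real
  proof -
    have "w - h *\<^sub>R g = h *\<^sub>R (w /\<^sub>R h - g)" using that(2) by (simp add: scaleR_diff_right)
    then have "norm (w - h *\<^sub>R g) = h * norm (w /\<^sub>R h - g)" using that(2) by simp
    also have "\<dots> \<le> h * e" using that by (intro mult_left_mono) auto
    finally show ?thesis by (simp add: mult.commute)
  qed
  show "\<exists>d>0. \<forall>y. norm (y - x) < d \<longrightarrow> norm (u y - u x - (y - x) *\<^sub>R g) \<le> e * norm (y - x)"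
  proof (intro exI[of _ "min d1 d2"] conjI allI impI)
    fix y assume y: "norm (y - x) < min d1 d2"
    consider "y = x" | "y > x" | "y < x" by linarith
    then show "norm (u y - u x - (y - x) *\<^sub>R g) \<le> e * norm (y - x)"
    proof cases
      case 2
      then show ?thesis using *[OF d1(2)[of "y - x"]] y by auto
    next
      case 3
      have "norm (u x - u y - (x - y) *\<^sub>R g) \<le> e * (x - y)"
        using *[OF d2(2)[of "x - y"]] y 3 by auto
      moreover have "norm (u x - u y - (x - y) *\<^sub>R g) = norm (u y - u x - (y - x) *\<^sub>R g)"
        by (subst norm_minus_cancel[symmetric]) (simp add: algebra_simps)
      ultimately show ?thesis using 3 by simp
    qed simp
  qed (use d1 d2 in auto)
qed

text \<open>The one-dimensional case of Lebesgue's differentiation theorem along one-sided intervals; the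
  left-hand derivative follows by reflecting the line.\<close>

lemma integral_right_derivative_AE:
  fixes g :: "real \<Rightarrow> 'a::euclidean_space"
  assumes g: "\<And>a b. g integrable_on {a..b}"
  shows "AE x in lebesgue. \<forall>e>0. \<exists>d>0. \<forall>h. 0 < h \<and> h < d \<longrightarrow> norm (integral {x..x+h} g /\<^sub>R h - g x) < e"
proof -
  obtain N where N: "negligible N"
    "\<And>x e. \<lbrakk>x \<notin> N; 0 < e\<rbrakk> \<Longrightarrow> \<exists>d>0. \<forall>h. 0 < h \<and> h < d \<longrightarrow>
       norm (integral (cbox x (x + h *\<^sub>R One)) g /\<^sub>R h ^ DIM(real) - g x) < e"
    using integrable_ccontinuous_explicit[of g] g by (metis box_real(2))
  then show ?thesis
    unfolding eventually_ae_filter_negligible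
  proof (intro exI[of _ N] conjI subsetI)
    fix x assume "x \<in> {x. \<not> (\<forall>e>0. \<exists>d>0. \<forall>h. 0 < h \<and> h < d \<longrightarrow> norm (integral {x..x+h} g /\<^sub>R h - g x) < e)}"
    then show "x \<in> N" using N(2)[of x] by (auto simp del: not_all not_ex)
  qed
qed

lemma AE_lebesgue_reflect:
  assumes "AE x in lebesgue. P (- x :: real)"
  shows "AE x in lebesgue. P x"
proof -
  obtain N where N: "negligible N" "{x. \<not> P (- x)} \<subseteq> N"
    using assms unfolding eventually_ae_filter_negligible by auto
  have "negligible (uminus ` N)"
    using N(1) by (intro negligible_differentiable_image_negligible) (auto intro!: derivative_intros)
  moreover have "{x. \<not> P x} \<subseteq> uminus ` N"
  proof
    fix x assume "x \<in> {x. \<not> P x}"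
    then have "- x \<in> N" using N(2) by auto
    then show "x \<in> uminus ` N" by (metis image_eqI minus_minus)
  qed
  ultimately show ?thesis unfolding eventually_ae_filter_negligible by blast
qed

lemma primitive_of_derivative_AE:
  fixes u :: "real \<Rightarrow> 'a::euclidean_space"
  assumes "primitive_of u g"
  shows "AE x in lebesgue. (u has_vector_derivative g x) (at x)"
proof -
  have g: "g integrable_on {a..b}" for a b
    using assms by (auto simp: primitive_of_def absolutely_integrable_on_def)
  have u: "u b - u a = integral {a..b} g" if "a \<le> b" for a b
    using assms that by (auto simp: primitive_of_def)
  have g': "(\<lambda>x. g (- x)) integrable_on {a..b}" for a b
    using g[of "-b" "-a"] Henstock_Kurzweil_Integration.integrable_reflect_real[where f=g and a="-b" and b="-a"] by simp
  have R: "AE x in lebesgue. \<forall>e>0. \<exists>d>0. \<forall>h. 0 < h \<and> h < d \<longrightarrow> norm ((u (x + h) - u x) /\<^sub>R h - g x) < e"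
    using integral_right_derivative_AE[OF g] by (simp add: u)
  have "AE x in lebesgue. \<forall>e>0. \<exists>d>0. \<forall>h. 0 < h \<and> h < d \<longrightarrow> norm ((u (- x) - u (- x - h)) /\<^sub>R h - g (- x)) < e"
    using integral_right_derivative_AE[OF g']
  proof eventually_elim
    case (elim x)
    have "integral {x..x+h} (\<lambda>x. g (- x)) = u (- x) - u (- x - h)" if "h > 0" for h
      using Henstock_Kurzweil_Integration.integral_reflect_real[where b="-x" and a="-x-h" and f=g] u[of "-x-h" "-x"] that
      by (simp add: add.commute)
    then show ?case using elim by auto
  qed
  then have L: "AE x in lebesgue. \<forall>e>0. \<exists>d>0. \<forall>h. 0 < h \<and> h < d \<longrightarrow> norm ((u x - u (x - h)) /\<^sub>R h - g x) < e"
    by (rule AE_lebesgue_reflect)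
  from R L show ?thesis
    by eventually_elim (rule right_left_derivative_imp_vector_derivative, auto)
qed


section \<open>The variation of an absolutely continuous function\<close>

text \<open>Absolute continuity for families over an arbitrary index type: a family of subfamilies is
  naturally indexed by pairs.\<close>

lemma abs_cont_on_finite_family:
  assumes f: "abs_cont_on a b f" and "\<epsilon> > 0"
  shows "\<exists>\<delta>>0. \<forall>(I :: 'i set) c d. finite I \<longrightarrow> (\<forall>i\<in>I. a \<le> c i \<and> c i \<le> d i \<and> d i \<le> b) \<longrightarrow>
    disjoint_family_on (\<lambda>i. {c i<..<d i}) I \<longrightarrow> (\<Sum>i\<in>I. d i - c i) < \<delta> \<longrightarrow>
    (\<Sum>i\<in>I. cmod (f (d i) - f (c i))) < \<epsilon>"
proof -
  obtain \<delta> where \<delta>: "\<delta> > 0" "\<forall>(n::nat) c d. (\<forall>i<n. a \<le> c i \<and> c i \<le> d i \<and> d i \<le> b) \<and>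
      disjoint_family_on (\<lambda>i. {c i<..<d i}) {..<n} \<and> (\<Sum>i<n. d i - c i) < \<delta> \<longrightarrow>
      (\<Sum>i<n. cmod (f (d i) - f (c i))) < \<epsilon>"
    using f \<open>\<epsilon> > 0\<close> unfolding abs_cont_on_def by blast
  show ?thesis
  proof (intro exI[of _ \<delta>] conjI allI impI \<delta>(1))
    fix I :: "'i set" and c d :: "'i \<Rightarrow> real"
    assume I: "finite I" "\<forall>i\<in>I. a \<le> c i \<and> c i \<le> d i \<and> d i \<le> b"
      "disjoint_family_on (\<lambda>i. {c i<..<d i}) I" "(\<Sum>i\<in>I. d i - c i) < \<delta>"
    obtain h where h: "bij_betw h {..<card I} I"
      using I(1) by (metis ex_bij_betw_nat_finite atLeast0LessThan)
    have eq: "(\<Sum>i<card I. F (h i)) = (\<Sum>i\<in>I. F i)" for F :: "'i \<Rightarrow> real"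
      using h by (rule sum.reindex_bij_betw)
    have "disjoint_family_on (\<lambda>i. {c (h i)<..<d (h i)}) {..<card I}"
      using I(3) h unfolding disjoint_family_on_def bij_betw_def inj_on_def by blast
    moreover have "\<forall>i<card I. a \<le> c (h i) \<and> c (h i) \<le> d (h i) \<and> d (h i) \<le> b"
      using I(2) h by (auto simp: bij_betw_def)
    ultimately have "(\<Sum>i<card I. cmod (f (d (h i)) - f (c (h i)))) < \<epsilon>"
      using I(4) by (intro \<delta>(2)[rule_format]) (auto simp: eq[of "\<lambda>i. d i - c i"])
    then show "(\<Sum>i\<in>I. cmod (f (d i) - f (c i))) < \<epsilon>"
      by (simp add: eq[of "\<lambda>i. cmod (f (d i) - f (c i))"])
  qed
qed

text \<open>Sums over finite families of disjoint intervals replace sums over partitions, so that the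
  variation can be compared directly with the definition of absolute continuity.\<close>

definition variation_sums :: "(real \<Rightarrow> complex) \<Rightarrow> real \<Rightarrow> real \<Rightarrow> real set" where
  "variation_sums f x y = {\<Sum>j\<in>J. cmod (f (d j) - f (c j)) | J c d.
     finite (J :: nat set) \<and> (\<forall>j\<in>J. x \<le> c j \<and> c j \<le> d j \<and> d j \<le> y) \<and>
     disjoint_family_on (\<lambda>j. {c j<..<d j}) J}"

definition variation :: "(real \<Rightarrow> complex) \<Rightarrow> real \<Rightarrow> real \<Rightarrow> real" where
  "variation f x y = Sup (variation_sums f x y)"

lemma variation_sumsI:
  assumes "finite (J :: nat set)" "\<And>j. j \<in> J \<Longrightarrow> x \<le> c j \<and> c j \<le> d j \<and> d j \<le> y"
    "disjoint_family_on (\<lambda>j. {c j<..<d j}) J"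
  shows "(\<Sum>j\<in>J. cmod (f (d j) - f (c j))) \<in> variation_sums f x y"
  unfolding variation_sums_def using assms by blast

lemma variation_sumsE:
  assumes "s \<in> variation_sums f x y"
  obtains J :: "nat set" and c d where "finite J" "\<forall>j\<in>J. x \<le> c j \<and> c j \<le> d j \<and> d j \<le> y"
    "disjoint_family_on (\<lambda>j. {c j<..<d j}) J" "s = (\<Sum>j\<in>J. cmod (f (d j) - f (c j)))"
  using assms unfolding variation_sums_def by blast

lemma variation_sums_0: "0 \<in> variation_sums f x y"
  using variation_sumsI[of "{}"] by (simp add: disjoint_family_on_def)

lemma variation_sums_mono:
  assumes le: "x' \<le> x" "y \<le> y'"
  shows "variation_sums f x y \<subseteq> variation_sums f x' y'"
proof
  fix s assume "s \<in> variation_sums f x y"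
  then obtain J :: "nat set" and c d where J: "finite J" "\<forall>j\<in>J. x \<le> c j \<and> c j \<le> d j \<and> d j \<le> y"
    "disjoint_family_on (\<lambda>j. {c j<..<d j}) J" "s = (\<Sum>j\<in>J. cmod (f (d j) - f (c j)))"
    by (elim variation_sumsE)
  have "x' \<le> c j \<and> c j \<le> d j \<and> d j \<le> y'" if "j \<in> J" for j using J(2)[rule_format, OF that] le by linarith
  then show "s \<in> variation_sums f x' y'"
    unfolding J(4) by (intro variation_sumsI J(1,3))
qed

lemma disjoint_family_on_shrink:
  assumes "disjoint_family_on A J" "\<And>j. j \<in> J \<Longrightarrow> B j \<subseteq> A j"
  shows "disjoint_family_on B J"
  using assms unfolding disjoint_family_on_def by blast

text \<open>Cutting each interval at \<open>y\<close> with \<open>min\<close> and \<open>max\<close> avoids a case distinction on its position: the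
  pieces on the wrong side degenerate to points.\<close>

lemma variation_sums_split:
  assumes "s \<in> variation_sums f x z" "x \<le> y" "y \<le> z"
  obtains s1 s2 where "s1 \<in> variation_sums f x y" "s2 \<in> variation_sums f y z" "s \<le> s1 + s2"
proof -
  obtain J :: "nat set" and c d where J: "finite J" "\<forall>j\<in>J. x \<le> c j \<and> c j \<le> d j \<and> d j \<le> z"
      "disjoint_family_on (\<lambda>j. {c j<..<d j}) J" and s: "s = (\<Sum>j\<in>J. cmod (f (d j) - f (c j)))"
    using assms(1) by (elim variation_sumsE)
  have 1: "(\<Sum>j\<in>J. cmod (f (min (d j) y) - f (min (c j) y))) \<in> variation_sums f x y"
    using assms
    by (intro variation_sumsI[OF J(1)] disjoint_family_on_shrink[OF J(3)]) (auto simp: min_def dest: J(2)[rule_format])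
  have 2: "(\<Sum>j\<in>J. cmod (f (max (d j) y) - f (max (c j) y))) \<in> variation_sums f y z"
    using assms
    by (intro variation_sumsI[OF J(1)] disjoint_family_on_shrink[OF J(3)]) (auto simp: max_def dest: J(2)[rule_format])
  have "cmod (f (d j) - f (c j)) \<le> cmod (f (min (d j) y) - f (min (c j) y)) + cmod (f (max (d j) y) - f (max (c j) y))"
    if "j \<in> J" for j
    using J(2)[rule_format, OF that] norm_triangle_ineq[of "f (d j) - f y" "f y - f (c j)"]
    by (cases "c j \<le> y"; cases "d j \<le> y") (auto simp: min_def max_def)
  then have "s \<le> (\<Sum>j\<in>J. cmod (f (min (d j) y) - f (min (c j) y))) + (\<Sum>j\<in>J. cmod (f (max (d j) y) - f (max (c j) y)))"
    unfolding s sum.distrib[symmetric] by (rule sum_mono)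
  with 1 2 show ?thesis by (rule that)
qed

lemma variation_sums_append:
  assumes "s \<in> variation_sums f x y" "x \<le> y" "y \<le> z"
  shows "s + cmod (f z - f y) \<in> variation_sums f x z"
proof -
  obtain J :: "nat set" and c d where J: "finite J" "\<forall>j\<in>J. x \<le> c j \<and> c j \<le> d j \<and> d j \<le> y"
      "disjoint_family_on (\<lambda>j. {c j<..<d j}) J" and s: "s = (\<Sum>j\<in>J. cmod (f (d j) - f (c j)))"
    using assms(1) by (elim variation_sumsE)
  obtain k where k: "k \<notin> J" using J(1) ex_new_if_finite infinite_UNIV_nat by blast
  have *: "(\<Sum>j\<in>insert k J. cmod (f ((d(k := z)) j) - f ((c(k := y)) j))) \<in> variation_sums f x z"
  proof (rule variation_sumsI)
    show "x \<le> (c(k := y)) j \<and> (c(k := y)) j \<le> (d(k := z)) j \<and> (d(k := z)) j \<le> z" if "j \<in> insert k J" for j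
      using that bspec[OF J(2), of j] assms by auto
    show "disjoint_family_on (\<lambda>j. {(c(k := y)) j<..<(d(k := z)) j}) (insert k J)"
      unfolding disjoint_family_on_def
    proof (intro ballI impI)
      fix m n assume mn: "m \<in> insert k J" "n \<in> insert k J" "m \<noteq> n"
      show "{(c(k := y)) m<..<(d(k := z)) m} \<inter> {(c(k := y)) n<..<(d(k := z)) n} = {}"
        using mn bspec[OF J(2), of m] bspec[OF J(2), of n] k J(3)
        by (cases "m = k"; cases "n = k") (auto simp: disjoint_family_on_def)
    qed
  qed (use J in auto)
  moreover have "(\<Sum>j\<in>J. cmod (f ((d(k := z)) j) - f ((c(k := y)) j))) = s"
    unfolding s using k by (intro sum.cong) auto
  ultimately show ?thesis using J(1) k by (simp add: add.commute)
qed

text \<open>On an interval shorter than the \<open>\<delta>\<close> that belongs to \<open>\<epsilon> = 1\<close> every variation sum is at most 1, and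
  finitely many such intervals cover \<open>[a, b]\<close>.\<close>

lemma abs_cont_on_bdd_variation:
  assumes f: "abs_cont_on a b f" and "a \<le> b"
  shows "bdd_above (variation_sums f a b)"
proof -
  obtain \<delta> where \<delta>: "\<delta> > 0" "\<forall>(I :: nat set) c d. finite I \<longrightarrow> (\<forall>i\<in>I. a \<le> c i \<and> c i \<le> d i \<and> d i \<le> b) \<longrightarrow>
    disjoint_family_on (\<lambda>i. {c i<..<d i}) I \<longrightarrow> (\<Sum>i\<in>I. d i - c i) < \<delta> \<longrightarrow>
    (\<Sum>i\<in>I. cmod (f (d i) - f (c i))) < 1"
    using abs_cont_on_finite_family[OF f zero_less_one, where ?'i = nat] by (elim exE conjE) (rule that)
  have short: "s \<le> 1" if "s \<in> variation_sums f y z" "a \<le> y" "y \<le> z" "z \<le> b" "z - y < \<delta>" for s y z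
  proof -
    obtain J :: "nat set" and c d where J: "finite J" "\<forall>j\<in>J. y \<le> c j \<and> c j \<le> d j \<and> d j \<le> z"
      "disjoint_family_on (\<lambda>j. {c j<..<d j}) J" and s: "s = (\<Sum>j\<in>J. cmod (f (d j) - f (c j)))"
      using \<open>s \<in> variation_sums f y z\<close> by (elim variation_sumsE)
    have "(\<Sum>j\<in>J. d j - c j) \<le> z - y"
      using mono_sum_disjoint_intervals_le[of J "\<lambda>x. x" y z c d] J that by (auto simp: mono_def)
    with that have "(\<Sum>j\<in>J. d j - c j) < \<delta>" by simp
    then show ?thesis unfolding s using J that by (intro less_imp_le \<delta>(2)[rule_format]) force+
  qed
  define p where "p n = min b (a + real n * (\<delta> / 2))" for n
  have p: "a \<le> p n" "p n \<le> p (Suc n)" "p n \<le> b" "p (Suc n) - p n < \<delta>" for n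
    using \<delta>(1) assms(2) by (auto simp: p_def min_def field_simps)
  have "\<forall>s \<in> variation_sums f a (p n). s \<le> real (Suc n)" for n
  proof (induction n)
    case 0
    then show ?case using short[of _ a a] assms \<delta>(1) by (auto simp: p_def)
  next
    case (Suc n)
    show ?case
    proof
      fix s assume "s \<in> variation_sums f a (p (Suc n))"
      then obtain s1 s2 where "s1 \<in> variation_sums f a (p n)" "s2 \<in> variation_sums f (p n) (p (Suc n))" "s \<le> s1 + s2"
        using variation_sums_split p by metis
      moreover have "s1 \<le> real (Suc n)" using Suc calculation(1) by auto
      moreover have "s2 \<le> 1" using short calculation(2) p by blast
      ultimately show "s \<le> real (Suc (Suc n))" by simp
    qed
  qed
  moreover obtain n where "p n = b"
  proof -
    obtain n where "(b - a) / (\<delta> / 2) < real n" using reals_Archimedean2 by blast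
    then have "p n = b" using \<delta>(1) by (auto simp: p_def field_simps min_def)
    then show ?thesis by (rule that)
  qed
  ultimately show ?thesis by (metis bdd_aboveI)
qed

context
  fixes a b :: real and f :: "real \<Rightarrow> complex"
  assumes f: "abs_cont_on a b f" and ab: "a \<le> b"
begin

lemma bdd_variation_sums: "a \<le> x \<Longrightarrow> y \<le> b \<Longrightarrow> bdd_above (variation_sums f x y)"
  by (rule bdd_above_mono[OF abs_cont_on_bdd_variation[OF f ab] variation_sums_mono])

text \<open>The variation grows at least as fast as the function itself; therefore adding it to the real or
  imaginary part gives a monotone function.\<close>

lemma variation_append:
  assumes "a \<le> y" "y \<le> z" "z \<le> b"
  shows "variation f a y + cmod (f z - f y) \<le> variation f a z"
proof -
  have "variation f a y \<le> variation f a z - cmod (f z - f y)"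
    unfolding variation_def
  proof (rule cSup_least)
    show "variation_sums f a y \<noteq> {}" using variation_sums_0 by blast
    fix s assume "s \<in> variation_sums f a y"
    then have "s + cmod (f z - f y) \<in> variation_sums f a z" using assms by (intro variation_sums_append) auto
    then show "s \<le> Sup (variation_sums f a z) - cmod (f z - f y)"
      using cSup_upper[OF _ bdd_variation_sums[of a z]] assms by fastforce
  qed
  then show ?thesis by simp
qed

lemma variation_increment_le:
  assumes "a \<le> y" "y \<le> z" "z \<le> b"
  shows "variation f a z \<le> variation f a y + variation f y z"
  unfolding variation_def[of f a z]
proof (rule cSup_least)
  show "variation_sums f a z \<noteq> {}" using variation_sums_0 by blast
  fix s assume "s \<in> variation_sums f a z"
  then obtain s1 s2 where "s1 \<in> variation_sums f a y" "s2 \<in> variation_sums f y z" "s \<le> s1 + s2"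
    using assms variation_sums_split by metis
  moreover have "s1 \<le> variation f a y" "s2 \<le> variation f y z"
    using calculation assms unfolding variation_def by (auto intro!: cSup_upper bdd_variation_sums)
  ultimately show "s \<le> variation f a y + variation f y z" by linarith
qed

text \<open>Replace the variation over each interval of a family by a nearly optimal sum over subintervals.
  All subintervals together form one family that is no longer than the original one, so the
  absolute continuity of \<open>f\<close> controls the total.\<close>

lemma variation_absolutely_continuous:
  assumes "\<epsilon> > 0"
  shows "\<exists>\<delta>>0. \<forall>(I :: nat set) c d. finite I \<longrightarrow> (\<forall>i\<in>I. a \<le> c i \<and> c i \<le> d i \<and> d i \<le> b) \<longrightarrow>
    disjoint_family_on (\<lambda>i. {c i<..<d i}) I \<longrightarrow> (\<Sum>i\<in>I. d i - c i) < \<delta> \<longrightarrow>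
    (\<Sum>i\<in>I. variation f a (d i) - variation f a (c i)) < \<epsilon>"
proof -
  obtain \<delta> where \<delta>: "\<delta> > 0" "\<forall>(I :: (nat \<times> nat) set) c d. finite I \<longrightarrow> (\<forall>i\<in>I. a \<le> c i \<and> c i \<le> d i \<and> d i \<le> b) \<longrightarrow>
    disjoint_family_on (\<lambda>i. {c i<..<d i}) I \<longrightarrow> (\<Sum>i\<in>I. d i - c i) < \<delta> \<longrightarrow>
    (\<Sum>i\<in>I. cmod (f (d i) - f (c i))) < \<epsilon> / 2"
    using abs_cont_on_finite_family[OF f half_gt_zero[OF assms], where ?'i = "nat \<times> nat"] by (elim exE conjE) (rule that)
  show ?thesis
  proof (intro exI[of _ \<delta>] conjI allI impI \<delta>(1))
    fix I :: "nat set" and c d :: "nat \<Rightarrow> real"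
    assume I: "finite I" "\<forall>i\<in>I. a \<le> c i \<and> c i \<le> d i \<and> d i \<le> b"
      "disjoint_family_on (\<lambda>i. {c i<..<d i}) I" "(\<Sum>i\<in>I. d i - c i) < \<delta>"
    \<comment> \<open>The loss \<open>\<eta>\<close> per interval adds up to at most \<open>\<epsilon> / 2\<close>; the summand 1 covers the empty family.\<close>
    define \<eta> where "\<eta> = \<epsilon> / (2 * (real (card I) + 1))"
    have \<eta>: "\<eta> > 0" using assms by (simp add: \<eta>_def)
    have "\<exists>J c' d'. finite (J :: nat set) \<and> (\<forall>j\<in>J. c i \<le> c' j \<and> c' j \<le> d' j \<and> d' j \<le> d i) \<and>
        disjoint_family_on (\<lambda>j. {c' j<..<d' j}) J \<and>
        variation f (c i) (d i) - \<eta> < (\<Sum>j\<in>J. cmod (f (d' j) - f (c' j)))" if "i \<in> I" for i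
    proof -
      have "\<exists>s\<in>variation_sums f (c i) (d i). variation f (c i) (d i) - \<eta> < s"
        unfolding variation_def using variation_sums_0 \<eta>
        by (intro less_cSupD) auto
      then show ?thesis unfolding variation_sums_def by blast
    qed
    then have "\<forall>i\<in>I. \<exists>J c' d'. finite (J :: nat set) \<and> (\<forall>j\<in>J. c i \<le> c' j \<and> c' j \<le> d' j \<and> d' j \<le> d i) \<and>
        disjoint_family_on (\<lambda>j. {c' j<..<d' j}) J \<and>
        variation f (c i) (d i) - \<eta> < (\<Sum>j\<in>J. cmod (f (d' j) - f (c' j)))" by blast
    then obtain J c' d' where "\<forall>i\<in>I. finite (J i :: nat set) \<and> (\<forall>j\<in>J i. c i \<le> c' i j \<and> c' i j \<le> d' i j \<and> d' i j \<le> d i) \<and>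
        disjoint_family_on (\<lambda>j. {c' i j<..<d' i j}) (J i) \<and>
        variation f (c i) (d i) - \<eta> < (\<Sum>j\<in>J i. cmod (f (d' i j) - f (c' i j)))"
      unfolding bchoice_iff by (elim exE) (rule that)
    then have J: "\<And>i. i \<in> I \<Longrightarrow> finite (J i :: nat set)"
        "\<And>i j. i \<in> I \<Longrightarrow> j \<in> J i \<Longrightarrow> c i \<le> c' i j \<and> c' i j \<le> d' i j \<and> d' i j \<le> d i"
        "\<And>i. i \<in> I \<Longrightarrow> disjoint_family_on (\<lambda>j. {c' i j<..<d' i j}) (J i)"
        "\<And>i. i \<in> I \<Longrightarrow> variation f (c i) (d i) - \<eta> < (\<Sum>j\<in>J i. cmod (f (d' i j) - f (c' i j)))"
      by blast+
    have "(\<Sum>i\<in>Sigma I J. cmod (f (case_prod d' i) - f (case_prod c' i))) < \<epsilon> / 2"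
    proof (rule \<delta>(2)[rule_format])
      show "finite (Sigma I J)" using I(1) J(1) by auto
      show "a \<le> case_prod c' i \<and> case_prod c' i \<le> case_prod d' i \<and> case_prod d' i \<le> b"
        if "i \<in> Sigma I J" for i
        using I(2) J(2) that by force
      show "disjoint_family_on (\<lambda>i. {case_prod c' i<..<case_prod d' i}) (Sigma I J)"
        unfolding disjoint_family_on_def
      proof (intro ballI impI)
        fix m n assume mn: "m \<in> Sigma I J" "n \<in> Sigma I J" "m \<noteq> n"
        show "{case_prod c' m<..<case_prod d' m} \<inter> {case_prod c' n<..<case_prod d' n} = {}"
        proof (cases "fst m = fst n")
          case True
          then obtain i j j' where ij: "m = (i, j)" "n = (i, j')" "i \<in> I" "j \<in> J i" "j' \<in> J i" "j \<noteq> j'"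
            using mn by (cases m; cases n) auto
          show ?thesis using disjoint_family_onD[OF J(3)[OF ij(3)] ij(4-6)] by (simp only: ij prod.case)
        next
          case False
          then have "{c (fst m)<..<d (fst m)} \<inter> {c (fst n)<..<d (fst n)} = {}"
            using I(3) mn by (auto simp: disjoint_family_on_def)
          moreover have "{case_prod c' m<..<case_prod d' m} \<subseteq> {c (fst m)<..<d (fst m)}"
            "{case_prod c' n<..<case_prod d' n} \<subseteq> {c (fst n)<..<d (fst n)}"
            using mn J(2) by force+
          ultimately show ?thesis by blast
        qed
      qed
      have "(\<Sum>i\<in>Sigma I J. case_prod d' i - case_prod c' i) = (\<Sum>i\<in>I. \<Sum>j\<in>J i. d' i j - c' i j)"
        using I(1) J(1) by (subst sum.Sigma) (auto intro!: sum.cong)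
      also have "\<dots> \<le> (\<Sum>i\<in>I. d i - c i)"
      proof (rule sum_mono)
        fix i assume "i \<in> I"
        then show "(\<Sum>j\<in>J i. d' i j - c' i j) \<le> d i - c i"
          using mono_sum_disjoint_intervals_le[of "J i" "\<lambda>x. x" "c i" "d i" "c' i" "d' i"] J I(2)
          by (auto simp: mono_def)
      qed
      finally show "(\<Sum>i\<in>Sigma I J. case_prod d' i - case_prod c' i) < \<delta>" using I(4) by simp
    qed
    also have "(\<Sum>i\<in>Sigma I J. cmod (f (case_prod d' i) - f (case_prod c' i))) =
        (\<Sum>i\<in>I. \<Sum>j\<in>J i. cmod (f (d' i j) - f (c' i j)))"
      using I(1) J(1) by (subst sum.Sigma) (auto intro!: sum.cong)
    finally have small: "(\<Sum>i\<in>I. \<Sum>j\<in>J i. cmod (f (d' i j) - f (c' i j))) < \<epsilon> / 2" .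
    have "(\<Sum>i\<in>I. variation f a (d i) - variation f a (c i)) \<le> (\<Sum>i\<in>I. (\<Sum>j\<in>J i. cmod (f (d' i j) - f (c' i j))) + \<eta>)"
    proof (rule sum_mono)
      fix i assume i: "i \<in> I"
      have "variation f a (d i) \<le> variation f a (c i) + variation f (c i) (d i)"
        using I(2) i by (intro variation_increment_le) auto
      with J(4)[OF i] show "variation f a (d i) - variation f a (c i) \<le> (\<Sum>j\<in>J i. cmod (f (d' i j) - f (c' i j))) + \<eta>"
        by linarith
    qed
    also have "\<dots> = (\<Sum>i\<in>I. \<Sum>j\<in>J i. cmod (f (d' i j) - f (c' i j))) + real (card I) * \<eta>"
      by (simp add: sum.distrib)
    also have "\<dots> < \<epsilon>"
    proof -
      have "real (card I) * \<eta> \<le> \<epsilon> / 2"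
        using assms by (simp add: \<eta>_def field_simps)
      then show ?thesis using small by linarith
    qed
    finally show "(\<Sum>i\<in>I. variation f a (d i) - variation f a (c i)) < \<epsilon>" .
  qed
qed

end


section \<open>Densities of monotone absolutely continuous functions\<close>

text \<open>The Stieltjes measure of \<open>F\<close> is absolutely continuous: a Lebesgue null set lies in an open set of
  small length, which is exhausted by finite unions of compact intervals, and a division of such a
  union into nonoverlapping intervals bounds its measure by a sum of increments of \<open>F\<close>. The
  Radon-Nikodym theorem then provides the density.\<close>

lemma mono_absolutely_continuous_has_density:
  fixes F :: "real \<Rightarrow> real"
  assumes F: "mono F"
    and ac: "\<And>\<epsilon>. \<epsilon> > 0 \<Longrightarrow> \<exists>\<delta>>0. \<forall>(I :: nat set) c d. finite I \<longrightarrow> (\<forall>i\<in>I. c i \<le> d i) \<longrightarrow>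
      disjoint_family_on (\<lambda>i. {c i<..<d i}) I \<longrightarrow> (\<Sum>i\<in>I. d i - c i) < \<delta> \<longrightarrow>
      (\<Sum>i\<in>I. F (d i) - F (c i)) < \<epsilon>"
  shows "\<exists>g. primitive_of F g"
proof -
  have cont: "continuous_on UNIV F"
    unfolding continuous_on_iff
  proof (intro ballI allI impI)
    fix x e :: real assume e: "e > 0"
    obtain \<delta> where \<delta>: "\<delta> > 0" "\<forall>(I :: nat set) c d. finite I \<longrightarrow> (\<forall>i\<in>I. c i \<le> d i) \<longrightarrow>
      disjoint_family_on (\<lambda>i. {c i<..<d i}) I \<longrightarrow> (\<Sum>i\<in>I. d i - c i) < \<delta> \<longrightarrow>
      (\<Sum>i\<in>I. F (d i) - F (c i)) < e" using ac[OF e] by (elim exE conjE) (rule that)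
    have *: "F z - F y < e" if "y \<le> z" "z - y < \<delta>" for y z
      using \<delta>(2)[rule_format, of "{0}" "\<lambda>_. y" "\<lambda>_. z"] that by (auto simp: disjoint_family_on_def)
    show "\<exists>d>0. \<forall>y\<in>UNIV. dist y x < d \<longrightarrow> dist (F y) (F x) < e"
    proof (intro exI[of _ \<delta>] conjI ballI impI \<delta>(1))
      fix y assume "dist y x < \<delta>"
      then show "dist (F y) (F x) < e"
        using *[of x y] *[of y x] monoD[OF F, of x y] monoD[OF F, of y x]
        by (cases "x \<le> y") (auto simp: dist_real_def)
    qed
  qed
  define \<mu> where "\<mu> = interval_measure F"
  have sets[measurable_cong, simp]: "sets \<mu> = sets borel" by (simp add: \<mu>_def)
  have Icc: "emeasure \<mu> {a..b} = ennreal (F b - F a)" if "a \<le> b" for a b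
    unfolding \<mu>_def using emeasure_interval_measure_Icc[OF that monoD[OF F] cont] by simp
  have small: "\<exists>\<delta>>0. \<forall>\<F>. finite \<F> \<longrightarrow> (\<forall>s\<in>\<F>. \<exists>a b. s = cbox a b) \<longrightarrow> emeasure lborel (\<Union>\<F>) < ennreal \<delta> \<longrightarrow>
      emeasure \<mu> (\<Union>\<F>) \<le> ennreal \<epsilon>" if "\<epsilon> > 0" for \<epsilon>
  proof -
    obtain \<delta> where \<delta>: "\<delta> > 0" "\<forall>(I :: nat set) c d. finite I \<longrightarrow> (\<forall>i\<in>I. c i \<le> d i) \<longrightarrow>
      disjoint_family_on (\<lambda>i. {c i<..<d i}) I \<longrightarrow> (\<Sum>i\<in>I. d i - c i) < \<delta> \<longrightarrow>
      (\<Sum>i\<in>I. F (d i) - F (c i)) < \<epsilon>" using ac[OF \<open>\<epsilon> > 0\<close>] by (elim exE conjE) (rule that)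
    show ?thesis
    proof (intro exI[of _ \<delta>] conjI allI impI \<delta>(1))
      fix \<F> :: "real set set"
      assume \<F>: "finite \<F>" "\<forall>s\<in>\<F>. \<exists>a b. s = cbox a b" "emeasure lborel (\<Union>\<F>) < ennreal \<delta>"
      then obtain p where p: "p division_of (\<Union>\<F>)" using elementary_unions_intervals[OF \<F>(1) bspec[OF \<F>(2)]] by metis
      have K: "Inf K \<le> Sup K \<and> K = {Inf K..Sup K}" if K: "K \<in> p" for K
        using division_ofD(3)[OF p K] division_ofD(4)[OF p K] by auto
      obtain h where h: "bij_betw h {..<card p} p"
        using division_ofD(1)[OF p] by (metis ex_bij_betw_nat_finite atLeast0LessThan)
      have eq: "(\<Sum>i<card p. G (h i)) = (\<Sum>i\<in>p. G i)" for G :: "real set \<Rightarrow> real"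
        using h by (rule sum.reindex_bij_betw)
      have hp: "h i \<in> p" if "i < card p" for i using h that by (auto simp: bij_betw_def)
      have int: "interior K = {Inf K<..<Sup K}" if "K \<in> p" for K
        using K[OF that] by (metis interior_atLeastAtMost_real)
      have "disjoint_family_on (\<lambda>i. {Inf (h i)<..<Sup (h i)}) {..<card p}"
        unfolding disjoint_family_on_def
      proof (intro ballI impI)
        fix m n assume mn: "m \<in> {..<card p}" "n \<in> {..<card p}" "m \<noteq> n"
        then have "h m \<noteq> h n" using h by (auto simp: bij_betw_def inj_on_def)
        then have "interior (h m) \<inter> interior (h n) = {}"
          using division_ofD(5)[OF p] hp mn by auto
        then show "{Inf (h m)<..<Sup (h m)} \<inter> {Inf (h n)<..<Sup (h n)} = {}"
          using int hp mn by simp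
      qed
      moreover have "(\<Sum>i<card p. Sup (h i) - Inf (h i)) < \<delta>"
      proof -
        have "(\<Sum>i<card p. Sup (h i) - Inf (h i)) = (\<Sum>K\<in>p. Sup K - Inf K)" by (rule eq)
        also have "\<dots> = (\<Sum>K\<in>p. measure lebesgue K)"
        proof (rule sum.cong)
          fix k assume "k \<in> p"
          then obtain u v where "k = {u..v}" "u \<le> v" using K by blast
          then show "Sup k - Inf k = measure lebesgue k" by simp
        qed simp
        also have "\<dots> = measure lebesgue (\<Union>\<F>)" by (rule content_division[OF p])
        also have "\<dots> = measure lborel (\<Union>\<F>)"
          using \<F>(1,2) by (intro measure_completion) (auto intro!: borel_closed closed_Union)
        also have "\<dots> < \<delta>" using \<F>(3) \<delta>(1)
          by (metis emeasure_eq_ennreal_measure ennreal_less_iff measure_nonneg order_less_imp_not_eq2 top.extremum_strict top.not_eq_extremum)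
        finally show ?thesis .
      qed
      ultimately have "(\<Sum>i<card p. F (Sup (h i)) - F (Inf (h i))) < \<epsilon>"
        using K hp by (intro \<delta>(2)[rule_format]) auto
      then have "(\<Sum>K\<in>p. F (Sup K) - F (Inf K)) < \<epsilon>"
        by (simp only: eq[of "\<lambda>K. F (Sup K) - F (Inf K)"])
      moreover have "emeasure \<mu> (\<Union>\<F>) \<le> (\<Sum>K\<in>p. emeasure \<mu> K)"
      proof -
        have "K \<in> sets \<mu>" if "K \<in> p" for K using division_ofD(4)[OF p that] by auto
        then show ?thesis
          using emeasure_subadditive_finite[of p "\<lambda>K. K" \<mu>] division_ofD(1)[OF p] division_ofD(6)[OF p] by auto
      qed
      moreover have "(\<Sum>K\<in>p. emeasure \<mu> K) = (\<Sum>K\<in>p. ennreal (F (Sup K) - F (Inf K)))"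
        using K Icc by (intro sum.cong) metis+
      moreover have "\<dots> = ennreal (\<Sum>K\<in>p. F (Sup K) - F (Inf K))"
        using K monoD[OF F] by (intro sum_ennreal) auto
      ultimately show "emeasure \<mu> (\<Union>\<F>) \<le> ennreal \<epsilon>"
        by (metis ennreal_leI less_imp_le order.trans)
    qed
  qed
  have "absolutely_continuous lborel \<mu>"
    unfolding absolutely_continuous_def
  proof
    fix N :: "real set" assume N: "N \<in> null_sets lborel"
    have "emeasure \<mu> N \<le> 0 + ennreal \<epsilon>" if \<epsilon>: "\<epsilon> > 0" for \<epsilon>
    proof -
      obtain \<delta> where \<delta>: "\<delta> > 0" "\<forall>\<F>. finite \<F> \<longrightarrow> (\<forall>s\<in>\<F>. \<exists>a b. s = cbox a b) \<longrightarrow> emeasure lborel (\<Union>\<F>) < ennreal \<delta> \<longrightarrow>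
        emeasure \<mu> (\<Union>\<F>) \<le> ennreal \<epsilon>" using small[OF \<epsilon>] by blast
      have "N \<in> sets borel" using N by auto
      then obtain U where U: "open U" "N \<subseteq> U" "emeasure lborel (U - N) < ennreal \<delta>"
        using outer_regular_lborel[OF _ \<delta>(1), of N] by metis
      have "emeasure lborel U = emeasure lborel (U - N)"
        using N U(1) by (simp add: emeasure_Diff_null_set)
      then have U\<delta>: "emeasure lborel U < ennreal \<delta>" using U(3) by simp
      obtain \<D> where \<D>: "countable \<D>" "\<D> \<subseteq> Pow U" "\<And>X. X \<in> \<D> \<Longrightarrow> \<exists>a b. X = cbox a b" "\<Union>\<D> = U"
        using open_countable_Union_open_cbox[OF U(1)] by metis
      \<comment> \<open>Enumerating the boxes exhausts \<open>U\<close> by finite unions.\<close>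
      define A where "A n = \<Union>{D \<in> \<D>. to_nat_on \<D> D < n}" for n
      have A: "emeasure \<mu> (A n) \<le> ennreal \<epsilon>" "A n \<in> sets \<mu>" for n
      proof -
        have fin: "finite {D \<in> \<D>. to_nat_on \<D> D < n}"
          by (rule finite_imageD[of "to_nat_on \<D>"], rule finite_subset[of _ "{..<n}"])
            (use inj_on_to_nat_on[OF \<D>(1)] in \<open>auto simp: inj_on_def\<close>)
        have "A n \<subseteq> U" using \<D>(4) by (auto simp: A_def)
        then have "emeasure lborel (A n) \<le> emeasure lborel U" using U(1) by (intro emeasure_mono) auto
        then have "emeasure lborel (A n) < ennreal \<delta>" using U\<delta> by (rule le_less_trans)
        then show "emeasure \<mu> (A n) \<le> ennreal \<epsilon>"
          unfolding A_def using fin \<D>(3) by (intro \<delta>(2)[rule_format]) auto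
        show "A n \<in> sets \<mu>"
          unfolding A_def using fin \<D>(3) by (intro sets.finite_Union) (auto, metis borel_closed box_real(2) closed_atLeastAtMost)
      qed
      have "U = (\<Union>n. A n)"
        unfolding \<D>(4)[symmetric] A_def by auto
      moreover have "incseq A" by (auto simp: incseq_def A_def)
      ultimately have "emeasure \<mu> U = (SUP n. emeasure \<mu> (A n))"
        using SUP_emeasure_incseq[of A \<mu>] A(2) by (auto simp: image_subset_iff)
      also have "\<dots> \<le> ennreal \<epsilon>" using A(1) by (rule SUP_least)
      finally have "emeasure \<mu> U \<le> ennreal \<epsilon>" .
      moreover have "emeasure \<mu> N \<le> emeasure \<mu> U" using U by (intro emeasure_mono) auto
      ultimately show ?thesis by simp
    qed
    then have "emeasure \<mu> N \<le> 0" by (rule ennreal_le_epsilon)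
    then show "N \<in> null_sets \<mu>" using N by (auto simp: null_sets_def)
  qed
  then obtain f where f: "f \<in> borel_measurable lborel" "density lborel f = \<mu>"
    using sigma_finite_measure.Radon_Nikodym[OF sigma_finite_lborel, of \<mu>] by auto
  have int: "(\<integral>\<^sup>+x. f x * indicator {a..b} x \<partial>lborel) = ennreal (F b - F a)" if "a \<le> b" for a b
    using Icc[OF that] f emeasure_density[of f lborel "{a..b}"] by simp
  have fin: "AE x in lborel. f x \<noteq> \<infinity>"
  proof -
    have "AE x in lborel. f x * indicator {- real n..real n} x \<noteq> \<infinity>" for n
      using f(1) by (intro nn_integral_noteq_infinite) (auto simp: int)
    then have "AE x in lborel. \<forall>n. f x * indicator {- real n..real n} x \<noteq> \<infinity>"
      by (simp add: AE_all_countable)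
    then show ?thesis
    proof eventually_elim
      case (elim x)
      obtain n where "\<bar>x\<bar> \<le> real n" using real_arch_simple by blast
      then show ?case using elim[rule_format, of n] by (auto simp: abs_le_iff)
    qed
  qed
  define g where "g x = enn2real (f x)" for x
  have [measurable]: "g \<in> borel_measurable lborel" unfolding g_def using f(1) by measurable
  have "has_bochner_integral lborel (\<lambda>x. g x * indicator {a..b} x) (F b - F a)" if "a \<le> b" for a b
  proof (rule has_bochner_integral_nn_integral)
    have "AE x in lborel. ennreal (g x * indicator {a..b} x) = f x * indicator {a..b} x"
      using fin by eventually_elim (auto simp: g_def indicator_def less_top)
    then have "(\<integral>\<^sup>+x. ennreal (g x * indicator {a..b} x) \<partial>lborel) = (\<integral>\<^sup>+x. f x * indicator {a..b} x \<partial>lborel)"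
      by (rule nn_integral_cong_AE)
    then show "(\<integral>\<^sup>+x. ennreal (g x * indicator {a..b} x) \<partial>lborel) = ennreal (F b - F a)"
      using int[OF that] by simp
    show "0 \<le> F b - F a" using monoD[OF F that] by simp
    show "(\<lambda>x. g x * indicator {a..b} x) \<in> borel_measurable lborel" by measurable
  qed (auto simp: g_def)
  then have *: "set_integrable lborel {a..b} g" "(LINT x:{a..b}|lborel. g x) = F b - F a" if "a \<le> b" for a b
    using that by (auto simp: set_integrable_def set_lebesgue_integral_def has_bochner_integral_iff mult.commute)
  have abs: "g absolutely_integrable_on {a..b}" for a b
  proof (cases "a \<le> b")
    case True
    then show ?thesis using *(1) unfolding set_integrable_def by (intro integrable_completion[THEN iffD2]) auto
  qed auto
  have "primitive_of F g"
    unfolding primitive_of_def using abs *(2) set_borel_integral_eq_integral(2)[OF *(1)] by auto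
  then show ?thesis by blast
qed


section \<open>Calculus of primitives\<close>

lemma primitive_ofD:
  assumes "primitive_of u g"
  shows "g absolutely_integrable_on {a..b}" "g integrable_on {a..b}" "a \<le> b \<Longrightarrow> u b - u a = integral {a..b} g"
  using assms by (auto simp: primitive_of_def absolutely_integrable_on_def)

lemma primitive_of_linear:
  fixes h :: "'a::euclidean_space \<Rightarrow> 'b::euclidean_space"
  assumes "primitive_of u g" "bounded_linear h"
  shows "primitive_of (\<lambda>x. h (u x)) (\<lambda>x. h (g x))"
proof -
  interpret bounded_linear h by fact
  have "integral {a..b} (\<lambda>x. h (g x)) = h (integral {a..b} g)" for a b
    using integral_linear[OF primitive_ofD(2)[OF assms(1)] assms(2)] by (simp add: o_def)
  then show ?thesis
    using assms absolutely_integrable_linear[OF primitive_ofD(1)[OF assms(1)] assms(2)]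
    unfolding primitive_of_def o_def by (simp add: diff[symmetric])
qed

lemma primitive_of_add:
  assumes "primitive_of u g" "primitive_of v h"
  shows "primitive_of (\<lambda>x. u x + v x) (\<lambda>x. g x + h x)"
  unfolding primitive_of_def
proof (intro conjI allI impI)
  fix a b :: real
  show "(\<lambda>x. g x + h x) absolutely_integrable_on {a..b}"
    using assms by (intro set_integral_add primitive_ofD)
  assume "a \<le> b"
  moreover have "integral {a..b} (\<lambda>x. g x + h x) = integral {a..b} g + integral {a..b} h"
    using assms by (intro integral_add primitive_ofD)
  ultimately show "u b + v b - (u a + v a) = integral {a..b} (\<lambda>x. g x + h x)"
    using primitive_ofD(3)[OF assms(1), of a b] primitive_ofD(3)[OF assms(2), of a b] by (simp add: algebra_simps)
qed

lemma primitive_of_uminus: "primitive_of u g \<Longrightarrow> primitive_of (\<lambda>x. - u x) (\<lambda>x. - g x)"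
  using primitive_of_linear[where h = uminus] bounded_linear_minus[OF bounded_linear_ident] by blast

lemma primitive_of_diff:
  assumes "primitive_of u g" "primitive_of v h"
  shows "primitive_of (\<lambda>x. u x - v x) (\<lambda>x. g x - h x)"
  using primitive_of_add[OF assms(1) primitive_of_uminus[OF assms(2)]] by simp

lemma primitive_of_const: "primitive_of (\<lambda>x. c) (\<lambda>x. 0)"
  by (auto simp: primitive_of_def)

lemma primitive_of_cong_AE:
  assumes u: "primitive_of u g" and ae: "AE x in lebesgue. g x = h x"
  shows "primitive_of u h"
proof -
  obtain N where N: "negligible N" "{x. g x \<noteq> h x} \<subseteq> N"
    using ae unfolding eventually_ae_filter_negligible by auto
  then have eq: "h x = g x" if "x \<in> S - N" for S x
    using that by (metis (mono_tags, lifting) DiffE mem_Collect_eq subsetD)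
  show ?thesis
    unfolding primitive_of_def
  proof (intro conjI allI impI)
    fix a b :: real
    show "h absolutely_integrable_on {a..b}"
      using absolutely_integrable_spike[OF primitive_ofD(1)[OF u] N(1) eq] .
    assume "a \<le> b"
    then have "u b - u a = integral {a..b} g" by (rule primitive_ofD(3)[OF u])
    also have "\<dots> = integral {a..b} h" by (rule integral_spike[OF N(1)]) (rule eq)
    finally show "u b - u a = integral {a..b} h" .
  qed
qed

lemma primitive_of_cong: "primitive_of u g \<Longrightarrow> (\<And>x. g x = h x) \<Longrightarrow> primitive_of u h"
  by (metis ext)

lemma primitive_of_continuous:
  assumes "primitive_of u g"
  shows "continuous_on UNIV u"
proof -
  have *: "continuous_on {a..b} u" for a b
  proof (cases "a \<le> b")
    case True
    have "continuous_on {a..b} (\<lambda>x. u a + integral {a..x} g)"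
      using indefinite_integral_continuous_1[OF primitive_ofD(2)[OF assms], of a b] by (intro continuous_intros)
    moreover have "u x = u a + integral {a..x} g" if "x \<in> {a..b}" for x
      using primitive_ofD(3)[OF assms, of a x] that by (simp add: algebra_simps)
    ultimately show ?thesis by (metis (mono_tags, lifting) continuous_on_cong)
  qed auto
  have "isCont u x" for x
    using continuous_on_interior[OF *[of "x - 1" "x + 1"], of x] by simp
  then show ?thesis by (simp add: continuous_at_imp_continuous_on)
qed

section \<open>Absolutely continuous functions are primitives\<close>

text \<open>Extending \<open>f\<close> by constants outside \<open>[a, b]\<close> keeps it absolutely continuous. With the variation
  \<open>V\<close>, the functions \<open>V\<close>, \<open>V + Re f\<close> and \<open>V + Im f\<close> are monotone and absolutely continuous, so each
  has a density, and differences of the densities are a density for \<open>f\<close>.\<close>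

lemma abs_cont_on_imp_primitive_of_clamp:
  assumes f: "abs_cont_on a b f" and ab: "a \<le> b"
  shows "\<exists>g. primitive_of (\<lambda>x. f (max a (min b x))) g"
proof -
  define cl where "cl x = max a (min b x)" for x
  have cl: "a \<le> cl x" "cl x \<le> b" "x \<le> y \<Longrightarrow> cl x \<le> cl y" "x \<le> y \<Longrightarrow> cl y - cl x \<le> y - x"
    "{cl x<..<cl y} \<subseteq> {x<..<y}" for x y
    using ab by (auto simp: cl_def max_def min_def)
  define V where "V x = variation f a x" for x
  have inc: "\<bar>p (f z) - p (f y)\<bar> \<le> V z - V y" if "a \<le> y" "y \<le> z" "z \<le> b" "\<And>w w'. \<bar>p w - p w'\<bar> \<le> cmod (w - w')"
    for y z and p :: "complex \<Rightarrow> real"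
    using variation_append[OF f ab that(1-3)] that(4)[of "f z" "f y"] by (simp add: V_def)
  \<comment> \<open>Used with \<open>p\<close> equal to \<open>0\<close>, \<open>Re\<close> and \<open>Im\<close>. Increments of \<open>V + p \<circ> f\<close> are at most twice those of \<open>V\<close>.\<close>
  have dens: "\<exists>g. primitive_of (\<lambda>x. V (cl x) + p (f (cl x))) g"
    if p: "\<And>w w'. \<bar>p w - p w'\<bar> \<le> cmod (w - w')" for p :: "complex \<Rightarrow> real"
  proof (rule mono_absolutely_continuous_has_density)
    show "mono (\<lambda>x. V (cl x) + p (f (cl x)))"
    proof (rule monoI)
      fix x y :: real assume "x \<le> y"
      then show "V (cl x) + p (f (cl x)) \<le> V (cl y) + p (f (cl y))"
        using inc[OF _ cl(3) _ p, of x y] cl by fastforce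
    qed
    fix \<epsilon> :: real assume \<epsilon>: "\<epsilon> > 0"
    obtain \<delta> where \<delta>: "\<delta> > 0" "\<forall>(I :: nat set) c d. finite I \<longrightarrow> (\<forall>i\<in>I. a \<le> c i \<and> c i \<le> d i \<and> d i \<le> b) \<longrightarrow>
      disjoint_family_on (\<lambda>i. {c i<..<d i}) I \<longrightarrow> (\<Sum>i\<in>I. d i - c i) < \<delta> \<longrightarrow>
      (\<Sum>i\<in>I. variation f a (d i) - variation f a (c i)) < \<epsilon> / 2"
      using variation_absolutely_continuous[OF f ab half_gt_zero[OF \<epsilon>]] by (elim exE conjE) (rule that)
    show "\<exists>\<delta>>0. \<forall>(I :: nat set) c d. finite I \<longrightarrow> (\<forall>i\<in>I. c i \<le> d i) \<longrightarrow>
      disjoint_family_on (\<lambda>i. {c i<..<d i}) I \<longrightarrow> (\<Sum>i\<in>I. d i - c i) < \<delta> \<longrightarrow>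
      (\<Sum>i\<in>I. V (cl (d i)) + p (f (cl (d i))) - (V (cl (c i)) + p (f (cl (c i))))) < \<epsilon>"
    proof (intro exI[of _ \<delta>] conjI allI impI \<delta>(1))
      fix I :: "nat set" and c d :: "nat \<Rightarrow> real"
      assume I: "finite I" "\<forall>i\<in>I. c i \<le> d i" "disjoint_family_on (\<lambda>i. {c i<..<d i}) I" "(\<Sum>i\<in>I. d i - c i) < \<delta>"
      have "(\<Sum>i\<in>I. cl (d i) - cl (c i)) \<le> (\<Sum>i\<in>I. d i - c i)"
        using I(2) cl(4) by (intro sum_mono) auto
      then have "(\<Sum>i\<in>I. V (cl (d i)) - V (cl (c i))) < \<epsilon> / 2"
        unfolding V_def using I cl
        by (intro \<delta>(2)[rule_format] I(1) disjoint_family_on_shrink[OF I(3)]) auto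
      moreover have "(\<Sum>i\<in>I. V (cl (d i)) + p (f (cl (d i))) - (V (cl (c i)) + p (f (cl (c i)))))
          \<le> (\<Sum>i\<in>I. 2 * (V (cl (d i)) - V (cl (c i))))"
      proof (rule sum_mono)
        fix i assume "i \<in> I"
        then show "V (cl (d i)) + p (f (cl (d i))) - (V (cl (c i)) + p (f (cl (c i)))) \<le> 2 * (V (cl (d i)) - V (cl (c i)))"
          using inc[OF _ cl(3) _ p, of "c i" "d i"] cl I(2) by fastforce
      qed
      moreover have "\<dots> = 2 * (\<Sum>i\<in>I. V (cl (d i)) - V (cl (c i)))" by (rule sum_distrib_left[symmetric])
      ultimately show "(\<Sum>i\<in>I. V (cl (d i)) + p (f (cl (d i))) - (V (cl (c i)) + p (f (cl (c i))))) < \<epsilon>"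
        by linarith
    qed
  qed
  obtain g0 where g0: "primitive_of (\<lambda>x. V (cl x)) g0" using dens[of "\<lambda>_. 0"] by auto
  obtain g1 where g1: "primitive_of (\<lambda>x. V (cl x) + Re (f (cl x))) g1"
    using dens[of Re] abs_Re_le_cmod by (metis minus_complex.sel(1))
  obtain g2 where g2: "primitive_of (\<lambda>x. V (cl x) + Im (f (cl x))) g2"
    using dens[of Im] abs_Im_le_cmod by (metis minus_complex.sel(2))
  have "primitive_of (\<lambda>x. complex_of_real (Re (f (cl x))) + \<i> * complex_of_real (Im (f (cl x))))
      (\<lambda>x. complex_of_real (g1 x - g0 x) + \<i> * complex_of_real (g2 x - g0 x))"
    using primitive_of_add[OF primitive_of_linear[OF primitive_of_diff[OF g1 g0] bounded_linear_of_real]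
        primitive_of_linear[OF primitive_of_diff[OF g2 g0] bounded_linear_compose[OF bounded_linear_mult_right[of \<i>] bounded_linear_of_real]]]
    by simp
  then show ?thesis unfolding cl_def[symmetric] complex_eq[symmetric] by blast
qed

text \<open>The fundamental theorem of calculus for locally absolutely continuous functions. On the open
  interval the density found for the clamped function is the derivative almost everywhere.\<close>

theorem AC_loc_primitive_of:
  assumes f: "AC_loc f"
  shows "primitive_of f (\<lambda>x. vderiv f x)"
proof -
  have loc: "(\<lambda>x. vderiv f x) absolutely_integrable_on {a..b} \<and> f b - f a = integral {a..b} (\<lambda>x. vderiv f x)"
    if ab: "a \<le> b" for a b
  proof -
    obtain g where g: "primitive_of (\<lambda>x. f (max a (min b x))) g"
      using abs_cont_on_imp_primitive_of_clamp[of a b f] f ab by (auto simp: AC_loc_def)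
    obtain N where N: "negligible N" "{x. \<not> ((\<lambda>x. f (max a (min b x))) has_vector_derivative g x) (at x)} \<subseteq> N"
      using primitive_of_derivative_AE[OF g] unfolding eventually_ae_filter_negligible by auto
    have neg: "negligible (N \<union> {a, b})" using N(1) by auto
    have eq: "vderiv f x = g x" if "x \<in> {a..b} - (N \<union> {a, b})" for x
    proof (rule vector_derivative_at)
      have "((\<lambda>x. f (max a (min b x))) has_vector_derivative g x) (at x)" using N(2) that by auto
      then show "(f has_vector_derivative g x) (at x)"
        by (rule has_vector_derivative_transform_within_open[of _ _ _ "{a<..<b}"]) (use that in auto)
    qed
    have "f b - f a = integral {a..b} g"
      using primitive_ofD(3)[OF g ab] ab by simp
    moreover have "integral {a..b} g = integral {a..b} (\<lambda>x. vderiv f x)"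
      by (rule integral_spike[OF neg]) (rule eq)
    moreover have "(\<lambda>x. vderiv f x) absolutely_integrable_on {a..b}"
      by (rule absolutely_integrable_spike[OF primitive_ofD(1)[OF g] neg]) (rule eq)
    ultimately show ?thesis by simp
  qed
  moreover have "(\<lambda>x. vderiv f x) absolutely_integrable_on {a..b}" for a b
    using loc[of a b] by (cases "a \<le> b") auto
  ultimately show ?thesis unfolding primitive_of_def by blast
qed

text \<open>An integrable function is bounded up to an error that is small in mean, by dominated convergence
  of the excesses over \<open>n\<close>.\<close>

lemma integral_truncation_small:
  fixes h :: "real \<Rightarrow> real"
  assumes h: "h integrable_on {a..b}" "\<And>x. 0 \<le> h x" and e: "e > 0"
  obtains n where "(\<lambda>x. max 0 (h x - real n)) integrable_on {a..b}" "integral {a..b} (\<lambda>x. max 0 (h x - real n)) < e"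
proof -
  have abs: "h absolutely_integrable_on {a..b}"
    using h nonnegative_absolutely_integrable_1 by blast
  have int: "(\<lambda>x. max 0 (h x - real n)) integrable_on {a..b}" for n
    by (intro set_lebesgue_integral_eq_integral(1) absolutely_integrable_max_1 set_integral_diff abs) auto
  have "(\<lambda>n. integral {a..b} (\<lambda>x. max 0 (h x - real n))) \<longlonglongrightarrow> integral {a..b} (\<lambda>x. 0)"
  proof (rule dominated_convergence(2)[OF int h(1)])
    show "norm (max 0 (h x - real n)) \<le> h x" for n x using h(2)[of x] by (auto simp: max_def)
    fix x
    obtain m where "h x \<le> real m" using real_arch_simple by blast
    then have "\<forall>\<^sub>F n in sequentially. max 0 (h x - real n) = 0"
      by (intro eventually_sequentiallyI[of m]) (auto simp: max_def)
    then show "(\<lambda>n. max 0 (h x - real n)) \<longlonglongrightarrow> 0" by (rule tendsto_eventually)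
  qed
  then have "\<forall>\<^sub>F n in sequentially. integral {a..b} (\<lambda>x. max 0 (h x - real n)) < e"
    using e by (intro order_tendstoD(2)) auto
  then obtain n where "integral {a..b} (\<lambda>x. max 0 (h x - real n)) < e"
    by (auto simp: eventually_sequentially)
  with int show ?thesis by (rule that)
qed

text \<open>Split the density into a part bounded by \<open>n\<close>, whose contribution is \<open>n\<close> times the total length,
  and an excess with small integral \<open>K b - K a\<close>, which bounds the increments of \<open>K\<close> over any family
  of disjoint intervals.\<close>

theorem primitive_of_imp_AC_loc:
  fixes u :: "real \<Rightarrow> complex"
  assumes u: "primitive_of u g"
  shows "AC_loc u"
  unfolding AC_loc_def
proof (intro allI)
  fix a b :: real
  show "abs_cont_on a b u"
    unfolding abs_cont_on_def
  proof (intro allI impI)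
    fix \<epsilon> :: real assume \<epsilon>: "\<epsilon> > 0"
    have ng: "(\<lambda>x. cmod (g x)) integrable_on {x..y}" for x y
      using primitive_ofD(1)[OF u] by (simp add: absolutely_integrable_on_def)
    obtain n where n: "(\<lambda>x. max 0 (cmod (g x) - real n)) integrable_on {a..b}"
        "integral {a..b} (\<lambda>x. max 0 (cmod (g x) - real n)) < \<epsilon> / 2"
      using integral_truncation_small[OF ng _ half_gt_zero[OF \<epsilon>], of a b] by auto
    define k where "k x = max 0 (cmod (g x) - real n)" for x
    define cl where "cl x = max a (min b x)" for x
    define K where "K x = integral {a..cl x} k" for x
    have k: "k integrable_on {x..y}" if "a \<le> x" "y \<le> b" for x y
      using n(1) that unfolding k_def[symmetric] by (rule_tac integrable_on_subinterval) auto
    have k0: "0 \<le> k x" for x by (simp add: k_def)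
    have mono: "mono K" if "a \<le> b"
      unfolding K_def
    proof (rule monoI)
      fix x y :: real assume "x \<le> y"
      then have "cl x \<le> cl y" "cl y \<le> b" using that by (auto simp: cl_def)
      then show "integral {a..cl x} k \<le> integral {a..cl y} k"
        by (intro integral_subset_le k) (auto simp: k0)
    qed
    define \<delta> where "\<delta> = \<epsilon> / (2 * (real n + 1))"
    have \<delta>: "\<delta> > 0" "real n * \<delta> \<le> \<epsilon> / 2" using \<epsilon> by (auto simp: \<delta>_def field_simps)
    show "\<exists>\<delta>>0. \<forall>(N::nat) c d. (\<forall>i<N. a \<le> c i \<and> c i \<le> d i \<and> d i \<le> b) \<and>
        disjoint_family_on (\<lambda>i. {c i<..<d i}) {..<N} \<and> (\<Sum>i<N. d i - c i) < \<delta> \<longrightarrow>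
        (\<Sum>i<N. cmod (u (d i) - u (c i))) < \<epsilon>"
    proof (intro exI[of _ \<delta>] conjI allI impI \<delta>(1), elim conjE)
      fix N :: nat and c d :: "nat \<Rightarrow> real"
      assume cd: "\<forall>i<N. a \<le> c i \<and> c i \<le> d i \<and> d i \<le> b"
        and dis: "disjoint_family_on (\<lambda>i. {c i<..<d i}) {..<N}" and sm: "(\<Sum>i<N. d i - c i) < \<delta>"
      show "(\<Sum>i<N. cmod (u (d i) - u (c i))) < \<epsilon>"
      proof (cases "N = 0")
        case False
        then have ab: "a \<le> b" using cd by force
        have each: "cmod (u (d i) - u (c i)) \<le> (K (d i) - K (c i)) + real n * (d i - c i)" if i: "i < N" for i
        proof -
          have ci: "a \<le> c i" "c i \<le> d i" "d i \<le> b" using cd i by auto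
          then have cl: "cl (c i) = c i" "cl (d i) = d i" by (auto simp: cl_def)
          have "cmod (u (d i) - u (c i)) = cmod (integral {c i..d i} g)"
            using primitive_ofD(3)[OF u ci(2)] by simp
          also have "\<dots> \<le> integral {c i..d i} (\<lambda>x. k x + real n)"
          proof (rule integral_norm_bound_integral[OF primitive_ofD(2)[OF u]])
            show "(\<lambda>x. k x + real n) integrable_on {c i..d i}"
              using k[OF ci(1,3)] by (intro integrable_add) auto
          qed (auto simp: k_def)
          also have "\<dots> = integral {c i..d i} k + real n * (d i - c i)"
            using k[OF ci(1,3)] ci by (subst integral_add) auto
          also have "integral {c i..d i} k = K (d i) - K (c i)"
            using Henstock_Kurzweil_Integration.integral_combine[OF ci(1,2) k[OF order_refl ci(3)]] by (simp add: K_def cl)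
          finally show ?thesis .
        qed
        have "(\<Sum>i<N. cmod (u (d i) - u (c i))) \<le> (\<Sum>i<N. (K (d i) - K (c i)) + real n * (d i - c i))"
          using each by (intro sum_mono) auto
        also have "\<dots> = (\<Sum>i<N. K (d i) - K (c i)) + real n * (\<Sum>i<N. d i - c i)"
          by (simp add: sum.distrib sum_distrib_left)
        also have "\<dots> \<le> (K b - K a) + real n * \<delta>"
          using mono_sum_disjoint_intervals_le[of "{..<N}" K a b c d, OF _ mono[OF ab] ab _ dis] cd sm
          by (intro add_mono mult_left_mono) auto
        also have "K b - K a = integral {a..b} k" using ab by (simp add: K_def cl_def)
        also have "integral {a..b} k + real n * \<delta> < \<epsilon>"
          using n(2) \<delta>(2) unfolding k_def[symmetric] by simp
        finally show ?thesis .
      qed (use \<epsilon> in simp)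
    qed
  qed
qed

text \<open>One criterion for products and for compositions with locally Lipschitz functions: increments of
  \<open>w\<close> are dominated by those of two absolutely continuous functions.\<close>

lemma AC_loc_dominated:
  assumes u: "AC_loc u" and v: "AC_loc v"
    and dom: "\<And>a b. \<exists>M. \<forall>x\<in>{a..b}. \<forall>y\<in>{a..b}. cmod (w y - w x) \<le> M * (cmod (u y - u x) + cmod (v y - v x))"
  shows "AC_loc w"
  unfolding AC_loc_def
proof (intro allI)
  fix a b :: real
  obtain M' where M': "\<forall>x\<in>{a..b}. \<forall>y\<in>{a..b}. cmod (w y - w x) \<le> M' * (cmod (u y - u x) + cmod (v y - v x))"
    using dom by blast
  define M where "M = max 1 M'"
  have M: "M > 0" by (simp add: M_def)
  have prod: "cmod (w y - w x) \<le> M * (cmod (u y - u x) + cmod (v y - v x))" if "x \<in> {a..b}" "y \<in> {a..b}" for x y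
  proof -
    have "cmod (w y - w x) \<le> M' * (cmod (u y - u x) + cmod (v y - v x))" using M' that by blast
    also have "\<dots> \<le> M * (cmod (u y - u x) + cmod (v y - v x))" by (intro mult_right_mono) (auto simp: M_def)
    finally show ?thesis .
  qed
  show "abs_cont_on a b w"
    unfolding abs_cont_on_def
  proof (intro allI impI)
    fix \<epsilon> :: real assume "\<epsilon> > 0"
    then have \<epsilon>: "\<epsilon> / (2 * M) > 0" using M by simp
    have "abs_cont_on a b u" "abs_cont_on a b v" using u v by (auto simp: AC_loc_def)
    from this(1)[unfolded abs_cont_on_def, rule_format, OF \<epsilon>] this(2)[unfolded abs_cont_on_def, rule_format, OF \<epsilon>]
    obtain \<delta>1 \<delta>2 where \<delta>: "\<delta>1 > 0" "\<delta>2 > 0"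
      and d1: "\<forall>(n::nat) c d. (\<forall>i<n. a \<le> c i \<and> c i \<le> d i \<and> d i \<le> b) \<and>
          disjoint_family_on (\<lambda>i. {c i<..<d i}) {..<n} \<and> (\<Sum>i<n. d i - c i) < \<delta>1 \<longrightarrow>
          (\<Sum>i<n. cmod (u (d i) - u (c i))) < \<epsilon> / (2 * M)"
      and d2: "\<forall>(n::nat) c d. (\<forall>i<n. a \<le> c i \<and> c i \<le> d i \<and> d i \<le> b) \<and>
          disjoint_family_on (\<lambda>i. {c i<..<d i}) {..<n} \<and> (\<Sum>i<n. d i - c i) < \<delta>2 \<longrightarrow>
          (\<Sum>i<n. cmod (v (d i) - v (c i))) < \<epsilon> / (2 * M)"
      by (elim exE conjE) (rule that)
    show "\<exists>\<delta>>0. \<forall>(n::nat) c d. (\<forall>i<n. a \<le> c i \<and> c i \<le> d i \<and> d i \<le> b) \<and>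
        disjoint_family_on (\<lambda>i. {c i<..<d i}) {..<n} \<and> (\<Sum>i<n. d i - c i) < \<delta> \<longrightarrow>
        (\<Sum>i<n. cmod (w (d i) - w (c i))) < \<epsilon>"
    proof (intro exI[of _ "min \<delta>1 \<delta>2"] conjI allI impI, goal_cases)
      case (2 n c d)
      have 1: "(\<Sum>i<n. cmod (u (d i) - u (c i))) < \<epsilon> / (2 * M)" using 2 by (intro d1[rule_format]) auto
      have 3: "(\<Sum>i<n. cmod (v (d i) - v (c i))) < \<epsilon> / (2 * M)" using 2 by (intro d2[rule_format]) auto
      have "(\<Sum>i<n. cmod (w (d i) - w (c i))) \<le>
          (\<Sum>i<n. M * (cmod (u (d i) - u (c i)) + cmod (v (d i) - v (c i))))"
      proof (rule sum_mono)
        fix i assume "i \<in> {..<n}"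
        then have "a \<le> c i \<and> c i \<le> d i \<and> d i \<le> b" using 2 by blast
        then show "cmod (w (d i) - w (c i)) \<le> M * (cmod (u (d i) - u (c i)) + cmod (v (d i) - v (c i)))"
          by (intro prod) auto
      qed
      also have "\<dots> = M * ((\<Sum>i<n. cmod (u (d i) - u (c i))) + (\<Sum>i<n. cmod (v (d i) - v (c i))))"
        by (simp only: sum.distrib[symmetric] sum_distrib_left)
      also have "\<dots> < M * (\<epsilon> / (2 * M) + \<epsilon> / (2 * M))"
        using 1 3 M by (intro mult_strict_left_mono add_strict_mono) auto
      also have "\<dots> = \<epsilon>" using M by (simp add: field_simps)
      finally show ?case .
    qed (use \<delta> in auto)
  qed
qed

lemma AC_loc_mult:
  assumes u: "AC_loc u" and v: "AC_loc v"
  shows "AC_loc (\<lambda>x. u x * v x)"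
proof (rule AC_loc_dominated[OF u v])
  fix a b :: real
  have "continuous_on UNIV u" "continuous_on UNIV v"
    using primitive_of_continuous[OF AC_loc_primitive_of] assms by auto
  then have "compact (u ` {a..b})" "compact (v ` {a..b})"
    by (auto intro!: compact_continuous_image elim: continuous_on_subset)
  then obtain M1 M2 where M1: "\<And>x. x \<in> {a..b} \<Longrightarrow> cmod (u x) \<le> M1" and M2: "\<And>x. x \<in> {a..b} \<Longrightarrow> cmod (v x) \<le> M2"
    by (metis bounded_iff compact_imp_bounded image_eqI)
  define M where "M = max M1 M2"
  have M: "\<And>x. x \<in> {a..b} \<Longrightarrow> cmod (u x) \<le> M" "\<And>x. x \<in> {a..b} \<Longrightarrow> cmod (v x) \<le> M"
    using M1 M2 by (force simp: M_def)+
  have "cmod (u y * v y - u x * v x) \<le> M * (cmod (u y - u x) + cmod (v y - v x))"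
    if "x \<in> {a..b}" "y \<in> {a..b}" for x y
  proof -
    have "u y * v y - u x * v x = (u y - u x) * v y + u x * (v y - v x)" by (simp add: algebra_simps)
    then have "cmod (u y * v y - u x * v x) \<le> cmod (u y - u x) * cmod (v y) + cmod (u x) * cmod (v y - v x)"
      by (metis norm_mult norm_triangle_ineq)
    also have "\<dots> \<le> cmod (u y - u x) * M + M * cmod (v y - v x)"
      using M that by (intro add_mono mult_left_mono mult_right_mono) auto
    finally show ?thesis by (simp add: algebra_simps)
  qed
  then show "\<exists>M. \<forall>x\<in>{a..b}. \<forall>y\<in>{a..b}. cmod (u y * v y - u x * v x) \<le> M * (cmod (u y - u x) + cmod (v y - v x))"
    by blast
qed

text \<open>Integration by parts. The product is absolutely continuous, hence the primitive of its own
  derivative, which the product rule identifies almost everywhere.\<close>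

theorem primitive_of_mult:
  fixes u v :: "real \<Rightarrow> complex"
  assumes u: "primitive_of u g" and v: "primitive_of v h"
  shows "primitive_of (\<lambda>x. u x * v x) (\<lambda>x. g x * v x + u x * h x)"
proof (rule primitive_of_cong_AE)
  show "primitive_of (\<lambda>x. u x * v x) (\<lambda>x. vderiv (\<lambda>x. u x * v x) x)"
    by (intro AC_loc_primitive_of AC_loc_mult primitive_of_imp_AC_loc[OF u] primitive_of_imp_AC_loc[OF v])
  show "AE x in lebesgue. vderiv (\<lambda>x. u x * v x) x = g x * v x + u x * h x"
    using primitive_of_derivative_AE[OF u] primitive_of_derivative_AE[OF v]
  proof eventually_elim
    case (elim x)
    then show ?case
      by (intro vector_derivative_at) (auto intro!: derivative_eq_intros)
  qed
qed


section \<open>Global solutions of first-order systems\<close>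

lemma primitive_of_exp:
  fixes p :: "real \<Rightarrow> real"
  assumes p: "primitive_of p k"
  shows "primitive_of (\<lambda>x. exp (p x)) (\<lambda>x. k x * exp (p x))"
proof -
  have ac: "AC_loc (\<lambda>x. complex_of_real (p x))"
    using primitive_of_linear[OF p bounded_linear_of_real] by (rule primitive_of_imp_AC_loc)
  have "AC_loc (\<lambda>x. complex_of_real (exp (p x)))"
  proof (rule AC_loc_dominated[OF ac ac])
    fix a b :: real
    have "compact (p ` {a..b})"
      using primitive_of_continuous[OF p] by (auto intro!: compact_continuous_image elim: continuous_on_subset)
    then obtain B where B: "\<And>x. x \<in> {a..b} \<Longrightarrow> \<bar>p x\<bar> \<le> B"
      by (metis bounded_iff compact_imp_bounded image_eqI real_norm_def)
    have *: "\<bar>exp s - exp t\<bar> \<le> exp B * \<bar>s - t\<bar>" if "\<bar>s\<bar> \<le> B" "\<bar>t\<bar> \<le> B" "t \<le> s" for s t :: real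
    proof -
      have "exp s - exp t = exp s * (1 - exp (t - s))" by (simp add: algebra_simps exp_diff)
      also have "\<dots> \<le> exp s * (s - t)" 
        by (intro mult_left_mono) (use exp_ge_add_one_self[of "t - s"] in linarith, simp)
      also have "\<dots> \<le> exp B * (s - t)" using that by (intro mult_right_mono) auto
      finally show ?thesis using that by simp
    qed
    have lipschitz: "\<bar>exp s - exp t\<bar> \<le> exp B * \<bar>s - t\<bar>" if "\<bar>s\<bar> \<le> B" "\<bar>t\<bar> \<le> B" for s t
      using *[of s t] *[of t s] that by (cases "t \<le> s") (auto simp: abs_minus_commute)
    have "cmod (complex_of_real (exp (p y)) - complex_of_real (exp (p x)))
        \<le> exp B * (cmod (complex_of_real (p y) - complex_of_real (p x)) + cmod (complex_of_real (p y) - complex_of_real (p x)))"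
      if "x \<in> {a..b}" "y \<in> {a..b}" for x y
    proof -
      have "\<bar>exp (p y) - exp (p x)\<bar> \<le> exp B * \<bar>p y - p x\<bar>" 
        by (intro lipschitz B that)
      also have "\<dots> \<le> exp B * (\<bar>p y - p x\<bar> + \<bar>p y - p x\<bar>)" by (intro mult_left_mono) auto
      finally show ?thesis by (simp only: of_real_diff[symmetric] norm_of_real)
    qed
    then show "\<exists>M. \<forall>x\<in>{a..b}. \<forall>y\<in>{a..b}. cmod (complex_of_real (exp (p y)) - complex_of_real (exp (p x)))
        \<le> M * (cmod (complex_of_real (p y) - complex_of_real (p x)) + cmod (complex_of_real (p y) - complex_of_real (p x)))"
      by blast
  qed
  then have "primitive_of (\<lambda>x. Re (complex_of_real (exp (p x)))) (\<lambda>x. Re (vderiv (\<lambda>x. complex_of_real (exp (p x))) x))"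
    by (intro primitive_of_linear[OF _ bounded_linear_Re] AC_loc_primitive_of)
  then have *: "primitive_of (\<lambda>x. exp (p x)) (\<lambda>x. Re (vderiv (\<lambda>x. complex_of_real (exp (p x))) x))" by simp
  show ?thesis
  proof (rule primitive_of_cong_AE[OF *])
    show "AE x in lebesgue. Re (vderiv (\<lambda>x. complex_of_real (exp (p x))) x) = k x * exp (p x)"
      using primitive_of_derivative_AE[OF p]
    proof eventually_elim
      case (elim x)
      then have "((\<lambda>x. exp (p x)) has_real_derivative exp (p x) * k x) (at x)"
        by (auto intro!: derivative_eq_intros simp: has_real_derivative_iff_has_vector_derivative[symmetric])
      then have "((\<lambda>x. complex_of_real (exp (p x))) has_vector_derivative complex_of_real (exp (p x) * k x)) (at x)"
        unfolding has_real_derivative_iff_has_vector_derivative by (rule bounded_linear.has_vector_derivative[OF bounded_linear_of_real])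
      then show ?case by (simp add: vector_derivative_at mult.commute)
    qed
  qed
qed

definition signed_integral :: "real \<Rightarrow> (real \<Rightarrow> 'a::euclidean_space) \<Rightarrow> real \<Rightarrow> 'a" where
  "signed_integral x0 g x = (if x0 \<le> x then integral {x0..x} g else - integral {x..x0} g)"

lemma primitive_of_signed_integral:
  assumes "\<And>a b. g absolutely_integrable_on {a..b}"
  shows "primitive_of (signed_integral x0 g) g"
  unfolding primitive_of_def
proof (intro conjI allI impI assms)
  fix a b :: real assume ab: "a \<le> b"
  have g: "g integrable_on {a..b}" for a b using assms by (simp add: absolutely_integrable_on_def)
  have comb: "integral {a..c} g + integral {c..b} g = integral {a..b} g" if "a \<le> c" "c \<le> b" for a b c
    using Henstock_Kurzweil_Integration.integral_combine[OF that g] .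
  show "signed_integral x0 g b - signed_integral x0 g a = integral {a..b} g"
    using comb[of x0 a b] comb[of a x0 b] comb[of a b x0] ab
    by (auto simp: signed_integral_def algebra_simps)
qed

lemma signed_integral_self [simp]: "signed_integral x0 g x0 = 0"
  by (simp add: signed_integral_def)

text \<open>The integral equation \<open>Y = c + \<integral> H(t, Y)\<close> is solved on the whole line at once. In the sup norm
  weighted by \<open>E = exp (2 \<bar>p\<bar>)\<close>, where \<open>p\<close> is the primitive of \<open>k\<close> that vanishes at \<open>x0\<close>, the
  integral operator is a contraction with constant \<open>1/2\<close>, because \<open>E/2\<close> majorizes the integral of
  \<open>k E\<close> from \<open>x0\<close>.\<close>

theorem caratheodory_global_solution:
  fixes H :: "real \<Rightarrow> 'a::euclidean_space \<Rightarrow> 'a" and k :: "real \<Rightarrow> real"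
  assumes int: "\<And>Y a b. continuous_on UNIV Y \<Longrightarrow> (\<lambda>t. H t (Y t)) absolutely_integrable_on {a..b}"
    and k: "\<And>a b. k absolutely_integrable_on {a..b}" "\<And>t. 0 \<le> k t"
    and lip: "\<And>t y y'. norm (H t y - H t y') \<le> k t * norm (y - y')"
    and H0: "\<And>t. norm (H t 0) \<le> k t"
  shows "\<exists>Y. Y x0 = c \<and> primitive_of Y (\<lambda>t. H t (Y t))"
proof -
  define p where "p = signed_integral x0 k"
  have p: "primitive_of p k" unfolding p_def by (rule primitive_of_signed_integral[OF k(1)])
  have p0: "p x0 = 0" by (simp add: p_def)
  have p_mono: "p x \<le> p y" if "x \<le> y" for x y
    using primitive_ofD(3)[OF p that] integral_nonneg[OF primitive_ofD(2)[OF p], of x y] k(2) by simp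
  define E where "E x = exp (2 * \<bar>p x\<bar>)" for x
  have E: "E x > 0" "E x \<ge> 1" for x by (auto simp: E_def)
  have cE: "continuous_on UNIV E"
    unfolding E_def using primitive_of_continuous[OF p] by (intro continuous_intros)
  have e_pos: "primitive_of (\<lambda>x. exp (2 * p x)) (\<lambda>x. 2 * k x * exp (2 * p x))"
    using primitive_of_exp[OF primitive_of_linear[OF p bounded_linear_mult_right[of 2]]] .
  have e_neg: "primitive_of (\<lambda>x. exp (- 2 * p x)) (\<lambda>x. - 2 * k x * exp (- 2 * p x))"
    using primitive_of_exp[OF primitive_of_linear[OF p bounded_linear_mult_right[of "- 2"]]] .
  have bound: "norm (signed_integral x0 h x) \<le> m / 2 * E x"
    if h: "\<And>a b. h absolutely_integrable_on {a..b}" and hm: "\<And>t. norm (h t) \<le> m * (k t * E t)" and m: "m \<ge> 0"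
    for h :: "real \<Rightarrow> 'a" and m x
  proof -
    have hi: "h integrable_on {a..b}" for a b using h by (simp add: absolutely_integrable_on_def)
    show ?thesis
    proof (cases "x0 \<le> x")
      case True
      have "norm (integral {x0..x} h) \<le> integral {x0..x} (\<lambda>t. m / 2 * (2 * k t * exp (2 * p t)))"
      proof (rule integral_norm_bound_integral[OF hi])
        show "(\<lambda>t. m / 2 * (2 * k t * exp (2 * p t))) integrable_on {x0..x}"
          by (rule integrable_on_mult_right[OF primitive_ofD(2)[OF e_pos]])
        fix t assume "t \<in> {x0..x}"
        then have "0 \<le> p t" using p_mono[of x0 t] p0 by simp
        then show "norm (h t) \<le> m / 2 * (2 * k t * exp (2 * p t))" using hm[of t] by (simp add: E_def)
      qed
      also have "\<dots> = m / 2 * integral {x0..x} (\<lambda>t. 2 * k t * exp (2 * p t))"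
        by (rule integral_mult_right)
      also have "\<dots> = m / 2 * (exp (2 * p x) - 1)"
        using primitive_ofD(3)[OF e_pos True] by (simp add: p0)
      also have "\<dots> \<le> m / 2 * E x"
        using p_mono[OF True] p0 m by (intro mult_left_mono) (auto simp: E_def)
      finally show ?thesis using True by (simp add: signed_integral_def)
    next
      case False
      have "norm (integral {x..x0} h) \<le> integral {x..x0} (\<lambda>t. - m / 2 * (- 2 * k t * exp (- 2 * p t)))"
      proof (rule integral_norm_bound_integral[OF hi])
        show "(\<lambda>t. - m / 2 * (- 2 * k t * exp (- 2 * p t))) integrable_on {x..x0}"
          by (rule integrable_on_mult_right[OF primitive_ofD(2)[OF e_neg]])
        fix t assume "t \<in> {x..x0}"
        then have "p t \<le> 0" using p_mono[of t x0] p0 by simp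
        then show "norm (h t) \<le> - m / 2 * (- 2 * k t * exp (- 2 * p t))" using hm[of t] by (simp add: E_def)
      qed
      also have "\<dots> = - m / 2 * integral {x..x0} (\<lambda>t. - 2 * k t * exp (- 2 * p t))"
        by (rule integral_mult_right)
      also have "\<dots> = m / 2 * (exp (- 2 * p x) - 1)"
      proof -
        have I: "integral {x..x0} (\<lambda>t. - 2 * k t * exp (- 2 * p t)) = 1 - exp (- 2 * p x)"
          using primitive_ofD(3)[OF e_neg, of x x0] False p0 by simp
        show ?thesis unfolding I by (simp add: algebra_simps)
      qed
      also have "\<dots> \<le> m / 2 * E x"
        using p_mono[of x x0] p0 m False by (intro mult_left_mono) (auto simp: E_def)
      finally show ?thesis using False by (simp add: signed_integral_def)
    qed
  qed
  \<comment> \<open>The unknown is \<open>Z = Y / E\<close>, a bounded continuous function.\<close>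
  define S where "S Z = signed_integral x0 (\<lambda>t. H t (E t *\<^sub>R apply_bcontfun Z t))" for Z :: "real \<Rightarrow>\<^sub>C 'a"
  define T where "T Z = Bcontfun (\<lambda>x. (c + S Z x) /\<^sub>R E x)" for Z :: "real \<Rightarrow>\<^sub>C 'a"
  have intZ: "(\<lambda>t. H t (E t *\<^sub>R apply_bcontfun Z t)) absolutely_integrable_on {a..b}" for Z a b
    by (intro int continuous_intros cE) auto
  have primS: "primitive_of (S Z) (\<lambda>t. H t (E t *\<^sub>R apply_bcontfun Z t))" for Z
    unfolding S_def by (rule primitive_of_signed_integral[OF intZ])
  have bS: "norm (S Z x) \<le> (1 + norm Z) / 2 * E x" for Z x
    unfolding S_def
  proof (rule bound[OF intZ])
    fix t
    have "norm (H t (E t *\<^sub>R Z t)) \<le> norm (H t 0) + norm (H t (E t *\<^sub>R Z t) - H t 0)"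
      using norm_triangle_sub by blast
    also have "\<dots> \<le> k t + k t * norm (E t *\<^sub>R Z t)"
      using H0[of t] lip[of t "E t *\<^sub>R Z t" 0] by (intro add_mono) auto
    also have "\<dots> \<le> k t * E t + k t * (E t * norm Z)"
      using E[of t] k(2)[of t] norm_bounded[of Z t]
      by (intro add_mono mult_left_mono) (auto simp: mult_le_cancel_left1)
    finally show "norm (H t (E t *\<^sub>R Z t)) \<le> (1 + norm Z) * (k t * E t)"
      by (simp add: algebra_simps)
  qed auto
  have T: "apply_bcontfun (T Z) x = (c + S Z x) /\<^sub>R E x" for Z x
  proof -
    have "continuous_on UNIV (\<lambda>x. (c + S Z x) /\<^sub>R E x)"
      using primitive_of_continuous[OF primS] cE E(1) by (intro continuous_intros) (auto simp: less_imp_neq[THEN not_sym])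
    moreover have "norm ((c + S Z x) /\<^sub>R E x) \<le> norm c + (1 + norm Z) / 2" for x
    proof -
      have "norm (c + S Z x) \<le> norm c * E x + (1 + norm Z) / 2 * E x"
        using norm_triangle_ineq[of c "S Z x"] bS[of Z x] E(2)[of x] mult_left_mono[of 1 "E x" "norm c"] by simp
      then have "norm (c + S Z x) / E x \<le> norm c + (1 + norm Z) / 2" using E(1)[of x] by (simp add: field_simps)
      moreover have "norm ((c + S Z x) /\<^sub>R E x) = norm (c + S Z x) / E x"
        using E(1)[of x] by (simp only: norm_scaleR) (simp add: divide_inverse mult.commute)
      ultimately show ?thesis by simp
    qed
    ultimately have "(\<lambda>x. (c + S Z x) /\<^sub>R E x) \<in> bcontfun"
      unfolding bcontfun_def bounded_iff by blast
    then show ?thesis by (simp add: T_def Bcontfun_inverse)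
  qed
  have "\<exists>!Z. T Z = Z"
  proof (rule banach_fix_type)
    show "\<forall>Z W. dist (T Z) (T W) \<le> 1 / 2 * dist Z W"
    proof (intro allI dist_bound)
      fix Z W :: "real \<Rightarrow>\<^sub>C 'a" and x
      let ?h = "\<lambda>t. H t (E t *\<^sub>R Z t) - H t (E t *\<^sub>R W t)"
      have ii: "(\<lambda>t. H t (E t *\<^sub>R apply_bcontfun Z t)) integrable_on {a..b}" for Z a b
        using intZ by (simp add: absolutely_integrable_on_def)
      have "S Z x - S W x = signed_integral x0 ?h x"
        unfolding S_def signed_integral_def using integral_diff[OF ii ii] by auto
      moreover have "norm (signed_integral x0 ?h x) \<le> dist Z W / 2 * E x"
      proof (rule bound)
        show "?h absolutely_integrable_on {a..b}" for a b by (intro set_integral_diff intZ)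
        fix t
        have "norm (?h t) \<le> k t * norm (E t *\<^sub>R Z t - E t *\<^sub>R W t)" by (rule lip)
        also have "norm (E t *\<^sub>R Z t - E t *\<^sub>R W t) = E t * dist (Z t) (W t)"
          using E(1)[of t] by (simp add: scaleR_diff_right[symmetric] dist_norm)
        also have "k t * (E t * dist (Z t) (W t)) \<le> k t * (E t * dist Z W)"
          using k(2)[of t] E(1)[of t] dist_bounded[of Z t W] by (intro mult_left_mono) auto
        finally show "norm (?h t) \<le> dist Z W * (k t * E t)" by (simp add: algebra_simps)
      qed auto
      ultimately have "norm (S Z x - S W x) / E x \<le> dist Z W / 2"
        using E(1)[of x] by (simp add: field_simps)
      moreover have "dist (T Z x) (T W x) = norm (S Z x - S W x) / E x"
      proof -
        have "T Z x - T W x = (S Z x - S W x) /\<^sub>R E x" by (simp add: T scaleR_diff_right[symmetric])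
        then show ?thesis using E(1)[of x] by (simp add: dist_norm divide_inverse)
      qed
      ultimately show "dist (T Z x) (T W x) \<le> 1 / 2 * dist Z W" by simp
    qed
  qed auto
  then obtain Z where Z: "T Z = Z" by blast
  define Y where "Y x = c + S Z x" for x
  have Y: "Y t = E t *\<^sub>R Z t" for t
    using T[of Z t] E(1)[of t] unfolding Z Y_def by simp
  have "primitive_of Y (\<lambda>t. 0 + H t (E t *\<^sub>R Z t))"
    unfolding Y_def by (rule primitive_of_add[OF primitive_of_const primS])
  then have "primitive_of Y (\<lambda>t. H t (Y t))" by (simp add: Y)
  moreover have "Y x0 = c" by (simp add: Y_def S_def)
  ultimately show ?thesis by blast
qed


section \<open>Orthogonal complements of closed subspaces\<close>

lemma subspace_orthogonal_minimizer:
  fixes y :: "'a::real_inner"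
  assumes "subspace M" and min: "\<And>m. m \<in> M \<Longrightarrow> norm y \<le> norm (y - m)" and m: "m \<in> M"
  shows "inner m y = 0"
proof (cases "m = 0")
  case False
  define t where "t = inner m y / inner m m"
  have pos: "inner m m > 0" using False by simp
  have "t *\<^sub>R m \<in> M" using assms(1) m by (rule subspace_scale)
  from min[OF this] have "(norm y)\<^sup>2 \<le> (norm (y - t *\<^sub>R m))\<^sup>2" by (intro power_mono) auto
  also have "\<dots> = (norm y)\<^sup>2 - 2 * t * inner m y + t * t * inner m m"
    by (simp add: power2_norm_eq_inner inner_diff_left inner_diff_right inner_commute algebra_simps)
  also have "\<dots> = (norm y)\<^sup>2 - (inner m y)\<^sup>2 / inner m m"
    using pos by (simp add: t_def field_simps power2_eq_square)
  finally have "(inner m y)\<^sup>2 / inner m m \<le> 0" by simp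
  then show ?thesis using pos by (simp add: divide_le_0_iff)
qed auto

text \<open>The vector \<open>y\<close> is the difference of \<open>x\<close> and its nearest point in \<open>M\<close>. A minimizing sequence is
  Cauchy by the parallelogram law, and \<open>inner x y\<close> is the squared distance of \<open>x\<close> from \<open>M\<close>. The
  lemma is used both for \<open>l2\<close> and for graphs, which are subspaces of \<open>l2 \<times> l2\<close>.\<close>

lemma closed_subspace_separation:
  fixes M :: "'a::{real_inner,complete_space} set"
  assumes M: "subspace M" "closed M" and x: "x \<notin> M"
  obtains y where "\<And>m. m \<in> M \<Longrightarrow> inner m y = 0" "inner x y \<noteq> 0"
proof -
  have ne: "M \<noteq> {}" using subspace_0[OF M(1)] by auto
  define d where "d = infdist x M"
  have d: "0 \<le> d" "\<And>m. m \<in> M \<Longrightarrow> d \<le> norm (x - m)"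
    using infdist_le[of _ M x] by (auto simp: d_def infdist_nonneg dist_norm)
  have "\<exists>m\<in>M. norm (x - m) < d + inverse (real (Suc n))" for n
  proof -
    have "infdist x M < d + inverse (real (Suc n))" by (simp add: d_def)
    then have "Inf ((\<lambda>m. norm (x - m)) ` M) < d + inverse (real (Suc n))"
      using ne by (simp add: infdist_def dist_norm)
    then show ?thesis using cInf_lessD[of "(\<lambda>m. norm (x - m)) ` M"] ne by blast
  qed
  then obtain m where m: "\<And>n. m n \<in> M" "\<And>n. norm (x - m n) < d + inverse (real (Suc n))" by metis
  have lim: "(\<lambda>n. norm (x - m n)) \<longlonglongrightarrow> d"
  proof (rule tendsto_sandwich[OF _ _ tendsto_const])
    show "(\<lambda>n. d + inverse (real (Suc n))) \<longlonglongrightarrow> d"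
      using tendsto_add[OF tendsto_const LIMSEQ_inverse_real_of_nat, of d] by simp
  qed (use d m in \<open>auto intro!: always_eventually less_imp_le\<close>)
  have "Cauchy m"
  proof (rule metric_CauchyI)
    fix e :: real assume e: "e > 0"
    have "(\<lambda>n. (norm (x - m n))\<^sup>2) \<longlonglongrightarrow> d\<^sup>2" by (intro tendsto_power lim)
    then have "\<forall>\<^sub>F n in sequentially. (norm (x - m n))\<^sup>2 < d\<^sup>2 + e\<^sup>2 / 4"
      using e by (intro order_tendstoD(2)) auto
    then obtain N where N: "\<And>n. n \<ge> N \<Longrightarrow> (norm (x - m n))\<^sup>2 < d\<^sup>2 + e\<^sup>2 / 4"
      by (auto simp: eventually_sequentially)
    have "dist (m i) (m j) < e" if ij: "i \<ge> N" "j \<ge> N" for i j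
    proof -
      have "(1/2) *\<^sub>R (m i + m j) \<in> M" using M(1) m(1) by (intro subspace_scale subspace_add) auto
      then have "d\<^sup>2 \<le> (norm (x - (1/2) *\<^sub>R (m i + m j)))\<^sup>2" using d by (intro power_mono) auto
      moreover have "(norm (m i - m j))\<^sup>2 = 2 * (norm (x - m i))\<^sup>2 + 2 * (norm (x - m j))\<^sup>2 - 4 * (norm (x - (1/2) *\<^sub>R (m i + m j)))\<^sup>2"
        by (simp add: power2_norm_eq_inner inner_diff_left inner_diff_right inner_add_left inner_add_right inner_commute algebra_simps)
      ultimately have "(norm (m i - m j))\<^sup>2 < e\<^sup>2" using N[OF ij(1)] N[OF ij(2)] by linarith
      then show ?thesis using e by (simp add: dist_norm power2_less_imp_less)
    qed
    then show "\<exists>N. \<forall>i\<ge>N. \<forall>j\<ge>N. dist (m i) (m j) < e" by blast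
  qed
  then obtain z where z: "m \<longlonglongrightarrow> z" using Cauchy_convergent convergent_def by blast
  have zM: "z \<in> M" using closed_sequentially[OF M(2)] m(1) z by blast
  have "(\<lambda>n. norm (x - m n)) \<longlonglongrightarrow> norm (x - z)" by (intro tendsto_intros z)
  then have nz: "norm (x - z) = d" using lim LIMSEQ_unique by blast
  have orth: "inner w (x - z) = 0" if "w \<in> M" for w
  proof (rule subspace_orthogonal_minimizer[OF M(1) _ that])
    fix w assume "w \<in> M"
    then have "z + w \<in> M" using zM M(1) by (simp add: subspace_add)
    from d(2)[OF this] show "norm (x - z) \<le> norm (x - z - w)" by (simp add: nz algebra_simps)
  qed
  have "inner x (x - z) = inner (x - z) (x - z) + inner z (x - z)" by (simp add: inner_diff_left)
  also have "\<dots> = (norm (x - z))\<^sup>2" using orth[OF zM] by (simp add: power2_norm_eq_inner)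
  also have "\<dots> \<noteq> 0" using x zM by auto
  finally show ?thesis using orth that by blast
qed

section \<open>The space l2\<close>

lemma l2_eq_refl_iff: "l2_eq f f \<longleftrightarrow> sq_int f"
  by (auto simp: l2_eq_def)

lemma l2_cases:
  obtains f where "sq_int f" "X = abs_l2 f"
  using Quotient_abs_rep[OF Quotient_l2, of X] Quotient_rep_reflp[OF Quotient_l2, of X] that
  by (metis l2_eq_refl_iff)

lemma abs_l2_eq_iff:
  assumes "sq_int f" "sq_int g"
  shows "abs_l2 f = abs_l2 g \<longleftrightarrow> (AE x in lebesgue. f x = g x)"
  using Quotient_rel[OF Quotient_l2, of f g] assms by (auto simp: l2_eq_def)

lemma abs_l2_add: "sq_int f \<Longrightarrow> sq_int g \<Longrightarrow> abs_l2 f + abs_l2 g = abs_l2 (\<lambda>x. f x + g x)"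
  by (simp add: plus_l2.abs_eq l2_eq_refl_iff)

lemma abs_l2_scaleC: "sq_int f \<Longrightarrow> l2_scaleC c (abs_l2 f) = abs_l2 (\<lambda>x. c * f x)"
  by (simp add: l2_scaleC.abs_eq l2_eq_refl_iff)

lemma abs_l2_uminus: "sq_int f \<Longrightarrow> - abs_l2 f = abs_l2 (\<lambda>x. - f x)"
  by (simp add: uminus_l2.abs_eq l2_eq_refl_iff)

lemma sq_int_uminus: "sq_int f \<Longrightarrow> sq_int (\<lambda>x. - f x)"
  using sq_int_cmult[of f "-1"] by simp

lemma sq_int_diff: "sq_int f \<Longrightarrow> sq_int g \<Longrightarrow> sq_int (\<lambda>x. f x - g x)"
  using sq_int_add[OF _ sq_int_uminus, of f g] by simp

lemma abs_l2_diff: "sq_int f \<Longrightarrow> sq_int g \<Longrightarrow> abs_l2 f - abs_l2 g = abs_l2 (\<lambda>x. f x - g x)"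
  by (simp add: minus_l2_def abs_l2_uminus abs_l2_add sq_int_uminus)

lemma zero_l2_eq: "0 = abs_l2 (\<lambda>x. 0)"
  by (simp add: zero_l2.abs_eq)

lemma l2_inner_abs: "sq_int f \<Longrightarrow> sq_int g \<Longrightarrow> l2_inner (abs_l2 f) (abs_l2 g) = (\<integral>x. f x * cnj (g x) \<partial>lebesgue)"
  by (simp add: l2_inner.abs_eq l2_eq_refl_iff)

lemma norm_abs_l2: 
  assumes "sq_int f"
  shows "(norm (abs_l2 f))\<^sup>2 = (\<integral>x. (cmod (f x))\<^sup>2 \<partial>lebesgue)"
proof -
  have "(norm (abs_l2 f))\<^sup>2 = Re (\<integral>x. f x * cnj (f x) \<partial>lebesgue)"
    by (simp add: power2_norm_eq_inner inner_l2_def l2_inner_abs assms)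
  also have "\<dots> = (\<integral>x. (cmod (f x))\<^sup>2 \<partial>lebesgue)"
    unfolding complex_norm_square[symmetric] integral_complex_of_real by simp
  finally show ?thesis .
qed

lemma nn_integral_abs_l2:
  assumes "sq_int f"
  shows "(\<integral>\<^sup>+x. ennreal ((cmod (f x))\<^sup>2) \<partial>lebesgue) = ennreal ((norm (abs_l2 f))\<^sup>2)"
  unfolding norm_abs_l2[OF assms] using assms by (intro nn_integral_eq_integral) (auto simp: sq_int_def)

lemma l2_inner_add_left: "l2_inner (X + Y) Z = l2_inner X Z + l2_inner Y Z"
proof -
  obtain f g h where "sq_int f" "X = abs_l2 f" "sq_int g" "Y = abs_l2 g" "sq_int h" "Z = abs_l2 h"
    by (metis l2_cases)
  then show ?thesis by (simp add: abs_l2_add l2_inner_abs sq_int_add distrib_right sq_int_inner)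
qed

lemma l2_inner_scaleC_left: "l2_inner (l2_scaleC c X) Z = c * l2_inner X Z"
proof -
  obtain f h where "sq_int f" "X = abs_l2 f" "sq_int h" "Z = abs_l2 h"
    by (metis l2_cases)
  then show ?thesis by (simp add: abs_l2_scaleC l2_inner_abs sq_int_cmult mult.assoc sq_int_inner)
qed

lemma l2_inner_commute: "l2_inner X Y = cnj (l2_inner Y X)"
proof -
  obtain f h where fh: "sq_int f" "X = abs_l2 f" "sq_int h" "Y = abs_l2 h"
    by (metis l2_cases)
  have "(\<integral>x. cnj (h x * cnj (f x)) \<partial>lebesgue) = cnj (\<integral>x. h x * cnj (f x) \<partial>lebesgue)"
    by (simp only: Bochner_Integration.integral_cnj)
  then show ?thesis using fh by (simp add: l2_inner_abs mult.commute)
qed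

lemma l2_inner_add_right: "l2_inner Z (X + Y) = l2_inner Z X + l2_inner Z Y"
  by (metis l2_inner_add_left l2_inner_commute complex_cnj_add)

lemma l2_inner_scaleC_right: "l2_inner Z (l2_scaleC c X) = cnj c * l2_inner Z X"
  by (metis l2_inner_scaleC_left l2_inner_commute complex_cnj_mult)

lemma l2_inner_uminus_left: "l2_inner (- X) Z = - l2_inner X Z"
proof -
  have "l2_inner 0 Z = 0" using l2_inner_add_left[of 0 0 Z] by simp
  then have "l2_inner (- X) Z + l2_inner X Z = 0" using l2_inner_add_left[of "- X" X Z] by simp
  then show ?thesis by (simp add: eq_neg_iff_add_eq_0)
qed

lemma l2_inner_diff_left: "l2_inner (X - Y) Z = l2_inner X Z - l2_inner Y Z"
  using l2_inner_add_left[of X "- Y" Z] by (simp add: l2_inner_uminus_left)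

lemma l2_inner_diff_right: "l2_inner Z (X - Y) = l2_inner Z X - l2_inner Z Y"
  by (metis l2_inner_diff_left l2_inner_commute complex_cnj_diff)

lemma l2_inner_zero_left [simp]: "l2_inner 0 Z = 0"
  using l2_inner_diff_left[of 0 0 Z] by simp

lemma l2_inner_zero_right [simp]: "l2_inner Z 0 = 0"
  using l2_inner_diff_right[of Z 0 0] by simp

lemma l2_inner_self_eq_0: "l2_inner X X = 0 \<Longrightarrow> X = 0"
  by (metis inner_eq_zero_iff inner_l2_def zero_complex.sel(1))

text \<open>The complex inner product is expressed through the real one, so that its continuity follows from
  that of the real one and of multiplication by \<open>\<i>\<close>.\<close>

lemma l2_inner_conv_inner: "l2_inner X Y = Complex (inner X Y) (inner X (l2_scaleC \<i> Y))"
  by (rule complex_eqI) (simp_all add: inner_l2_def l2_inner_scaleC_right)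

lemma norm_l2_scaleC: "norm (l2_scaleC c X) = cmod c * norm X"
proof -
  have "(norm (l2_scaleC c X))\<^sup>2 = Re (c * cnj c * l2_inner X X)"
    by (simp only: power2_norm_eq_inner inner_l2_def l2_inner_scaleC_left l2_inner_scaleC_right mult.assoc mult.left_commute[of "cnj c" c])
  also have "c * cnj c = of_real ((cmod c)\<^sup>2)" by (rule complex_norm_square[symmetric])
  also have "Re (of_real ((cmod c)\<^sup>2) * l2_inner X X) = (cmod c * norm X)\<^sup>2"
    by (simp add: power_mult_distrib power2_norm_eq_inner inner_l2_def del: of_real_power)
  finally show ?thesis by (simp add: power2_eq_iff_nonneg)
qed

lemma scaleR_conv_l2_scaleC: "a *\<^sub>R X = l2_scaleC (of_real a) X"
  by (simp add: scaleR_l2_def)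

lemma l2_scaleC_add: "l2_scaleC c (X + Y) = l2_scaleC c X + l2_scaleC c Y"
  by transfer (auto simp: l2_eq_def distrib_left intro!: sq_int_add sq_int_cmult)

lemma l2_scaleC_assoc: "l2_scaleC a (l2_scaleC b X) = l2_scaleC (a * b) X"
  by transfer (auto simp: l2_eq_def mult.assoc intro!: sq_int_cmult)

lemma bounded_linear_l2_scaleC: "bounded_linear (l2_scaleC c)"
proof (rule bounded_linear_intro[where K = "cmod c"])
  show "l2_scaleC c (r *\<^sub>R X) = r *\<^sub>R l2_scaleC c X" for r X
    by (simp add: scaleR_conv_l2_scaleC l2_scaleC_assoc mult.commute)
qed (auto simp: l2_scaleC_add norm_l2_scaleC mult.commute)

lemma continuous_on_l2_inner [continuous_intros]:
  assumes "continuous_on S f" "continuous_on S g"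
  shows "continuous_on S (\<lambda>x. l2_inner (f x) (g x))"
  unfolding l2_inner_conv_inner Complex_eq
  by (intro continuous_intros assms bounded_linear.continuous_on[OF bounded_linear_l2_scaleC])

subsection \<open>Completeness\<close>

lemma fast_Cauchy_subsequence:
  fixes X :: "nat \<Rightarrow> 'a::metric_space" and e :: "nat \<Rightarrow> real"
  assumes X: "Cauchy X" and e: "\<And>n. e n > 0"
  obtains r where "strict_mono r" "\<And>n k. k \<ge> r n \<Longrightarrow> dist (X k) (X (r n)) < e n"
proof -
  have "\<exists>N. \<forall>i\<ge>N. \<forall>j\<ge>N. dist (X i) (X j) < e n" for n
    using X e[of n] by (auto simp: Cauchy_def)
  then obtain N where N: "\<And>n i j. i \<ge> N n \<Longrightarrow> j \<ge> N n \<Longrightarrow> dist (X i) (X j) < e n" by metis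
  define r where "r n = (\<Sum>i\<le>n. N i) + n" for n
  have "strict_mono r" by (rule strict_monoI_Suc) (simp add: r_def)
  moreover have "r n \<ge> N n" for n
    unfolding r_def using member_le_sum[of n "{..n}" N] by (simp add: trans_le_add1)
  then have "dist (X k) (X (r n)) < e n" if "k \<ge> r n" for n k
    using that by (meson N order.trans)
  ultimately show ?thesis by (rule that)
qed

text \<open>With the weights \<open>4\<^sup>n\<close> the integrals of the squared increments remain summable. Hence the weighted
  squares are bounded almost everywhere, and there the increments decay like \<open>2\<^sup>-\<^sup>n\<close>.\<close>

lemma AE_convergent_of_fast_Cauchy:
  fixes f :: "nat \<Rightarrow> real \<Rightarrow> complex"
  assumes f: "\<And>n. sq_int (f n)" and fast: "\<And>n. norm (abs_l2 (f (Suc n)) - abs_l2 (f n)) \<le> (1/4) ^ n"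
  shows "AE x in lebesgue. convergent (\<lambda>n. f n x)"
proof -
  have [measurable]: "f n \<in> borel_measurable lebesgue" for n using f by (simp add: sq_int_def)
  define D where "D n x = cmod (f (Suc n) x - f n x)" for n x
  have [measurable]: "D n \<in> borel_measurable lebesgue" for n unfolding D_def by measurable
  have D: "(\<integral>\<^sup>+x. ennreal (4 ^ n * (D n x)\<^sup>2) \<partial>lebesgue) \<le> ennreal ((1/4) ^ n)" for n
  proof -
    have "(\<integral>\<^sup>+x. ennreal (4 ^ n * (D n x)\<^sup>2) \<partial>lebesgue) = ennreal (4 ^ n) * (\<integral>\<^sup>+x. ennreal ((D n x)\<^sup>2) \<partial>lebesgue)"
      by (subst nn_integral_cmult[symmetric]) (auto simp: ennreal_mult)
    also have "(\<integral>\<^sup>+x. ennreal ((D n x)\<^sup>2) \<partial>lebesgue) = ennreal ((norm (abs_l2 (f (Suc n)) - abs_l2 (f n)))\<^sup>2)"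
      unfolding D_def abs_l2_diff[OF f f] by (rule nn_integral_abs_l2[OF sq_int_diff[OF f f]])
    also have "ennreal (4 ^ n) * \<dots> \<le> ennreal (4 ^ n) * ennreal (((1/4) ^ n)\<^sup>2)"
      using fast[of n] by (intro mult_left_mono ennreal_leI power_mono) auto
    also have "\<dots> = ennreal ((1/4) ^ n)"
      by (simp add: ennreal_mult[symmetric] power2_eq_square power_mult_distrib[symmetric])
    finally show ?thesis .
  qed
  have "(\<integral>\<^sup>+x. (\<Sum>n. ennreal (4 ^ n * (D n x)\<^sup>2)) \<partial>lebesgue) = (\<Sum>n. \<integral>\<^sup>+x. ennreal (4 ^ n * (D n x)\<^sup>2) \<partial>lebesgue)"
    by (rule nn_integral_suminf) measurable
  also have "\<dots> \<le> (\<Sum>n. ennreal ((1/4) ^ n))" by (intro suminf_le D) auto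
  also have "\<dots> < \<infinity>"
    by (subst suminf_ennreal2) (auto simp: summable_geometric)
  finally have "AE x in lebesgue. (\<Sum>n. ennreal (4 ^ n * (D n x)\<^sup>2)) \<noteq> \<infinity>"
    by (intro nn_integral_noteq_infinite) auto
  then show ?thesis
  proof eventually_elim
    case (elim x)
    define h where "h = (\<lambda>n. ennreal (4 ^ n * (D n x)\<^sup>2))"
    have "suminf h \<noteq> \<infinity>" using elim unfolding h_def .
    then obtain C where C: "C \<ge> 0" "suminf h = ennreal C"
      by (cases "suminf h" rule: ennreal_cases) auto
    have Dn: "D n x \<le> sqrt C * (1/2) ^ n" for n
    proof -
      have "sum h {n} \<le> suminf h" by (rule sum_le_suminf) auto
      then have "ennreal (4 ^ n * (D n x)\<^sup>2) \<le> ennreal C" using C(2) by (simp add: h_def)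
      then have "4 ^ n * (D n x)\<^sup>2 \<le> C" using C(1) by simp
      moreover have "((2::real) ^ n)\<^sup>2 = (2\<^sup>2) ^ n" by (simp only: power_mult[symmetric] mult.commute)
      ultimately have "(2 ^ n * D n x)\<^sup>2 \<le> C" by (simp add: power_mult_distrib)
      then have "2 ^ n * D n x \<le> sqrt C" by (rule real_le_rsqrt)
      then show ?thesis by (simp add: field_simps power_divide)
    qed
    have "summable (\<lambda>n. sqrt C * (1/2) ^ n)" by (intro summable_mult summable_geometric) simp
    then have "summable (\<lambda>n. f (Suc n) x - f n x)"
      by (rule summable_comparison_test'[where N = 0]) (use Dn in \<open>simp add: D_def\<close>)
    then have "convergent (\<lambda>n. \<Sum>i<n. f (Suc i) x - f i x)" by (simp add: summable_iff_convergent)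
    moreover have "(\<lambda>n. \<Sum>i<n. f (Suc i) x - f i x) = (\<lambda>n. f n x - f 0 x)"
      by (intro ext) (rule sum_lessThan_telescope)
    ultimately have "convergent (\<lambda>n. f n x - f 0 x)" by simp
    then show ?case by (simp add: convergent_diff_const_right_iff)
  qed
qed

text \<open>The Riesz-Fischer theorem: a fast Cauchy subsequence converges almost everywhere, and Fatou's
  lemma turns the pointwise limit into a limit in the norm.\<close>

instance l2 :: complete_space
proof
  fix X :: "nat \<Rightarrow> l2" assume X: "Cauchy X"
  obtain r where r: "strict_mono r" "\<And>n k. k \<ge> r n \<Longrightarrow> dist (X k) (X (r n)) < (1/4) ^ n"
    using fast_Cauchy_subsequence[OF X, of "\<lambda>n. (1/4) ^ n"] by auto
  have "\<forall>n. \<exists>f. sq_int f \<and> X (r n) = abs_l2 f" by (metis l2_cases)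
  then obtain f where f: "\<And>n. sq_int (f n)" "\<And>n. X (r n) = abs_l2 (f n)" by metis
  have [measurable]: "f n \<in> borel_measurable lebesgue" for n using f by (simp add: sq_int_def)
  have mono: "r n \<le> r k" if "n \<le> k" for n k using r(1) that by (simp add: strict_mono_less_eq)
  have close: "norm (abs_l2 (f k) - abs_l2 (f n)) \<le> (1/4) ^ n" if "n \<le> k" for n k
    using r(2)[OF mono[OF that]] f(2) by (simp add: dist_norm less_imp_le)
  have conv: "AE x in lebesgue. convergent (\<lambda>n. f n x)"
    using AE_convergent_of_fast_Cauchy[OF f(1)] close by simp
  define g where "g x = lim (\<lambda>n. f n x)" for x
  have [measurable]: "g \<in> borel_measurable lebesgue"
    unfolding g_def by (rule borel_measurable_lim_metric) measurable
  have fatou: "(\<integral>\<^sup>+x. ennreal ((cmod (g x - f n x))\<^sup>2) \<partial>lebesgue) \<le> ennreal (((1/4) ^ n)\<^sup>2)" for n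
  proof -
    have "AE x in lebesgue. ennreal ((cmod (g x - f n x))\<^sup>2) = liminf (\<lambda>k. ennreal ((cmod (f k x - f n x))\<^sup>2))"
      using conv
    proof eventually_elim
      case (elim x)
      then have "(\<lambda>k. f k x) \<longlonglongrightarrow> g x" by (simp add: g_def convergent_LIMSEQ_iff)
      then have "(\<lambda>k. ennreal ((cmod (f k x - f n x))\<^sup>2)) \<longlonglongrightarrow> ennreal ((cmod (g x - f n x))\<^sup>2)"
        by (intro tendsto_intros)
      then show ?case by (rule lim_imp_Liminf[OF trivial_limit_sequentially, symmetric])
    qed
    then have "(\<integral>\<^sup>+x. ennreal ((cmod (g x - f n x))\<^sup>2) \<partial>lebesgue) = (\<integral>\<^sup>+x. liminf (\<lambda>k. ennreal ((cmod (f k x - f n x))\<^sup>2)) \<partial>lebesgue)"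
      by (rule nn_integral_cong_AE)
    also have "\<dots> \<le> liminf (\<lambda>k. \<integral>\<^sup>+x. ennreal ((cmod (f k x - f n x))\<^sup>2) \<partial>lebesgue)"
      by (rule nn_integral_liminf) measurable
    also have "\<dots> \<le> ennreal (((1/4) ^ n)\<^sup>2)"
    proof (rule Liminf_le)
      show "\<forall>\<^sub>F k in sequentially. (\<integral>\<^sup>+x. ennreal ((cmod (f k x - f n x))\<^sup>2) \<partial>lebesgue) \<le> ennreal (((1/4) ^ n)\<^sup>2)"
      proof (rule eventually_sequentiallyI[of n])
        fix k assume "n \<le> k"
        then show "(\<integral>\<^sup>+x. ennreal ((cmod (f k x - f n x))\<^sup>2) \<partial>lebesgue) \<le> ennreal (((1/4) ^ n)\<^sup>2)"
          unfolding nn_integral_abs_l2[OF sq_int_diff[OF f(1) f(1)]] abs_l2_diff[OF f(1) f(1), symmetric]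
          using close by (intro ennreal_leI power_mono) auto
      qed
    qed simp
    finally show ?thesis .
  qed
  have diff: "sq_int (\<lambda>x. g x - f n x)" for n
    unfolding sq_int_def
  proof
    show "integrable lebesgue (\<lambda>x. (cmod (g x - f n x))\<^sup>2)"
      using fatou[of n] by (intro integrableI_bounded) (auto simp: le_less_trans)
  qed measurable
  have g: "sq_int g" using sq_int_add[OF diff[of 0] f(1)[of 0]] by simp
  have bnd: "norm (abs_l2 (f n) - abs_l2 g) \<le> (1/4) ^ n" for n
  proof -
    have "ennreal ((norm (abs_l2 g - abs_l2 (f n)))\<^sup>2) \<le> ennreal (((1/4) ^ n)\<^sup>2)"
      using fatou[of n] unfolding nn_integral_abs_l2[OF diff] abs_l2_diff[OF g f(1)] .
    then have "(norm (abs_l2 g - abs_l2 (f n)))\<^sup>2 \<le> ((1/4) ^ n)\<^sup>2" by simp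
    then have "norm (abs_l2 g - abs_l2 (f n)) \<le> (1/4) ^ n" by (rule power2_le_imp_le) simp
    then show ?thesis by (simp add: norm_minus_commute)
  qed
  have "(\<lambda>n. abs_l2 (f n)) \<longlonglongrightarrow> abs_l2 g"
    by (rule iffD2[OF tendsto_dist_iff], rule Lim_null_comparison[of _ "\<lambda>n. (1/4::real) ^ n"])
      (use bnd in \<open>auto simp: dist_norm LIMSEQ_power_zero\<close>)
  then have "(X \<circ> r) \<longlonglongrightarrow> abs_l2 g" by (simp add: o_def f(2))
  then have "X \<longlonglongrightarrow> abs_l2 g" using Cauchy_converges_subseq[OF X r(1)] by blast
  then show "convergent X" by (auto simp: convergent_def)
qed


section \<open>Locally integrable functions\<close>

lemma L1_locD: "L1_loc f \<Longrightarrow> f absolutely_integrable_on {a..b}"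
  by (simp add: L1_loc_def)

lemma L1_loc_bounded_by:
  fixes f :: "real \<Rightarrow> complex" and g :: "real \<Rightarrow> real"
  assumes f: "f \<in> borel_measurable lebesgue" and g: "\<And>a b. g absolutely_integrable_on {a..b}"
    and le: "\<And>x. cmod (f x) \<le> g x"
  shows "L1_loc f"
  unfolding L1_loc_def
proof (intro allI)
  fix a b :: real
  show "f absolutely_integrable_on {a..b}"
    using f g le
    by (intro measurable_bounded_by_integrable_imp_absolutely_integrable[where g = g])
      (auto intro: measurable_restrict_space1 simp: absolutely_integrable_on_def)
qed

lemma mult_le_sum_squares: "(a::real) * b \<le> a\<^sup>2 + b\<^sup>2"
proof -
  have "2 * (a * b) \<le> a\<^sup>2 + b\<^sup>2" using sum_squares_bound[of a b] by simp
  moreover have "0 \<le> a\<^sup>2 + b\<^sup>2" by simp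
  ultimately show ?thesis by linarith
qed

lemma L2_locD:
  assumes "L2_loc f"
  shows "f \<in> borel_measurable lebesgue" "(\<lambda>x. (cmod (f x))\<^sup>2) absolutely_integrable_on {a..b}"
  using assms by (auto simp: L2_loc_def)

lemma L1_loc_mult_L2_loc:
  assumes f: "L2_loc f" and g: "L2_loc g"
  shows "L1_loc (\<lambda>x. f x * g x)"
proof (rule L1_loc_bounded_by)
  note [measurable] = L2_locD(1)[OF f] L2_locD(1)[OF g]
  show "(\<lambda>x. f x * g x) \<in> borel_measurable lebesgue" by measurable
  show "(\<lambda>x. (cmod (f x))\<^sup>2 + (cmod (g x))\<^sup>2) absolutely_integrable_on {a..b}" for a b
    by (intro set_integral_add L2_locD f g)
  show "cmod (f x * g x) \<le> (cmod (f x))\<^sup>2 + (cmod (g x))\<^sup>2" for x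
    using mult_le_sum_squares[of "cmod (f x)" "cmod (g x)"] by (simp add: norm_mult)
qed

lemma L2_loc_continuous:
  fixes f :: "real \<Rightarrow> complex"
  assumes "continuous_on UNIV f"
  shows "L2_loc f"
  unfolding L2_loc_def
proof (intro conjI allI)
  show "f \<in> borel_measurable lebesgue"
    using borel_measurable_continuous_onI[OF assms] by (intro measurable_completion) simp
  fix a b :: real
  show "(\<lambda>x. (cmod (f x))\<^sup>2) absolutely_integrable_on {a..b}"
    by (intro absolutely_integrable_continuous_real continuous_intros continuous_on_subset[OF assms]) auto
qed

lemma L2_loc_imp_L1_loc: "L2_loc f \<Longrightarrow> L1_loc f"
  using L1_loc_mult_L2_loc[of f "\<lambda>x. 1"] L2_loc_continuous[of "\<lambda>x. 1"] by simp

lemma L1_loc_add: "L1_loc f \<Longrightarrow> L1_loc g \<Longrightarrow> L1_loc (\<lambda>x. f x + g x)"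
  by (simp add: L1_loc_def)

lemma L1_loc_diff: "L1_loc f \<Longrightarrow> L1_loc g \<Longrightarrow> L1_loc (\<lambda>x. f x - g x)"
  by (simp add: L1_loc_def)

lemma L1_loc_uminus: "L1_loc f \<Longrightarrow> L1_loc (\<lambda>x. - f x)"
  using L1_loc_diff[of "\<lambda>x. 0" f] by (simp add: L1_loc_def)

lemma L1_loc_mult_continuous:
  assumes f: "L1_loc f" and g: "continuous_on UNIV g"
  shows "L1_loc (\<lambda>x. f x * g x)"
  unfolding L1_loc_def
proof (intro allI)
  fix a b :: real
  have ga: "continuous_on {a..b} g" using g by (rule continuous_on_subset) auto
  then have "(\<lambda>x. g x * f x) absolutely_integrable_on {a..b}"
    by (intro absolutely_integrable_bounded_measurable_product[where h = "(*)"])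
      (auto intro!: bilinear_times continuous_imp_measurable_on_sets_lebesgue compact_imp_bounded compact_continuous_image L1_locD[OF f])
  then show "(\<lambda>x. f x * g x) absolutely_integrable_on {a..b}" by (simp add: mult.commute)
qed

lemma L2_loc_mult_continuous:
  assumes f: "L2_loc f" and g: "continuous_on UNIV g"
  shows "L2_loc (\<lambda>x. f x * g x)"
  unfolding L2_loc_def
proof (intro conjI allI)
  note [measurable] = L2_locD(1)[OF f] L2_locD(1)[OF L2_loc_continuous[OF g]]
  show "(\<lambda>x. f x * g x) \<in> borel_measurable lebesgue" by measurable
  fix a b :: real
  have ga: "continuous_on {a..b} (\<lambda>x. (cmod (g x))\<^sup>2)" by (intro continuous_intros continuous_on_subset[OF g]) auto
  then have "(\<lambda>x. (cmod (g x))\<^sup>2 * (cmod (f x))\<^sup>2) absolutely_integrable_on {a..b}"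
    by (intro absolutely_integrable_bounded_measurable_product_real)
      (auto intro!: continuous_imp_measurable_on_sets_lebesgue compact_imp_bounded compact_continuous_image L2_locD[OF f])
  then show "(\<lambda>x. (cmod (f x * g x))\<^sup>2) absolutely_integrable_on {a..b}"
    by (simp add: norm_mult power_mult_distrib mult.commute)
qed

lemma L2_loc_add:
  assumes f: "L2_loc f" and g: "L2_loc g"
  shows "L2_loc (\<lambda>x. f x + g x)"
  unfolding L2_loc_def
proof (intro conjI allI)
  note [measurable] = L2_locD(1)[OF f] L2_locD(1)[OF g]
  show "(\<lambda>x. f x + g x) \<in> borel_measurable lebesgue" by measurable
  fix a b :: real
  show "(\<lambda>x. (cmod (f x + g x))\<^sup>2) absolutely_integrable_on {a..b}"
  proof (rule measurable_bounded_by_integrable_imp_absolutely_integrable)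
    show "(\<lambda>x. (cmod (f x + g x))\<^sup>2) \<in> borel_measurable (lebesgue_on {a..b})"
      by (rule measurable_restrict_space1) measurable
    have "(\<lambda>x. 2 * (cmod (f x))\<^sup>2 + 2 * (cmod (g x))\<^sup>2) absolutely_integrable_on {a..b}"
      by (intro set_integral_add set_integrable_mult_right impI L2_locD f g)
    then show "(\<lambda>x. 2 * (cmod (f x))\<^sup>2 + 2 * (cmod (g x))\<^sup>2) integrable_on {a..b}"
      by (simp add: absolutely_integrable_on_def)
    fix x
    have "(cmod (f x + g x))\<^sup>2 \<le> (cmod (f x) + cmod (g x))\<^sup>2"
      by (intro power_mono norm_triangle_ineq) auto
    also have "\<dots> \<le> 2 * (cmod (f x))\<^sup>2 + 2 * (cmod (g x))\<^sup>2"
      using sum_squares_bound[of "cmod (f x)" "cmod (g x)"] by (simp add: power2_sum)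
    finally show "norm ((cmod (f x + g x))\<^sup>2) \<le> 2 * (cmod (f x))\<^sup>2 + 2 * (cmod (g x))\<^sup>2" by simp
  qed auto
qed

lemma sq_int_imp_L2_loc: "sq_int f \<Longrightarrow> L2_loc f"
  unfolding L2_loc_def sq_int_def set_integrable_def
  by (elim conjE, intro conjI allI integrable_mult_indicator) auto

lemma L2_loc_cnj: "L2_loc f \<Longrightarrow> L2_loc (cnj \<circ> f)"
  unfolding L2_loc_def o_def by (auto intro: cnj_measurable)

lemma L1_loc_cnj: "L1_loc f \<Longrightarrow> L1_loc (cnj \<circ> f)"
  unfolding L1_loc_def using absolutely_integrable_linear[OF _ bounded_linear_cnj] by blast

lemma L2_loc_cong_AE:
  assumes f: "L2_loc f" and ae: "AE x in lebesgue. f x = g x"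
  shows "L2_loc g"
  unfolding L2_loc_def
proof (intro conjI allI)
  show "g \<in> borel_measurable lebesgue" by (rule borel_measurable_AE[OF L2_locD(1)[OF f] ae])
  fix a b :: real
  obtain N where N: "negligible N" "{x. f x \<noteq> g x} \<subseteq> N"
    using ae unfolding eventually_ae_filter_negligible by auto
  show "(\<lambda>x. (cmod (g x))\<^sup>2) absolutely_integrable_on {a..b}"
  proof (rule absolutely_integrable_spike[OF L2_locD(2)[OF f] N(1)])
    fix x assume "x \<in> {a..b} - N"
    then have "f x = g x" using N(2) by (metis (mono_tags, lifting) DiffE mem_Collect_eq subsetD)
    then show "(cmod (g x))\<^sup>2 = (cmod (f x))\<^sup>2" by simp
  qed
qed

lemma sq_int_cong_AE:
  assumes f: "sq_int f" and ae: "AE x in lebesgue. f x = g x"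
  shows "sq_int g"
proof -
  have g: "g \<in> borel_measurable lebesgue"
    using f ae by (auto simp: sq_int_def intro: borel_measurable_AE)
  have "integrable lebesgue (\<lambda>x. (cmod (g x))\<^sup>2)"
  proof (rule integrable_cong_AE_imp)
    show "integrable lebesgue (\<lambda>x. (cmod (f x))\<^sup>2)" using f by (simp add: sq_int_def)
    show "AE x in lebesgue. (cmod (f x))\<^sup>2 = (cmod (g x))\<^sup>2" using ae by eventually_elim simp
    show "(\<lambda>x. (cmod (g x))\<^sup>2) \<in> borel_measurable lebesgue" using g by measurable
  qed
  then show ?thesis using g by (simp add: sq_int_def)
qed

lemma set_integrable_imp_integrable_lebesgue:
  fixes f :: "real \<Rightarrow> 'a::{banach, second_countable_topology}"
  assumes "set_integrable lebesgue {a..b} f" "\<And>x. x \<notin> {a..b} \<Longrightarrow> f x = 0"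
  shows "integrable lebesgue f"
proof -
  have "(\<lambda>x. indicator {a..b} x *\<^sub>R f x) = f" using assms(2) by (auto simp: indicator_def)
  then show ?thesis using assms(1) by (simp add: set_integrable_def)
qed

lemma lebesgue_integral_eq_integral_interval:
  fixes f :: "real \<Rightarrow> complex"
  assumes "set_integrable lebesgue {a..b} f" "\<And>x. x \<notin> {a..b} \<Longrightarrow> f x = 0"
  shows "(\<integral>x. f x \<partial>lebesgue) = integral {a..b} f"
proof -
  have "(\<lambda>x. indicator {a..b} x *\<^sub>R f x) = f" using assms(2) by (auto simp: indicator_def)
  then have "(\<integral>x. f x \<partial>lebesgue) = (LINT x:{a..b}|lebesgue. f x)" by (simp add: set_lebesgue_integral_def)
  then show ?thesis using set_lebesgue_integral_eq_integral(2)[OF assms(1)] by simp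
qed

lemma sq_int_of_L2_loc:
  assumes f: "L2_loc f" and "\<And>x. x \<notin> {a..b} \<Longrightarrow> f x = 0"
  shows "sq_int f"
  using L2_locD(1)[OF f] set_integrable_imp_integrable_lebesgue[OF L2_locD(2)[OF f], of a b] assms(2)
  by (simp add: sq_int_def)

lemma L2_loc_restrict:
  assumes f: "L2_loc f"
  shows "sq_int (\<lambda>x. if x \<in> {a..b} then f x else 0)"
proof -
  note [measurable] = L2_locD(1)[OF f]
  have "integrable lebesgue (\<lambda>x. (cmod (if x \<in> {a..b} then f x else 0))\<^sup>2)"
  proof (rule set_integrable_imp_integrable_lebesgue)
    show "set_integrable lebesgue {a..b} (\<lambda>x. (cmod (if x \<in> {a..b} then f x else 0))\<^sup>2)"
      using L2_locD(2)[OF f, of a b] by (rule set_integrable_cong[THEN iffD1, rotated -1]) auto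
  qed auto
  then show ?thesis unfolding sq_int_def by (auto intro!: measurable_If)
qed

section \<open>Primitives: limits at infinity and cut-off\<close>

text \<open>Up to a constant, \<open>P\<close> is the integral of \<open>h\<close> over the half-line up to the argument, to which
  dominated convergence applies at both ends.\<close>

lemma primitive_of_limits:
  fixes P :: "real \<Rightarrow> complex"
  assumes P: "primitive_of P h" and h: "integrable lebesgue h"
  shows "\<exists>l1 l2. (P \<longlongrightarrow> l1) at_top \<and> (P \<longlongrightarrow> l2) at_bot \<and> l1 - l2 = (\<integral>x. h x \<partial>lebesgue)"
proof -
  have [measurable]: "h \<in> borel_measurable lebesgue" using h by simp
  define G where "G y = (\<integral>x. indicator {..y} x *\<^sub>R h x \<partial>lebesgue)" for y
  have ind: "integrable lebesgue (\<lambda>x. indicator {..y} x *\<^sub>R h x)" for y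
    by (intro integrable_mult_indicator h) auto
  note meas = borel_measurable_integrable[OF ind]
  have GP: "G y - G x = P y - P x" if "x \<le> y" for x y
  proof -
    have "G y - G x = (\<integral>t. indicator {x<..y} t *\<^sub>R h t \<partial>lebesgue)"
      unfolding G_def using that
      by (subst Bochner_Integration.integral_diff[symmetric, OF ind ind]) (auto intro!: Bochner_Integration.integral_cong simp: indicator_def)
    also have "\<dots> = (LINT t:{x..y}|lebesgue. h t)"
      unfolding set_lebesgue_integral_def
    proof (rule integral_cong_AE)
      have "AE t in lebesgue. t \<noteq> x" by (intro AE_completion AE_lborel_singleton)
      then show "AE t in lebesgue. indicator {x<..y} t *\<^sub>R h t = indicator {x..y} t *\<^sub>R h t"
        by eventually_elim (auto simp: indicator_def)
    qed (auto intro!: borel_measurable_integrable integrable_mult_indicator h)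
    also have "\<dots> = integral {x..y} h"
      by (rule set_lebesgue_integral_eq_integral(2)[OF primitive_ofD(1)[OF P]])
    also have "\<dots> = P y - P x" using primitive_ofD(3)[OF P that] by simp
    finally show ?thesis .
  qed
  have top: "(G \<longlongrightarrow> (\<integral>x. h x \<partial>lebesgue)) at_top"
    unfolding G_def
  proof (rule integral_dominated_convergence_at_top[where w = "\<lambda>x. norm (h x)"])
    show "AE x in lebesgue. ((\<lambda>y. indicator {..y} x *\<^sub>R h x) \<longlongrightarrow> h x) at_top"
    proof (rule AE_I2)
      fix x
      have "\<forall>\<^sub>F y in at_top. indicator {..y} x *\<^sub>R h x = h x"
        using eventually_ge_at_top[of x] by eventually_elim simp
      then show "((\<lambda>y. indicator {..y} x *\<^sub>R h x) \<longlongrightarrow> h x) at_top" by (rule tendsto_eventually)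
    qed
  qed (use h meas in \<open>auto intro!: AE_I2 simp: abs_mult indicator_le_1 mult_left_le_one_le\<close>)
  have "((\<lambda>y. G (- y)) \<longlongrightarrow> (\<integral>x. (0::complex) \<partial>(lebesgue :: real measure))) at_top"
    unfolding G_def
  proof (rule integral_dominated_convergence_at_top[where w = "\<lambda>x. norm (h x)"])
    show "AE x in lebesgue. ((\<lambda>y. indicator {..- y} x *\<^sub>R h x) \<longlongrightarrow> 0) at_top"
    proof (rule AE_I2)
      fix x
      have "\<forall>\<^sub>F y in at_top. indicator {..- y} x *\<^sub>R h x = 0"
        using eventually_gt_at_top[of "- x"] by eventually_elim (auto simp: indicator_def)
      then show "((\<lambda>y. indicator {..- y} x *\<^sub>R h x) \<longlongrightarrow> 0) at_top" by (rule tendsto_eventually)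
    qed
  qed (use h meas in \<open>auto intro!: AE_I2 simp: abs_mult indicator_le_1 mult_left_le_one_le\<close>)
  then have bot: "(G \<longlongrightarrow> 0) at_bot" by (simp add: filterlim_at_bot_mirror)
  have eq: "P = (\<lambda>y. G y + (P 0 - G 0))"
  proof
    fix y show "P y = G y + (P 0 - G 0)" using GP[of 0 y] GP[of y 0] by (cases "0 \<le> y") (auto simp: algebra_simps)
  qed
  have "(P \<longlongrightarrow> (\<integral>x. h x \<partial>lebesgue) + (P 0 - G 0)) at_top" by (subst eq) (intro tendsto_intros top)
  moreover have "(P \<longlongrightarrow> 0 + (P 0 - G 0)) at_bot" by (subst eq) (intro tendsto_intros bot)
  ultimately show ?thesis by (intro exI conjI) auto
qed

lemma integral_eq_0_of_compactly_supported_primitive: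
  fixes P :: "real \<Rightarrow> complex"
  assumes P: "primitive_of P h" and h: "integrable lebesgue h" and supp: "\<And>x. R \<le> \<bar>x\<bar> \<Longrightarrow> P x = 0"
  shows "(\<integral>x. h x \<partial>lebesgue) = 0"
proof -
  obtain l1 l2 where l: "(P \<longlongrightarrow> l1) at_top" "(P \<longlongrightarrow> l2) at_bot" "l1 - l2 = (\<integral>x. h x \<partial>lebesgue)"
    using primitive_of_limits[OF P h] by blast
  have "\<forall>\<^sub>F x in at_top. P x = 0"
    using eventually_ge_at_top[of "\<bar>R\<bar>"] by eventually_elim (rule supp, simp)
  moreover have "\<forall>\<^sub>F x in at_bot. P x = 0"
    using eventually_le_at_bot[of "-\<bar>R\<bar>"] by eventually_elim (rule supp, simp)
  ultimately have "(P \<longlongrightarrow> 0) at_top" "(P \<longlongrightarrow> 0) at_bot" by (auto intro: tendsto_eventually)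
  then have "l1 = 0" "l2 = 0"
    using l(1,2) tendsto_unique[OF trivial_limit_at_top_linorder] tendsto_unique[OF trivial_limit_at_bot_linorder] by blast+
  then show ?thesis using l(3) by simp
qed

text \<open>Zeros at the end points allow the extension by zero without a jump.\<close>

lemma primitive_of_cutoff:
  fixes u :: "real \<Rightarrow> complex"
  assumes u: "primitive_of u g" and ab: "a \<le> b" and 0: "u a = 0" "u b = 0"
  shows "primitive_of (\<lambda>x. if x \<in> {a..b} then u x else 0) (\<lambda>x. if x \<in> {a..b} then g x else 0)"
  unfolding primitive_of_def
proof (intro conjI allI impI)
  fix x y :: real
  have "set_integrable lebesgue ({a..b} \<inter> {x..y}) g"
    using primitive_ofD(1)[OF u, of "max a x" "min b y"] by simp
  then show "(\<lambda>x. if x \<in> {a..b} then g x else 0) absolutely_integrable_on {x..y}"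
    unfolding set_integrable_def
    by (rule Bochner_Integration.integrable_cong[THEN iffD1, rotated -1]) (auto simp: indicator_def)
  assume xy: "x \<le> y"
  have "integral {x..y} (\<lambda>x. if x \<in> {a..b} then g x else 0) = integral ({a..b} \<inter> {x..y}) g"
    by (rule integral_restrict_Int)
  also have "{a..b} \<inter> {x..y} = {max a x..min b y}" by auto
  also have "integral {max a x..min b y} g = (if y \<in> {a..b} then u y else 0) - (if x \<in> {a..b} then u x else 0)"
  proof (cases "max a x \<le> min b y")
    case True
    then have "integral {max a x..min b y} g = u (min b y) - u (max a x)" using primitive_ofD(3)[OF u] by metis
    then show ?thesis using True 0 by (auto simp: min_def max_def split: if_splits)
  next
    case False
    then have "y \<notin> {a..b}" "x \<notin> {a..b}" using xy ab by auto
    moreover have "{max a x..min b y} = {}" using False by simp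
    ultimately show ?thesis by (auto simp del: atLeastAtMost_iff)
  qed
  finally show "(if y \<in> {a..b} then u y else 0) - (if x \<in> {a..b} then u x else 0) =
      integral {x..y} (\<lambda>x. if x \<in> {a..b} then g x else 0)" by simp
qed

text \<open>A nonempty open set is not a null set.\<close>

lemma continuous_AE_eq_imp_eq:
  fixes f g :: "real \<Rightarrow> 'a::real_normed_vector"
  assumes "continuous_on S f" "continuous_on S g" "open S" and ae: "AE x in lebesgue. x \<in> S \<longrightarrow> f x = g x" and x: "x \<in> S"
  shows "f x = g x"
proof (rule ccontr)
  assume "f x \<noteq> g x"
  have "open {x \<in> S. f x \<noteq> g x}"
  proof -
    have "open (S \<inter> (\<lambda>x. f x - g x) -` (- {0}))"
      using assms(1-3) by (intro continuous_open_preimage continuous_on_diff) auto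
    also have "S \<inter> (\<lambda>x. f x - g x) -` (- {0}) = {x \<in> S. f x \<noteq> g x}" by auto
    finally show ?thesis .
  qed
  moreover have "{x \<in> S. f x \<noteq> g x} \<noteq> {}" using \<open>f x \<noteq> g x\<close> x by auto
  moreover obtain N where "negligible N" "{x. \<not> (x \<in> S \<longrightarrow> f x = g x)} \<subseteq> N"
    using ae unfolding eventually_ae_filter_negligible by auto
  then have "negligible {x \<in> S. f x \<noteq> g x}" by (elim negligible_subset) auto
  ultimately show False using open_not_negligible by blast
qed


section \<open>The quasi-differential equation as a first-order system\<close>

text \<open>\<open>u\<close> satisfies \<open>l[u] = f\<close> with first quasi-derivative \<open>w\<close>. The equation \<open>w = u' - A u\<close> is read as an
  equation for \<open>u'\<close>, so that both conditions ask for primitives and only ordinary derivatives occur.\<close>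

definition quasi_solution ::
    "(real \<Rightarrow> complex) \<Rightarrow> (real \<Rightarrow> complex) \<Rightarrow> (real \<Rightarrow> complex) \<Rightarrow> (real \<Rightarrow> complex) \<Rightarrow>
     (real \<Rightarrow> complex) \<Rightarrow> (real \<Rightarrow> complex) \<Rightarrow> bool" where
  "quasi_solution A B c f u w \<longleftrightarrow>
     primitive_of u (\<lambda>x. A x * u x + w x) \<and>
     primitive_of w (\<lambda>x. - B x * w x - (A x * B x - c x) * u x - f x)"

lemma quasi_solution_continuous:
  assumes "quasi_solution A B c f u w"
  shows "continuous_on UNIV u" "continuous_on UNIV w"
  using assms by (auto simp: quasi_solution_def intro: primitive_of_continuous)

lemma quasi_solution_add:
  assumes "quasi_solution A B c f u w" "quasi_solution A B c f' u' w'"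
  shows "quasi_solution A B c (\<lambda>x. f x + f' x) (\<lambda>x. u x + u' x) (\<lambda>x. w x + w' x)"
  unfolding quasi_solution_def
proof
  show "primitive_of (\<lambda>x. u x + u' x) (\<lambda>x. A x * (u x + u' x) + (w x + w' x))"
    by (rule primitive_of_cong[OF primitive_of_add[OF assms[unfolded quasi_solution_def, THEN conjunct1]]])
      (simp add: algebra_simps)
  show "primitive_of (\<lambda>x. w x + w' x) (\<lambda>x. - B x * (w x + w' x) - (A x * B x - c x) * (u x + u' x) - (f x + f' x))"
    by (rule primitive_of_cong[OF primitive_of_add[OF assms[unfolded quasi_solution_def, THEN conjunct2]]])
      (simp add: algebra_simps)
qed

lemma quasi_solution_scale:
  assumes "quasi_solution A B c f u w"
  shows "quasi_solution A B c (\<lambda>x. k * f x) (\<lambda>x. k * u x) (\<lambda>x. k * w x)"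
  unfolding quasi_solution_def
proof
  note lin = primitive_of_linear[OF _ bounded_linear_mult_right[of k]]
  show "primitive_of (\<lambda>x. k * u x) (\<lambda>x. A x * (k * u x) + k * w x)"
    by (rule primitive_of_cong[OF lin[OF assms[unfolded quasi_solution_def, THEN conjunct1]]])
      (simp add: algebra_simps)
  show "primitive_of (\<lambda>x. k * w x) (\<lambda>x. - B x * (k * w x) - (A x * B x - c x) * (k * u x) - k * f x)"
    by (rule primitive_of_cong[OF lin[OF assms[unfolded quasi_solution_def, THEN conjunct2]]])
      (simp add: algebra_simps)
qed

lemma quasi_solution_diff:
  assumes "quasi_solution A B c f u w" "quasi_solution A B c f' u' w'"
  shows "quasi_solution A B c (\<lambda>x. f x - f' x) (\<lambda>x. u x - u' x) (\<lambda>x. w x - w' x)"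
  using quasi_solution_add[OF assms(1) quasi_solution_scale[OF assms(2), of "-1"]] by simp

lemma is_qderiv1_unique:
  assumes "is_qderiv1 A u w" "is_qderiv1 A u w'"
  shows "w = w'"
proof
  fix x
  have "continuous_on UNIV w" "continuous_on UNIV w'"
    using assms by (auto simp: is_qderiv1_def intro: primitive_of_continuous AC_loc_primitive_of)
  moreover have "AE x in lebesgue. w x = vderiv u x - A x * u x" "AE x in lebesgue. w' x = vderiv u x - A x * u x"
    using assms by (auto simp: is_qderiv1_def)
  then have "AE x in lebesgue. x \<in> UNIV \<longrightarrow> w x = w' x" by eventually_elim simp
  ultimately show "w x = w' x" by (rule continuous_AE_eq_imp_eq[OF _ _ open_UNIV]) auto
qed

lemma qderiv1_eqI: "is_qderiv1 A u w \<Longrightarrow> qderiv1 A u = w"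
  unfolding qderiv1_def by (rule the_equality) (auto intro: is_qderiv1_unique)

lemma quasi_solution_vderiv:
  assumes "quasi_solution A B c f u w"
  shows "AE x in lebesgue. vderiv u x = A x * u x + w x"
  using primitive_of_derivative_AE[OF assms[unfolded quasi_solution_def, THEN conjunct1]]
  by eventually_elim (rule vector_derivative_at)

lemma quasi_solution_qderiv1:
  assumes "quasi_solution A B c f u w"
  shows "is_qderiv1 A u w" "AC_loc u" "qderiv1 A u = w" "AE x in lebesgue. qexpr A B c u x = f x"
proof -
  show "AC_loc u" using assms by (auto simp: quasi_solution_def intro: primitive_of_imp_AC_loc)
  have "AC_loc w" using assms by (auto simp: quasi_solution_def intro: primitive_of_imp_AC_loc)
  then show qd: "is_qderiv1 A u w"
    unfolding is_qderiv1_def using quasi_solution_vderiv[OF assms] by (auto elim!: eventually_mono)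
  then show eq: "qderiv1 A u = w" by (rule qderiv1_eqI)
  have "AE x in lebesgue. (w has_vector_derivative - B x * w x - (A x * B x - c x) * u x - f x) (at x)"
    using assms by (auto simp: quasi_solution_def intro: primitive_of_derivative_AE)
  then show "AE x in lebesgue. qexpr A B c u x = f x"
  proof eventually_elim
    case (elim x)
    then show ?case by (simp add: qexpr_def qderiv2_def eq vector_derivative_at algebra_simps)
  qed
qed

lemma quasi_solution_of_AC:
  assumes u: "AC_loc u" and w: "\<exists>w. is_qderiv1 A u w"
  shows "quasi_solution A B c (qexpr A B c u) u (qderiv1 A u)"
proof -
  have w: "is_qderiv1 A u (qderiv1 A u)" using w qderiv1_eqI by metis
  then have ac: "AC_loc (qderiv1 A u)" and ae: "AE x in lebesgue. qderiv1 A u x = vderiv u x - A x * u x"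
    by (auto simp: is_qderiv1_def)
  have "primitive_of u (\<lambda>x. A x * u x + qderiv1 A u x)"
    by (rule primitive_of_cong_AE[OF AC_loc_primitive_of[OF u]]) (use ae in eventually_elim, simp)
  moreover have "primitive_of (qderiv1 A u) (\<lambda>x. vderiv (qderiv1 A u) x)" using ac by (rule AC_loc_primitive_of)
  ultimately show ?thesis unfolding quasi_solution_def by (simp add: qexpr_def qderiv2_def algebra_simps)
qed

text \<open>The quasi-derivative is local: where \<open>u\<close> vanishes identically, so does \<open>w = u' - A u\<close> almost
  everywhere, and then everywhere by continuity.\<close>

lemma quasi_solution_zero_on_open:
  assumes q: "quasi_solution A B c f u w" and S: "open S" and u: "\<And>x. x \<in> S \<Longrightarrow> u x = 0" and x: "x \<in> S"
  shows "w x = 0"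
proof (rule continuous_AE_eq_imp_eq[of S w "\<lambda>x. 0" x])
  show "AE x in lebesgue. x \<in> S \<longrightarrow> w x = 0"
    using quasi_solution_vderiv[OF q]
  proof eventually_elim
    case (elim x)
    show ?case
    proof
      assume x: "x \<in> S"
      have "(u has_vector_derivative 0) (at x)"
        by (rule has_vector_derivative_transform_within_open[of "\<lambda>x. 0" _ _ S]) (use S x u in auto)
      then show "w x = 0" using elim u[OF x] by (simp add: vector_derivative_at)
    qed
  qed
qed (use S x in \<open>auto intro: continuous_on_subset[OF quasi_solution_continuous(2)[OF q]]\<close>)

text \<open>The right-hand side of the system is affine in \<open>(u, w)\<close> with locally integrable Lipschitz constant
  \<open>k\<close>; products such as \<open>A B\<close> are integrable because \<open>A\<close> and \<open>B\<close> are locally square-integrable.\<close>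

theorem quasi_solution_exists:
  assumes A: "L2_loc A" and B: "L2_loc B" and c: "L1_loc c" and f: "L1_loc f"
  shows "\<exists>u w. quasi_solution A B c f u w \<and> u x0 = \<alpha> \<and> w x0 = \<beta>"
proof -
  define H where "H t y = (A t * fst y + snd y, - B t * snd y - (A t * B t - c t) * fst y - f t)"
    for t and y :: "complex \<times> complex"
  define k where "k t = cmod (A t) + 1 + cmod (B t) + cmod (A t * B t - c t) + cmod (f t)" for t
  note L1 = L2_loc_imp_L1_loc[OF A] L2_loc_imp_L1_loc[OF B] L1_loc_diff[OF L1_loc_mult_L2_loc[OF A B] c]
  have pair: "norm (p, q) \<le> norm p + norm q" for p q :: complex
    using norm_Pair_le[of p q] .
  have inl: "bounded_linear (\<lambda>z. (z, 0::complex))" and inr: "bounded_linear (\<lambda>z. (0::complex, z))"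
    by (auto intro!: bounded_linear_Pair bounded_linear_ident bounded_linear_zero)
  have "\<exists>Y. Y x0 = (\<alpha>, \<beta>) \<and> primitive_of Y (\<lambda>t. H t (Y t))"
  proof (rule caratheodory_global_solution)
    fix Y :: "real \<Rightarrow> complex \<times> complex" and a b :: real
    assume Y: "continuous_on UNIV Y"
    have "L1_loc (\<lambda>t. A t * fst (Y t) + snd (Y t))"
      by (intro L1_loc_add L1_loc_mult_continuous L1 L2_loc_imp_L1_loc[OF L2_loc_continuous] continuous_intros Y)
    then have "(\<lambda>t. (A t * fst (Y t) + snd (Y t), 0::complex)) absolutely_integrable_on {a..b}"
      using absolutely_integrable_linear[OF L1_locD inl] by (simp add: o_def)
    moreover have "L1_loc (\<lambda>t. (- B t) * snd (Y t) - (A t * B t - c t) * fst (Y t) - f t)"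
      by (intro L1_loc_diff[OF L1_loc_diff f] L1_loc_mult_continuous L1_loc_uminus L1 continuous_intros Y)
    then have "(\<lambda>t. (0::complex, (- B t) * snd (Y t) - (A t * B t - c t) * fst (Y t) - f t)) absolutely_integrable_on {a..b}"
      using absolutely_integrable_linear[OF L1_locD inr] by (simp add: o_def)
    ultimately have "(\<lambda>t. (A t * fst (Y t) + snd (Y t), 0::complex) + (0::complex, (- B t) * snd (Y t) - (A t * B t - c t) * fst (Y t) - f t)) absolutely_integrable_on {a..b}"
      by (rule set_integral_add)
    then show "(\<lambda>t. H t (Y t)) absolutely_integrable_on {a..b}" by (simp add: H_def)
  next
    fix a b :: real
    show "k absolutely_integrable_on {a..b}"
      unfolding k_def by (intro set_integral_add absolutely_integrable_norm[unfolded o_def] L1_locD L1 f) auto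
  next
    show "0 \<le> k t" for t by (simp add: k_def)
  next
    fix t and y y' :: "complex \<times> complex"
    have "H t y - H t y' = (A t * (fst y - fst y') + (snd y - snd y'), - B t * (snd y - snd y') - (A t * B t - c t) * (fst y - fst y'))"
      by (simp add: H_def algebra_simps)
    also have "norm \<dots> \<le> (cmod (A t) * cmod (fst y - fst y') + cmod (snd y - snd y')) +
        (cmod (B t) * cmod (snd y - snd y') + cmod (A t * B t - c t) * cmod (fst y - fst y'))"
    proof (rule order_trans[OF pair], rule add_mono)
      show "cmod (A t * (fst y - fst y') + (snd y - snd y')) \<le> cmod (A t) * cmod (fst y - fst y') + cmod (snd y - snd y')"
        by (metis norm_mult norm_triangle_ineq)
      show "cmod (- B t * (snd y - snd y') - (A t * B t - c t) * (fst y - fst y')) \<le>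
          cmod (B t) * cmod (snd y - snd y') + cmod (A t * B t - c t) * cmod (fst y - fst y')"
        using norm_triangle_ineq4[of "- B t * (snd y - snd y')" "(A t * B t - c t) * (fst y - fst y')"]
        by (simp only: norm_mult norm_minus_cancel)
    qed
    also have "\<dots> \<le> (cmod (A t) * norm (y - y') + norm (y - y')) +
        (cmod (B t) * norm (y - y') + cmod (A t * B t - c t) * norm (y - y'))"
    proof -
      have "cmod (fst y - fst y') \<le> norm (y - y')" "cmod (snd y - snd y') \<le> norm (y - y')"
        by (metis fst_diff norm_fst_le prod.collapse) (metis snd_diff norm_snd_le prod.collapse)
      then show ?thesis by (intro add_mono mult_left_mono) auto
    qed
    also have "\<dots> \<le> k t * norm (y - y')"
      by (simp add: k_def algebra_simps)
    finally show "norm (H t y - H t y') \<le> k t * norm (y - y')" .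
  next
    fix t
    have "H t 0 = (0, - f t)" by (simp add: H_def)
    then have "norm (H t 0) = cmod (f t)" by (simp add: norm_Pair)
    also have "\<dots> \<le> k t" by (simp add: k_def)
    finally show "norm (H t 0) \<le> k t" .
  qed
  then obtain Y where Y: "Y x0 = (\<alpha>, \<beta>)" "primitive_of Y (\<lambda>t. H t (Y t))" by blast
  have "primitive_of (\<lambda>x. fst (Y x)) (\<lambda>x. fst (H x (Y x)))" "primitive_of (\<lambda>x. snd (Y x)) (\<lambda>x. snd (H x (Y x)))"
    using primitive_of_linear[OF Y(2) bounded_linear_fst] primitive_of_linear[OF Y(2) bounded_linear_snd] .
  then have "quasi_solution A B c f (\<lambda>x. fst (Y x)) (\<lambda>x. snd (Y x))"
    unfolding quasi_solution_def H_def by simp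
  then show ?thesis using Y(1) by (intro exI[of _ "\<lambda>x. fst (Y x)"] exI[of _ "\<lambda>x. snd (Y x)"]) auto
qed

text \<open>In the derivative of the boundary form all terms with \<open>A\<close>, \<open>B\<close> and \<open>c\<close> cancel; this is what the
  choice of the adjoint coefficients achieves.\<close>

theorem Lagrange_identity:
  assumes u: "quasi_solution A B c f u w"
    and v: "quasi_solution (cnj \<circ> B) (cnj \<circ> A) (cnj \<circ> c) g v z"
  shows "primitive_of (\<lambda>x. u x * cnj (z x) - w x * cnj (v x)) (\<lambda>x. f x * cnj (v x) - u x * cnj (g x))"
proof -
  have u': "primitive_of u (\<lambda>x. A x * u x + w x)"
    and w': "primitive_of w (\<lambda>x. - B x * w x - (A x * B x - c x) * u x - f x)"
    using u by (auto simp: quasi_solution_def)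
  have v': "primitive_of (\<lambda>x. cnj (v x)) (\<lambda>x. cnj (cnj (B x) * v x + z x))"
    and z': "primitive_of (\<lambda>x. cnj (z x)) (\<lambda>x. cnj (- cnj (A x) * z x - (cnj (B x) * cnj (A x) - cnj (c x)) * v x - g x))"
    using v[unfolded quasi_solution_def o_def, THEN conjunct1, THEN primitive_of_linear, OF bounded_linear_cnj]
      v[unfolded quasi_solution_def o_def, THEN conjunct2, THEN primitive_of_linear, OF bounded_linear_cnj] .
  have "primitive_of (\<lambda>x. u x * cnj (z x) - w x * cnj (v x))
     (\<lambda>x. ((A x * u x + w x) * cnj (z x) + u x * cnj (- cnj (A x) * z x - (cnj (B x) * cnj (A x) - cnj (c x)) * v x - g x))
        - ((- B x * w x - (A x * B x - c x) * u x - f x) * cnj (v x) + w x * cnj (cnj (B x) * v x + z x)))"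
    by (intro primitive_of_diff primitive_of_mult u' w' v' z')
  also have "(\<lambda>x. ((A x * u x + w x) * cnj (z x) + u x * cnj (- cnj (A x) * z x - (cnj (B x) * cnj (A x) - cnj (c x)) * v x - g x))
        - ((- B x * w x - (A x * B x - c x) * u x - f x) * cnj (v x) + w x * cnj (cnj (B x) * v x + z x)))
      = (\<lambda>x. f x * cnj (v x) - u x * cnj (g x))"
    by (intro ext) (simp add: algebra_simps)
  finally show ?thesis .
qed

lemma compactly_supported_iff_bounded_support:
  fixes u :: "real \<Rightarrow> 'a::zero"
  shows "compactly_supported u \<longleftrightarrow> (\<exists>R>0. \<forall>x. R \<le> \<bar>x\<bar> \<longrightarrow> u x = 0)"
proof
  assume "compactly_supported u"
  then have "bounded (closure {x. u x \<noteq> 0})" by (simp add: compactly_supported_def compact_imp_bounded)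
  then have "bounded {x. u x \<noteq> 0}" using bounded_subset closure_subset by blast
  then obtain M where M: "\<And>x. u x \<noteq> 0 \<Longrightarrow> \<bar>x\<bar> \<le> M" unfolding bounded_iff by auto
  have "u x = 0" if "\<bar>M\<bar> + 1 \<le> \<bar>x\<bar>" for x using M[of x] that by force
  then show "\<exists>R>0. \<forall>x. R \<le> \<bar>x\<bar> \<longrightarrow> u x = 0" by (intro exI[of _ "\<bar>M\<bar> + 1"]) auto
next
  assume "\<exists>R>0. \<forall>x. R \<le> \<bar>x\<bar> \<longrightarrow> u x = 0"
  then obtain R where R: "R > 0" "\<And>x. R \<le> \<bar>x\<bar> \<Longrightarrow> u x = 0" by blast
  have "{x. u x \<noteq> 0} \<subseteq> {-R..R}"
  proof
    fix x assume "x \<in> {x. u x \<noteq> 0}"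
    then have "\<not> R \<le> \<bar>x\<bar>" using R(2) by blast
    then show "x \<in> {-R..R}" by auto
  qed
  then have "bounded {x. u x \<noteq> 0}" using bounded_subset[of "{-R..R}"] by auto
  then show "compactly_supported u" by (simp add: compactly_supported_def)
qed

lemma quasi_solution_compact_support:
  assumes q: "quasi_solution A B c f u w" and u: "compactly_supported u"
  obtains R where "R > 0" "\<And>x. R \<le> \<bar>x\<bar> \<Longrightarrow> u x = 0" "\<And>x. R \<le> \<bar>x\<bar> \<Longrightarrow> w x = 0"
proof -
  obtain R where R: "R > 0" "\<And>x. R \<le> \<bar>x\<bar> \<Longrightarrow> u x = 0"
    using u compactly_supported_iff_bounded_support by blast
  have "open {x::real. R < \<bar>x\<bar>}" by (intro open_Collect_less continuous_intros)
  then have "w x = 0" if "R < \<bar>x\<bar>" for x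
    using quasi_solution_zero_on_open[OF q, of "{x. R < \<bar>x\<bar>}" x] R(2) that by auto
  then show ?thesis using R by (intro that[of "R + 1"]) auto
qed

lemma quasi_solution_cutoff:
  assumes q: "quasi_solution A B c f u w" and ab: "a \<le> b"
    and 0: "u a = 0" "u b = 0" "w a = 0" "w b = 0" and f: "\<And>x. x \<notin> {a..b} \<Longrightarrow> f x = 0"
  shows "quasi_solution A B c f (\<lambda>x. if x \<in> {a..b} then u x else 0) (\<lambda>x. if x \<in> {a..b} then w x else 0)"
proof -
  have "primitive_of (\<lambda>x. if x \<in> {a..b} then u x else 0) (\<lambda>x. if x \<in> {a..b} then A x * u x + w x else 0)"
    "primitive_of (\<lambda>x. if x \<in> {a..b} then w x else 0) (\<lambda>x. if x \<in> {a..b} then - B x * w x - (A x * B x - c x) * u x - f x else 0)"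
    using q 0 ab by (auto simp: quasi_solution_def simp del: atLeastAtMost_iff intro!: primitive_of_cutoff)
  moreover have "(\<lambda>x. if x \<in> {a..b} then A x * u x + w x else 0) =
      (\<lambda>x. A x * (if x \<in> {a..b} then u x else 0) + (if x \<in> {a..b} then w x else 0))" by auto
  moreover have "(\<lambda>x. if x \<in> {a..b} then - B x * w x - (A x * B x - c x) * u x - f x else 0) =
      (\<lambda>x. - B x * (if x \<in> {a..b} then w x else 0) - (A x * B x - c x) * (if x \<in> {a..b} then u x else 0) - f x)"
    using f by auto
  ultimately show ?thesis unfolding quasi_solution_def by metis
qed

text \<open>Local agreement of the \<open>u n\<close> forces agreement of the quasi-derivatives, so both can be glued; every
  bounded interval sees only one member of the sequence.\<close>

lemma quasi_solution_glue:
  assumes q: "\<And>n. quasi_solution A B c f (u n) (w n)"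
    and eq: "\<And>n m. n \<le> m \<Longrightarrow> AE x in lebesgue. x \<in> {- real (Suc n)<..<real (Suc n)} \<longrightarrow> u n x = u m x"
  shows "\<exists>U W. quasi_solution A B c f U W \<and> (\<forall>n. \<forall>x\<in>{- real (Suc n)<..<real (Suc n)}. U x = u n x)"
proof -
  have ueq: "u n x = u m x" if "n \<le> m" "\<bar>x\<bar> < real (Suc n)" for n m x
    by (rule continuous_AE_eq_imp_eq[OF _ _ _ eq[OF that(1)]])
      (use that in \<open>auto intro: continuous_on_subset[OF quasi_solution_continuous(1)[OF q]]\<close>)
  have weq: "w n x = w m x" if "n \<le> m" "\<bar>x\<bar> < real (Suc n)" for n m x
  proof -
    have "w n x - w m x = 0"
      by (rule quasi_solution_zero_on_open[OF quasi_solution_diff[OF q[of n] q[of m]], of "{- real (Suc n)<..<real (Suc n)}"])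
        (use ueq[OF that(1)] that(2) in \<open>auto simp: abs_less_iff\<close>)
    then show ?thesis by simp
  qed
  \<comment> \<open>The first index whose interval certainly contains \<open>x\<close>.\<close>
  define N where "N x = nat \<lceil>\<bar>x\<bar>\<rceil>" for x :: real
  have N: "\<bar>x\<bar> < real (Suc (N x))" for x unfolding N_def by linarith
  define U where "U x = u (N x) x" for x
  define W where "W x = w (N x) x" for x
  have UW: "U x = u n x \<and> W x = w n x" if x: "\<bar>x\<bar> < real (Suc n)" for n x
  proof (cases "n \<le> N x")
    case True
    show ?thesis unfolding U_def W_def using ueq[OF True x] weq[OF True x] by (simp only:)
  next
    case False
    then have le: "N x \<le> n" by simp
    show ?thesis unfolding U_def W_def using ueq[OF le N] weq[OF le N] by (simp only:)
  qed
  then have U: "\<And>n x. \<bar>x\<bar> < real (Suc n) \<Longrightarrow> U x = u n x" and W: "\<And>n x. \<bar>x\<bar> < real (Suc n) \<Longrightarrow> W x = w n x"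
    by blast+
  have glue: "primitive_of P p"
    if prim: "\<And>n. primitive_of (P' n) (p' n)"
      and Pp: "\<And>x n. \<bar>x\<bar> < real (Suc n) \<Longrightarrow> P x = P' n x" "\<And>x n. \<bar>x\<bar> < real (Suc n) \<Longrightarrow> p x = p' n x"
    for P p :: "real \<Rightarrow> complex" and P' p'
    unfolding primitive_of_def
  proof (intro conjI allI impI)
    fix a b :: real
    obtain n where n: "max \<bar>a\<bar> \<bar>b\<bar> < real n" using reals_Archimedean2 by blast
    have "\<bar>x\<bar> < real (Suc n)" if "x \<in> {a..b}" for x using that n by auto
    then have eq: "p x = p' n x" "P x = P' n x" if "x \<in> {a..b}" for x
      using Pp[of x n] that by blast+
    have "p absolutely_integrable_on {a..b} \<longleftrightarrow> p' n absolutely_integrable_on {a..b}"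
      by (intro set_integrable_cong) (auto simp: eq)
    then show "p absolutely_integrable_on {a..b}" using primitive_ofD(1)[OF prim] by simp
    assume ab: "a \<le> b"
    have "integral {a..b} p = integral {a..b} (p' n)" by (rule integral_cong) (simp add: eq)
    then show "P b - P a = integral {a..b} p" using primitive_ofD(3)[OF prim ab, of n] eq(2)[of a] eq(2)[of b] ab by simp
  qed
  have "quasi_solution A B c f U W"
    unfolding quasi_solution_def
  proof (intro conjI)
    show "primitive_of U (\<lambda>x. A x * U x + W x)"
      by (rule glue[of u "\<lambda>n x. A x * u n x + w n x"])
        (use q in \<open>simp add: quasi_solution_def\<close>, simp_all only: U W)
    show "primitive_of W (\<lambda>x. - B x * W x - (A x * B x - c x) * U x - f x)"
      by (rule glue[of w "\<lambda>n x. - B x * w n x - (A x * B x - c x) * u n x - f x"])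
        (use q in \<open>simp add: quasi_solution_def\<close>, simp_all only: U W)
  qed
  then show ?thesis using U by (intro exI[of _ U] exI[of _ W] conjI allI ballI U) (auto simp: abs_less_iff)
qed


section \<open>The adjoint of the pre-minimal operator\<close>

text \<open>The maximal and pre-minimal operators with \<open>w\<close> and \<open>f\<close> as witnesses: \<open>f\<close> need agree with the
  value of the expression only almost everywhere, which \<open>l2\<close> cannot see.\<close>

definition maximal_graph :: "(real \<Rightarrow> complex) \<Rightarrow> (real \<Rightarrow> complex) \<Rightarrow> (real \<Rightarrow> complex) \<Rightarrow> l2_op" where
  "maximal_graph A B c = {(abs_l2 u, abs_l2 f) | u w f. quasi_solution A B c f u w \<and> sq_int u \<and> sq_int f}"

definition preminimal_graph :: "(real \<Rightarrow> complex) \<Rightarrow> (real \<Rightarrow> complex) \<Rightarrow> (real \<Rightarrow> complex) \<Rightarrow> l2_op" where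
  "preminimal_graph A B c = {(abs_l2 u, abs_l2 f) | u w f. quasi_solution A B c f u w \<and> sq_int u \<and> sq_int f \<and> compactly_supported u}"

lemma max_domI:
  assumes "quasi_solution A B c f u w" "sq_int u" "sq_int f"
  shows "u \<in> max_dom A B c" "abs_l2 (qexpr A B c u) = abs_l2 f"
proof -
  have ae: "AE x in lebesgue. qexpr A B c u x = f x" by (rule quasi_solution_qderiv1(4)[OF assms(1)])
  then have sq: "sq_int (qexpr A B c u)" by (intro sq_int_cong_AE[OF assms(3)]) (auto elim: eventually_mono)
  then show "u \<in> max_dom A B c"
    using quasi_solution_qderiv1[OF assms(1)] assms(2) by (auto simp: max_dom_def)
  show "abs_l2 (qexpr A B c u) = abs_l2 f" using abs_l2_eq_iff[OF sq assms(3)] ae by simp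
qed

lemma max_domD:
  assumes "u \<in> max_dom A B c"
  shows "quasi_solution A B c (qexpr A B c u) u (qderiv1 A u)" "sq_int u" "sq_int (qexpr A B c u)"
  using assms by (auto simp: max_dom_def intro: quasi_solution_of_AC)

lemma qop_on_max_dom: "qop_on (max_dom A B c) A B c = maximal_graph A B c"
proof
  show "qop_on (max_dom A B c) A B c \<subseteq> maximal_graph A B c"
    unfolding qop_on_def maximal_graph_def using max_domD by blast
  show "maximal_graph A B c \<subseteq> qop_on (max_dom A B c) A B c"
  proof
    fix X assume "X \<in> maximal_graph A B c"
    then obtain u w f where "X = (abs_l2 u, abs_l2 f)" "quasi_solution A B c f u w" "sq_int u" "sq_int f"
      by (auto simp: maximal_graph_def)
    then show "X \<in> qop_on (max_dom A B c) A B c"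
      unfolding qop_on_def using max_domI[of A B c f u w] by (intro image_eqI[of _ _ u]) auto
  qed
qed

lemma qop_on_premin_dom: "qop_on (premin_dom A B c) A B c = preminimal_graph A B c"
proof
  show "qop_on (premin_dom A B c) A B c \<subseteq> preminimal_graph A B c"
    unfolding qop_on_def preminimal_graph_def premin_dom_def using max_domD by blast
  show "preminimal_graph A B c \<subseteq> qop_on (premin_dom A B c) A B c"
  proof
    fix X assume "X \<in> preminimal_graph A B c"
    then obtain u w f where "X = (abs_l2 u, abs_l2 f)" "quasi_solution A B c f u w" "sq_int u" "sq_int f" "compactly_supported u"
      by (auto simp: preminimal_graph_def)
    then show "X \<in> qop_on (premin_dom A B c) A B c"
      unfolding qop_on_def premin_dom_def using max_domI[of A B c f u w] by (intro image_eqI[of _ _ u]) auto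
  qed
qed

lemma preminimal_subset_maximal: "preminimal_graph A B c \<subseteq> maximal_graph A B c"
  unfolding preminimal_graph_def maximal_graph_def by blast

lemma l2_scaleC_diff_left: "l2_scaleC (k - l) X = l2_scaleC k X - l2_scaleC l X"
proof -
  obtain f where "sq_int f" "X = abs_l2 f" by (rule l2_cases)
  then show ?thesis by (simp add: abs_l2_scaleC abs_l2_diff sq_int_cmult left_diff_distrib)
qed

text \<open>If \<open>a\<close> has norm zero then \<open>a = 0\<close> and any multiple serves.\<close>

lemma l2_projection_line: "\<exists>\<alpha>. l2_inner (h - l2_scaleC \<alpha> a) a = 0"
proof (cases "l2_inner a a = 0")
  case True
  then show ?thesis using l2_inner_self_eq_0[OF True] by (intro exI[of _ 0]) simp
next
  case False
  then show ?thesis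
    by (intro exI[of _ "l2_inner h a / l2_inner a a"]) (simp add: l2_inner_diff_left l2_inner_scaleC_left)
qed

text \<open>Gram-Schmidt; \<open>a\<close> and \<open>b\<close> may be linearly dependent.\<close>

lemma l2_projection_plane:
  "\<exists>\<alpha> \<beta>. l2_inner (h - l2_scaleC \<alpha> a - l2_scaleC \<beta> b) a = 0 \<and> l2_inner (h - l2_scaleC \<alpha> a - l2_scaleC \<beta> b) b = 0"
proof -
  obtain \<gamma> where \<gamma>: "l2_inner (b - l2_scaleC \<gamma> a) a = 0" using l2_projection_line by blast
  define b' where "b' = b - l2_scaleC \<gamma> a"
  obtain \<alpha> where \<alpha>: "l2_inner (h - l2_scaleC \<alpha> a) a = 0" using l2_projection_line by blast
  obtain \<beta> where \<beta>: "l2_inner (h - l2_scaleC \<beta> b') b' = 0" using l2_projection_line by blast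
  have b'a: "l2_inner b' a = 0" "l2_inner a b' = 0"
    using \<gamma> l2_inner_commute[of a b'] by (auto simp: b'_def)
  define p where "p = h - l2_scaleC \<alpha> a - l2_scaleC \<beta> b'"
  have pa: "l2_inner p a = 0" using \<alpha> b'a by (simp add: p_def l2_inner_diff_left l2_inner_scaleC_left)
  have pb': "l2_inner p b' = 0" using \<beta> b'a by (simp add: p_def l2_inner_diff_left l2_inner_scaleC_left)
  have pb: "l2_inner p b = 0"
    using pb' pa by (simp add: b'_def l2_inner_diff_right l2_inner_scaleC_right)
  have lin: "l2_scaleC \<beta> b' = l2_scaleC \<beta> b - l2_scaleC (\<beta> * \<gamma>) a"
    using bounded_linear.linear[OF bounded_linear_l2_scaleC, of \<beta>]
    by (simp add: b'_def linear_diff l2_scaleC_assoc)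
  have lin2: "l2_scaleC (\<alpha> - \<beta> * \<gamma>) a = l2_scaleC \<alpha> a - l2_scaleC (\<beta> * \<gamma>) a"
    by (rule l2_scaleC_diff_left)
  have "p = h - l2_scaleC (\<alpha> - \<beta> * \<gamma>) a - l2_scaleC \<beta> b"
    by (simp add: p_def lin lin2)
  then show ?thesis using pa pb by metis
qed

lemma l2_inner_supported:
  assumes p: "sq_int p" and k: "sq_int k" and supp: "\<And>x. x \<notin> {a..b} \<Longrightarrow> p x = 0"
    and kl: "\<And>x. x \<in> {a..b} \<Longrightarrow> k x = l x"
  shows "l2_inner (abs_l2 p) (abs_l2 k) = integral {a..b} (\<lambda>x. p x * cnj (l x))"
proof -
  have "set_integrable lebesgue {a..b} (\<lambda>x. p x * cnj (k x))"
    unfolding set_integrable_def by (intro integrable_mult_indicator sq_int_inner p k) auto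
  then have "(\<integral>x. p x * cnj (k x) \<partial>lebesgue) = integral {a..b} (\<lambda>x. p x * cnj (k x))"
    by (rule lebesgue_integral_eq_integral_interval) (simp add: supp)
  also have "\<dots> = integral {a..b} (\<lambda>x. p x * cnj (l x))"
    by (rule integral_cong) (simp add: kl)
  finally show ?thesis by (simp add: l2_inner_abs p k)
qed

context
  fixes A B c :: "real \<Rightarrow> complex"
  assumes A: "L2_loc A" and B: "L2_loc B" and c: "L1_loc c"
begin

text \<open>The core of the computation of the adjoint. The data of \<open>y1\<close> and \<open>y2\<close> are prescribed at the right
  end point \<open>R\<close>, so that the two orthogonality relations of \<open>p\<close> are exactly the two boundary conditions
  that \<open>u\<close> must satisfy there.\<close>

lemma adjoint_preminimal_local_solution:
  assumes adj: "(abs_l2 v, abs_l2 g) \<in> adjoint_op (preminimal_graph A B c)"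
    and v: "sq_int v" and g: "sq_int g" and R: "R > 0"
  shows "\<exists>y z. quasi_solution (cnj \<circ> B) (cnj \<circ> A) (cnj \<circ> c) g y z \<and> (AE x in lebesgue. x \<in> {-R..R} \<longrightarrow> v x = y x)"
proof -
  define cut where "cut k x = (if x \<in> {-R..R} then k x else 0)" for k :: "real \<Rightarrow> complex" and x
  have cut_sq: "sq_int (cut k)" if "L2_loc k" for k
    using L2_loc_restrict[OF that, of "-R" R] unfolding cut_def .
  have cut_out: "x \<notin> {-R..R} \<Longrightarrow> cut k x = 0" and cut_in: "x \<in> {-R..R} \<Longrightarrow> cut k x = k x" for k x
    by (auto simp: cut_def)
  note ex = quasi_solution_exists[OF L2_loc_cnj[OF B] L2_loc_cnj[OF A] L1_loc_cnj[OF c]]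
  have zero: "L1_loc (\<lambda>x. 0)" by (simp add: L1_loc_def)
  obtain y0 z0 where y0: "quasi_solution (cnj \<circ> B) (cnj \<circ> A) (cnj \<circ> c) g y0 z0"
    using ex[OF L2_loc_imp_L1_loc[OF sq_int_imp_L2_loc[OF g]]] by blast
  obtain y1 z1 where y1: "quasi_solution (cnj \<circ> B) (cnj \<circ> A) (cnj \<circ> c) (\<lambda>x. 0) y1 z1" "y1 R = 1" "z1 R = 0"
    using ex[OF zero] by blast
  obtain y2 z2 where y2: "quasi_solution (cnj \<circ> B) (cnj \<circ> A) (cnj \<circ> c) (\<lambda>x. 0) y2 z2" "y2 R = 0" "z2 R = 1"
    using ex[OF zero] by blast
  have L2: "L2_loc y0" "L2_loc y1" "L2_loc y2" "L2_loc v"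
    using y0 y1(1) y2(1) by (auto intro: L2_loc_continuous quasi_solution_continuous(1) sq_int_imp_L2_loc[OF v])
  define d where "d x = v x - y0 x" for x
  have d: "L2_loc d"
    unfolding d_def using L2_loc_add[OF L2(4) L2_loc_mult_continuous[OF L2(1), of "\<lambda>_. -1"]] by simp
  obtain \<alpha> \<beta> where
    o1: "l2_inner (abs_l2 (cut d) - l2_scaleC \<alpha> (abs_l2 (cut y1)) - l2_scaleC \<beta> (abs_l2 (cut y2))) (abs_l2 (cut y1)) = 0" and
    o2: "l2_inner (abs_l2 (cut d) - l2_scaleC \<alpha> (abs_l2 (cut y1)) - l2_scaleC \<beta> (abs_l2 (cut y2))) (abs_l2 (cut y2)) = 0"
    using l2_projection_plane by blast
  define p where "p x = cut d x - \<alpha> * cut y1 x - \<beta> * cut y2 x" for x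
  have p: "sq_int p" unfolding p_def by (intro sq_int_diff sq_int_cmult cut_sq d L2)
  have p_out: "p x = 0" if "x \<notin> {-R..R}" for x using that by (simp add: p_def cut_out)
  have abs_p: "abs_l2 p = abs_l2 (cut d) - l2_scaleC \<alpha> (abs_l2 (cut y1)) - l2_scaleC \<beta> (abs_l2 (cut y2))"
    unfolding p_def by (simp add: abs_l2_diff abs_l2_scaleC cut_sq d L2 sq_int_cmult sq_int_diff)
  have RR: "- R \<le> R" using R by simp
  obtain u w where u: "quasi_solution A B c p u w" "u (-R) = 0" "w (-R) = 0"
    using quasi_solution_exists[OF A B c L2_loc_imp_L1_loc[OF sq_int_imp_L2_loc[OF p]]] by blast
  have bdry: "u R * cnj (z R) - w R * cnj (y R) = l2_inner (abs_l2 p) (abs_l2 (cut y))"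
    if y: "quasi_solution (cnj \<circ> B) (cnj \<circ> A) (cnj \<circ> c) (\<lambda>x. 0) y z" for y z
  proof -
    have "u R * cnj (z R) - w R * cnj (y R) = integral {-R..R} (\<lambda>x. p x * cnj (y x) - u x * cnj 0)"
      using primitive_ofD(3)[OF Lagrange_identity[OF u(1) y] RR] u(2,3) by simp
    also have "\<dots> = integral {-R..R} (\<lambda>x. p x * cnj (y x))" by simp
    also have "\<dots> = l2_inner (abs_l2 p) (abs_l2 (cut y))"
      by (rule l2_inner_supported[symmetric, OF p cut_sq p_out cut_in])
        (auto intro: L2_loc_continuous quasi_solution_continuous(1)[OF y])
    finally show ?thesis .
  qed
  \<comment> \<open>Lagrange's identity for \<open>u\<close> and \<open>y1\<close> or \<open>y2\<close>; the left end point contributes nothing.\<close>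
  have wR: "w R = 0" using bdry[OF y1(1)] o1 y1(2,3) abs_p by simp
  have uR: "u R = 0" using bdry[OF y2(1)] o2 y2(2,3) abs_p by simp
  have cu: "quasi_solution A B c p (cut u) (cut w)"
    using quasi_solution_cutoff[OF u(1) RR u(2) uR u(3) wR p_out] unfolding cut_def .
  have su: "sq_int (cut u)" by (intro cut_sq L2_loc_continuous quasi_solution_continuous(1)[OF u(1)])
  have "compactly_supported (cut u)"
    unfolding compactly_supported_iff_bounded_support using R
    by (intro exI[of _ "R + 1"]) (auto intro!: cut_out)
  then have "(abs_l2 (cut u), abs_l2 p) \<in> preminimal_graph A B c"
    unfolding preminimal_graph_def using cu su p by blast
  then have "l2_inner (abs_l2 p) (abs_l2 v) = l2_inner (abs_l2 (cut u)) (abs_l2 g)"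
    using adj unfolding adjoint_op_def by auto
  also have "\<dots> = integral {-R..R} (\<lambda>x. cut u x * cnj (g x))"
    by (rule l2_inner_supported[OF su g cut_out]) auto
  also have "\<dots> = integral {-R..R} (\<lambda>x. p x * cnj (y0 x))"
  proof -
    have i1: "(\<lambda>x. p x * cnj (y0 x)) integrable_on {-R..R}"
      using L1_loc_mult_L2_loc[OF sq_int_imp_L2_loc[OF p] L2_loc_cnj[OF L2(1)]]
      by (simp add: L1_loc_def absolutely_integrable_on_def)
    have i2: "(\<lambda>x. u x * cnj (g x)) integrable_on {-R..R}"
      using L1_loc_mult_L2_loc[OF L2_loc_continuous[OF quasi_solution_continuous(1)[OF u(1)]] L2_loc_cnj[OF sq_int_imp_L2_loc[OF g]]]
      by (simp add: L1_loc_def absolutely_integrable_on_def)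
    have "0 = integral {-R..R} (\<lambda>x. p x * cnj (y0 x) - u x * cnj (g x))"
      using primitive_ofD(3)[OF Lagrange_identity[OF u(1) y0] RR] u(2,3) uR wR by simp
    also have "\<dots> = integral {-R..R} (\<lambda>x. p x * cnj (y0 x)) - integral {-R..R} (\<lambda>x. u x * cnj (g x))"
      by (rule integral_diff[OF i1 i2])
    also have "integral {-R..R} (\<lambda>x. u x * cnj (g x)) = integral {-R..R} (\<lambda>x. cut u x * cnj (g x))"
      by (rule integral_cong) (simp add: cut_in)
    finally show ?thesis by simp
  qed
  also have "\<dots> = l2_inner (abs_l2 p) (abs_l2 (cut y0))"
    by (rule l2_inner_supported[symmetric, OF p cut_sq[OF L2(1)] p_out cut_in]) auto
  finally have "l2_inner (abs_l2 p) (abs_l2 v) = l2_inner (abs_l2 p) (abs_l2 (cut y0))" .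
  moreover have "l2_inner (abs_l2 p) (abs_l2 v) = l2_inner (abs_l2 p) (abs_l2 (cut v))"
    using l2_inner_supported[OF p v p_out, of "-R" R v] l2_inner_supported[OF p cut_sq[OF L2(4)] p_out cut_in] by simp
  moreover have "cut d = (\<lambda>x. cut v x - cut y0 x)" by (auto simp: cut_def d_def)
  then have "abs_l2 (cut d) = abs_l2 (cut v) - abs_l2 (cut y0)" by (simp add: abs_l2_diff cut_sq L2)
  ultimately have "l2_inner (abs_l2 p) (abs_l2 (cut d)) = 0" by (simp add: l2_inner_diff_right)
  then have "l2_inner (abs_l2 p) (abs_l2 p) = 0"
    using o1 o2 unfolding abs_p[symmetric]
    by (subst (2) abs_p) (simp add: l2_inner_diff_right l2_inner_scaleC_right)
  then have "abs_l2 p = abs_l2 (\<lambda>x. 0)" using l2_inner_self_eq_0 zero_l2_eq by metis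
  then have ae: "AE x in lebesgue. p x = 0" using abs_l2_eq_iff[OF p sq_int_zero] by simp
  have "quasi_solution (cnj \<circ> B) (cnj \<circ> A) (cnj \<circ> c) (\<lambda>x. (g x + \<alpha> * 0) + \<beta> * 0)
      (\<lambda>x. (y0 x + \<alpha> * y1 x) + \<beta> * y2 x) (\<lambda>x. (z0 x + \<alpha> * z1 x) + \<beta> * z2 x)"
    by (intro quasi_solution_add quasi_solution_scale y0 y1(1) y2(1))
  then have "quasi_solution (cnj \<circ> B) (cnj \<circ> A) (cnj \<circ> c) g
      (\<lambda>x. (y0 x + \<alpha> * y1 x) + \<beta> * y2 x) (\<lambda>x. (z0 x + \<alpha> * z1 x) + \<beta> * z2 x)" by simp
  moreover have "AE x in lebesgue. x \<in> {-R..R} \<longrightarrow> v x = (y0 x + \<alpha> * y1 x) + \<beta> * y2 x"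
    using ae by eventually_elim (auto simp: p_def cut_def d_def algebra_simps)
  ultimately show ?thesis by blast
qed

text \<open>One inclusion glues the local solutions; the other is Lagrange's identity over the whole line,
  where the boundary form of a compactly supported function vanishes near both ends.\<close>

theorem adjoint_preminimal:
  "adjoint_op (preminimal_graph A B c) = maximal_graph (cnj \<circ> B) (cnj \<circ> A) (cnj \<circ> c)"
proof (intro equalityI subsetI)
  fix VW assume VW: "VW \<in> adjoint_op (preminimal_graph A B c)"
  obtain v g where v: "sq_int v" "fst VW = abs_l2 v" and g: "sq_int g" "snd VW = abs_l2 g"
    by (metis l2_cases)
  have adj: "(abs_l2 v, abs_l2 g) \<in> adjoint_op (preminimal_graph A B c)" using VW v g by (metis prod.collapse)
  have "\<forall>n. \<exists>y z. quasi_solution (cnj \<circ> B) (cnj \<circ> A) (cnj \<circ> c) g y z \<and>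
      (AE x in lebesgue. x \<in> {-real (Suc n)..real (Suc n)} \<longrightarrow> v x = y x)"
    by (intro allI adjoint_preminimal_local_solution[OF adj v(1) g(1)]) simp
  then obtain y z where y: "\<And>n. quasi_solution (cnj \<circ> B) (cnj \<circ> A) (cnj \<circ> c) g (y n) (z n)"
    and vy: "\<And>n. AE x in lebesgue. x \<in> {-real (Suc n)..real (Suc n)} \<longrightarrow> v x = y n x"
    by metis
  have "AE x in lebesgue. x \<in> {-real (Suc n)<..<real (Suc n)} \<longrightarrow> y n x = y m x" if "n \<le> m" for n m
    using vy[of n] vy[of m] by eventually_elim (use of_nat_mono[OF that, where 'a = real] in auto)
  from quasi_solution_glue[OF y this] obtain U W where
    U: "quasi_solution (cnj \<circ> B) (cnj \<circ> A) (cnj \<circ> c) g U W" "\<And>n x. x \<in> {- real (Suc n)<..<real (Suc n)} \<Longrightarrow> U x = y n x"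
    by metis
  have "AE x in lebesgue. \<forall>n. x \<in> {-real (Suc n)..real (Suc n)} \<longrightarrow> v x = y n x"
    using vy by (simp add: AE_all_countable)
  then have vU: "AE x in lebesgue. v x = U x"
  proof eventually_elim
    case (elim x)
    obtain n where "\<bar>x\<bar> < real n" using reals_Archimedean2 by blast
    then have x: "x \<in> {- real (Suc n)<..<real (Suc n)}" by auto
    show ?case using elim[rule_format, of n] U(2)[OF x] x by auto
  qed
  then have "sq_int U" by (rule sq_int_cong_AE[OF v(1)])
  moreover from this have "abs_l2 v = abs_l2 U" using abs_l2_eq_iff v(1) vU by blast
  ultimately have "(abs_l2 v, abs_l2 g) \<in> maximal_graph (cnj \<circ> B) (cnj \<circ> A) (cnj \<circ> c)"
    unfolding maximal_graph_def using U(1) g(1) by blast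
  then show "VW \<in> maximal_graph (cnj \<circ> B) (cnj \<circ> A) (cnj \<circ> c)" using v g by (metis prod.collapse)
next
  fix VW assume "VW \<in> maximal_graph (cnj \<circ> B) (cnj \<circ> A) (cnj \<circ> c)"
  then obtain v z g where VW: "VW = (abs_l2 v, abs_l2 g)" and
    v: "quasi_solution (cnj \<circ> B) (cnj \<circ> A) (cnj \<circ> c) g v z" "sq_int v" "sq_int g"
    by (auto simp: maximal_graph_def)
  have "l2_inner (abs_l2 f) (abs_l2 v) = l2_inner (abs_l2 u) (abs_l2 g)"
    if u: "quasi_solution A B c f u w" "sq_int u" "sq_int f" "compactly_supported u" for u w f
  proof -
    have int: "integrable lebesgue (\<lambda>x. f x * cnj (v x) - u x * cnj (g x))"
      by (intro Bochner_Integration.integrable_diff sq_int_inner u v)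
    obtain R where R: "R > 0" "\<And>x. R \<le> \<bar>x\<bar> \<Longrightarrow> u x = 0" "\<And>x. R \<le> \<bar>x\<bar> \<Longrightarrow> w x = 0"
      using quasi_solution_compact_support[OF u(1,4)] by blast
    have "(\<integral>x. f x * cnj (v x) - u x * cnj (g x) \<partial>lebesgue) = 0"
      by (rule integral_eq_0_of_compactly_supported_primitive[OF Lagrange_identity[OF u(1) v(1)] int, of R])
        (simp add: R)
    then show ?thesis
      by (simp add: l2_inner_abs u v Bochner_Integration.integral_diff sq_int_inner)
  qed
  then show "VW \<in> adjoint_op (preminimal_graph A B c)"
    unfolding VW adjoint_op_def preminimal_graph_def by blast
qed

end


section \<open>Adjoints and closures of graphs\<close>

text \<open>A linear relation. Adjoints of graphs are always of this kind, also when they are not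
  single-valued; \<open>linear_operator\<close> adds single-valuedness.\<close>

definition linear_graph :: "l2_op \<Rightarrow> bool" where
  "linear_graph T \<longleftrightarrow> (0, 0) \<in> T \<and>
     (\<forall>f g f' g'. (f, g) \<in> T \<longrightarrow> (f', g') \<in> T \<longrightarrow> (f + f', g + g') \<in> T) \<and>
     (\<forall>k f g. (f, g) \<in> T \<longrightarrow> (l2_scaleC k f, l2_scaleC k g) \<in> T)"

lemma linear_operator_iff: "linear_operator T \<longleftrightarrow> single_valued T \<and> linear_graph T"
  by (auto simp: linear_operator_def linear_graph_def)

lemma l2_scaleC_zero [simp]: "l2_scaleC k 0 = 0"
  using bounded_linear.linear[OF bounded_linear_l2_scaleC] by (rule linear_0)

lemma adjoint_op_iff: "(v, w) \<in> adjoint_op T \<longleftrightarrow> (\<forall>u t. (u, t) \<in> T \<longrightarrow> l2_inner t v = l2_inner u w)"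
  by (auto simp: adjoint_op_def)

lemma linear_graph_adjoint: "linear_graph (adjoint_op T)"
  by (auto simp: linear_graph_def adjoint_op_iff l2_inner_add_right l2_inner_scaleC_right)

lemma closed_adjoint: "closed (adjoint_op T)"
proof -
  have "adjoint_op T = (\<Inter>(u, t)\<in>T. {vw. l2_inner t (fst vw) = l2_inner u (snd vw)})"
    by (auto simp: adjoint_op_def)
  moreover have "closed {vw. l2_inner t (fst vw) = l2_inner u (snd vw)}" for t u
    by (intro closed_Collect_eq continuous_intros)
  ultimately show ?thesis by (auto intro!: closed_INT)
qed

lemma subspace_closure:
  fixes S :: "'a::real_normed_vector set"
  assumes S: "subspace S"
  shows "subspace (closure S)"
  unfolding subspace_def
proof (intro conjI ballI allI)
  show "0 \<in> closure S" using subspace_0[OF S] closure_subset by blast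
  show "x + y \<in> closure S" if xy: "x \<in> closure S" "y \<in> closure S" for x y
  proof -
    obtain f g where "\<And>n. f n \<in> S" "f \<longlonglongrightarrow> x" "\<And>n. g n \<in> S" "g \<longlonglongrightarrow> y"
      using xy unfolding closure_sequential by blast
    then show ?thesis
      unfolding closure_sequential using S
      by (intro exI[of _ "\<lambda>n. f n + g n"]) (auto intro: tendsto_add subspace_add)
  qed
  show "k *\<^sub>R x \<in> closure S" if x: "x \<in> closure S" for x k
  proof -
    obtain f where "\<And>n. f n \<in> S" "f \<longlonglongrightarrow> x"
      using x unfolding closure_sequential by blast
    then show ?thesis
      unfolding closure_sequential using S
      by (intro exI[of _ "\<lambda>n. k *\<^sub>R f n"]) (auto intro: tendsto_scaleR subspace_scale)
  qed
qed

lemma subspace_linear_graph: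
  assumes "linear_graph T"
  shows "subspace T"
  unfolding subspace_def using assms
  by (auto simp: linear_graph_def scaleR_conv_l2_scaleC zero_prod_def)

lemma orthogonal_complex_subspace:
  assumes "inner m y = 0" "inner (l2_scaleC \<i> m) y = 0"
  shows "l2_inner m y = 0"
  using assms by (intro complex_eqI) (auto simp: inner_l2_def l2_inner_scaleC_left)

text \<open>A pair outside the closure is separated from the graph by a vector \<open>(p, q)\<close> orthogonal to it.
  Orthogonality says that \<open>(q, -p)\<close> belongs to the adjoint, and separation says that the pair violates
  the double adjoint relation for \<open>(q, -p)\<close>. Invariance of the graph under \<open>\<i>\<close> upgrades real to
  complex orthogonality.\<close>

theorem double_adjoint:
  assumes T: "linear_graph T"
  shows "adjoint_op (adjoint_op T) = closure T"
proof
  have "T \<subseteq> adjoint_op (adjoint_op T)"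
  proof
    fix X assume X: "X \<in> T"
    obtain u t where ut: "X = (u, t)" by (cases X)
    have "l2_inner w u = l2_inner v t" if "(v, w) \<in> adjoint_op T" for v w
    proof -
      have "l2_inner t v = l2_inner u w" using that X ut by (auto simp: adjoint_op_def)
      then show ?thesis by (metis l2_inner_commute)
    qed
    then show "X \<in> adjoint_op (adjoint_op T)" unfolding ut adjoint_op_def[of "adjoint_op T"] by auto
  qed
  then show "closure T \<subseteq> adjoint_op (adjoint_op T)" by (rule closure_minimal) (rule closed_adjoint)
next
  show "adjoint_op (adjoint_op T) \<subseteq> closure T"
  proof (rule ccontr)
    assume "\<not> adjoint_op (adjoint_op T) \<subseteq> closure T"
    then obtain a b where ab: "(a, b) \<in> adjoint_op (adjoint_op T)" "(a, b) \<notin> closure T" by auto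
    have "subspace (closure T)" by (rule subspace_closure[OF subspace_linear_graph[OF T]])
    then obtain Y where Y: "\<And>m. m \<in> closure T \<Longrightarrow> inner m Y = 0" "inner (a, b) Y \<noteq> 0"
      using closed_subspace_separation[OF _ closed_closure ab(2)] by metis
    obtain p q where pq: "Y = (p, q)" by (cases Y)
    have "l2_inner t q = l2_inner u (- p)" if ut: "(u, t) \<in> T" for u t
    proof -
      have *: "inner u' p + inner t' q = 0" if "(u', t') \<in> T" for u' t'
        using Y(1)[of "(u', t')"] that closure_subset[of T] by (auto simp: pq)
      have "(l2_scaleC \<i> u, l2_scaleC \<i> t) \<in> T" using T ut by (auto simp: linear_graph_def)
      from *[OF ut] *[OF this] have "l2_inner u p + l2_inner t q = 0"
        by (intro complex_eqI) (auto simp: inner_l2_def l2_inner_scaleC_left)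
      then show ?thesis
        using l2_inner_diff_right[of u 0 p] by (simp add: add_eq_0_iff)
    qed
    then have "(q, - p) \<in> adjoint_op T" by (auto simp: adjoint_op_def)
    then have "l2_inner (- p) a = l2_inner q b" using ab(1) unfolding adjoint_op_def[of "adjoint_op T"] by auto
    then have "inner (- p) a = inner q b" by (simp add: inner_l2_def)
    then show False using Y(2) by (simp add: pq inner_commute)
  qed
qed

text \<open>A vector \<open>y\<close> orthogonal to the domain puts \<open>(0, y)\<close> next to \<open>(0, 0)\<close> into the adjoint.\<close>

lemma dense_Domain_if_adjoint_single_valued:
  assumes T: "linear_graph T" and sv: "single_valued (adjoint_op T)"
  shows "closure (Domain T) = UNIV"
proof (rule ccontr)
  assume "closure (Domain T) \<noteq> UNIV"
  then obtain x where x: "x \<notin> closure (Domain T)" by blast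
  have "subspace (Domain T)"
    unfolding subspace_def
  proof (intro conjI ballI allI)
    show "0 \<in> Domain T" using T by (auto simp: linear_graph_def)
    show "a + b \<in> Domain T" if "a \<in> Domain T" "b \<in> Domain T" for a b
      using T that unfolding linear_graph_def by blast
    show "k *\<^sub>R a \<in> Domain T" if "a \<in> Domain T" for a k
      using T that unfolding linear_graph_def scaleR_conv_l2_scaleC by blast
  qed
  then have "subspace (closure (Domain T))" by (rule subspace_closure)
  then obtain y where y: "\<And>m. m \<in> closure (Domain T) \<Longrightarrow> inner m y = 0" "inner x y \<noteq> 0"
    using closed_subspace_separation[OF _ closed_closure x] by metis
  have "l2_inner u y = 0" if ut: "(u, t) \<in> T" for u t
  proof (rule orthogonal_complex_subspace)
    have "u \<in> Domain T" "l2_scaleC \<i> u \<in> Domain T" using T ut unfolding linear_graph_def by blast+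
    then show "inner u y = 0" "inner (l2_scaleC \<i> u) y = 0" using y(1) closure_subset[of "Domain T"] by auto
  qed
  then have "(0, y) \<in> adjoint_op T" "(0, 0) \<in> adjoint_op T" by (auto simp: adjoint_op_def)
  then have "y = 0" using sv by (auto simp: single_valued_def)
  then show False using y(2) by simp
qed

section \<open>The maximal and minimal operators\<close>

lemma quasi_solution_zero: "quasi_solution A B c (\<lambda>x. 0) (\<lambda>x. 0) (\<lambda>x. 0)"
  using primitive_of_const[of "0::complex"] by (simp add: quasi_solution_def)

text \<open>The class of \<open>u\<close> in \<open>l2\<close> determines its continuous representative, hence its image.\<close>

lemma single_valued_maximal: "single_valued (maximal_graph A B c)"
proof (rule single_valuedI)
  fix X F F' assume "(X, F) \<in> maximal_graph A B c" "(X, F') \<in> maximal_graph A B c"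
  then obtain u w f u' w' f' where
    u: "X = abs_l2 u" "F = abs_l2 f" "quasi_solution A B c f u w" "sq_int u" "sq_int f" and
    u': "X = abs_l2 u'" "F' = abs_l2 f'" "quasi_solution A B c f' u' w'" "sq_int u'" "sq_int f'"
    unfolding maximal_graph_def by blast
  have "AE x in lebesgue. x \<in> UNIV \<longrightarrow> u x = u' x" using abs_l2_eq_iff[OF u(4) u'(4)] u(1) u'(1) by simp
  then have "u x = u' x" for x
    by (rule continuous_AE_eq_imp_eq[OF quasi_solution_continuous(1)[OF u(3)] quasi_solution_continuous(1)[OF u'(3)] open_UNIV]) simp
  then have "u = u'" by (rule ext)
  then have "AE x in lebesgue. f x = f' x"
    using quasi_solution_qderiv1(4)[OF u(3)] quasi_solution_qderiv1(4)[OF u'(3)] by (auto elim: eventually_elim2)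
  then show "F = F'" using abs_l2_eq_iff[OF u(5) u'(5)] u(2) u'(2) by simp
qed

lemma compactly_supported_add:
  fixes u v :: "real \<Rightarrow> complex"
  assumes "compactly_supported u" "compactly_supported v"
  shows "compactly_supported (\<lambda>x. u x + v x)"
proof -
  obtain R R' where "R > 0" "\<forall>x. R \<le> \<bar>x\<bar> \<longrightarrow> u x = 0" "R' > 0" "\<forall>x. R' \<le> \<bar>x\<bar> \<longrightarrow> v x = 0"
    using assms unfolding compactly_supported_iff_bounded_support by blast
  then show ?thesis
    unfolding compactly_supported_iff_bounded_support by (intro exI[of _ "max R R'"]) auto
qed

lemma linear_graph_preminimal: "linear_graph (preminimal_graph A B c)"
  unfolding linear_graph_def
proof (intro conjI allI impI)
  have "compactly_supported (\<lambda>x::real. 0::complex)" by (simp add: compactly_supported_def)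
  then show "(0, 0) \<in> preminimal_graph A B c"
    unfolding preminimal_graph_def zero_l2_eq using quasi_solution_zero sq_int_zero by blast
next
  fix X F X' F' assume "(X, F) \<in> preminimal_graph A B c" "(X', F') \<in> preminimal_graph A B c"
  then obtain u w f u' w' f' where
    u: "X = abs_l2 u" "F = abs_l2 f" "quasi_solution A B c f u w" "sq_int u" "sq_int f" "compactly_supported u" and
    u': "X' = abs_l2 u'" "F' = abs_l2 f'" "quasi_solution A B c f' u' w'" "sq_int u'" "sq_int f'" "compactly_supported u'"
    unfolding preminimal_graph_def by blast
  have "X + X' = abs_l2 (\<lambda>x. u x + u' x)" "F + F' = abs_l2 (\<lambda>x. f x + f' x)"
    using u u' by (auto simp: abs_l2_add)
  then show "(X + X', F + F') \<in> preminimal_graph A B c"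
    unfolding preminimal_graph_def
    using quasi_solution_add[OF u(3) u'(3)] sq_int_add[OF u(4) u'(4)] sq_int_add[OF u(5) u'(5)] compactly_supported_add[OF u(6) u'(6)]
    by blast
next
  fix k X F assume "(X, F) \<in> preminimal_graph A B c"
  then obtain u w f where
    u: "X = abs_l2 u" "F = abs_l2 f" "quasi_solution A B c f u w" "sq_int u" "sq_int f" "compactly_supported u"
    unfolding preminimal_graph_def by blast
  have "compactly_supported (\<lambda>x. k * u x)"
    using u(6) unfolding compactly_supported_iff_bounded_support by auto
  moreover have "l2_scaleC k X = abs_l2 (\<lambda>x. k * u x)" "l2_scaleC k F = abs_l2 (\<lambda>x. k * f x)"
    using u by (auto simp: abs_l2_scaleC)
  ultimately show "(l2_scaleC k X, l2_scaleC k F) \<in> preminimal_graph A B c"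
    unfolding preminimal_graph_def
    using quasi_solution_scale[OF u(3), of k] sq_int_cmult[OF u(4), of k] sq_int_cmult[OF u(5), of k] by blast
qed

lemma cnj_comp_cnj_comp [simp]: "cnj \<circ> (cnj \<circ> f) = f"
  by (auto simp: o_def)

text \<open>Lagrange's identity over the whole line. Both images are square-integrable, so the derivative of
  the boundary form is integrable and the limits exist.\<close>

theorem boundary_form_eq:
  assumes u: "u \<in> max_dom A B c" and v: "v \<in> max_dom (cnj \<circ> B) (cnj \<circ> A) (cnj \<circ> c)"
  defines "P \<equiv> \<lambda>x. u x * cnj (qderiv1 (cnj \<circ> B) v x) - qderiv1 A u x * cnj (v x)"
  shows "Lim at_top P - Lim at_bot P =
    l2_inner (abs_l2 (qexpr A B c u)) (abs_l2 v) - l2_inner (abs_l2 u) (abs_l2 (qexpr (cnj \<circ> B) (cnj \<circ> A) (cnj \<circ> c) v))"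
proof -
  note U = max_domD[OF u] and V = max_domD[OF v]
  have int: "integrable lebesgue (\<lambda>x. qexpr A B c u x * cnj (v x) - u x * cnj (qexpr (cnj \<circ> B) (cnj \<circ> A) (cnj \<circ> c) v x))"
    by (intro Bochner_Integration.integrable_diff sq_int_inner U V)
  obtain l1 l2 where l: "(P \<longlongrightarrow> l1) at_top" "(P \<longlongrightarrow> l2) at_bot"
    "l1 - l2 = (\<integral>x. qexpr A B c u x * cnj (v x) - u x * cnj (qexpr (cnj \<circ> B) (cnj \<circ> A) (cnj \<circ> c) v x) \<partial>lebesgue)"
    using primitive_of_limits[OF Lagrange_identity[OF U(1) V(1)] int] unfolding P_def by blast
  have "Lim at_top P = l1" "Lim at_bot P = l2"
    using l tendsto_Lim[OF trivial_limit_at_top_linorder] tendsto_Lim[OF trivial_limit_at_bot_linorder] by blast+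
  then show ?thesis using l(3)
    by (simp add: l2_inner_abs U V Bochner_Integration.integral_diff sq_int_inner)
qed

context
  fixes A B c :: "real \<Rightarrow> complex"
  assumes A: "L2_loc A" and B: "L2_loc B" and c: "L1_loc c"
begin

lemma adjoint_preminimal_star: "adjoint_op (preminimal_graph (cnj \<circ> B) (cnj \<circ> A) (cnj \<circ> c)) = maximal_graph A B c"
  using adjoint_preminimal[OF L2_loc_cnj[OF B] L2_loc_cnj[OF A] L1_loc_cnj[OF c]] by simp

lemma closed_operator_maximal: "closed_operator (maximal_graph A B c)"
  unfolding closed_operator_def linear_operator_iff
  using single_valued_maximal linear_graph_adjoint closed_adjoint adjoint_preminimal_star by metis

lemma linear_operator_preminimal: "linear_operator (preminimal_graph A B c)"
  unfolding linear_operator_iff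
  using linear_graph_preminimal single_valued_subset[OF preminimal_subset_maximal single_valued_maximal] by blast

lemma densely_defined_preminimal: "densely_defined (preminimal_graph A B c)"
  unfolding densely_defined_def
  using linear_operator_preminimal dense_Domain_if_adjoint_single_valued[OF linear_graph_preminimal[of A B c]]
    single_valued_maximal adjoint_preminimal[OF A B c] by metis

lemma closure_preminimal:
  "closure (preminimal_graph A B c) = adjoint_op (maximal_graph (cnj \<circ> B) (cnj \<circ> A) (cnj \<circ> c))"
  using double_adjoint[OF linear_graph_preminimal, of A B c] adjoint_preminimal[OF A B c] by simp

lemma closure_preminimal_subset: "closure (preminimal_graph A B c) \<subseteq> maximal_graph A B c"
  by (rule closure_minimal[OF preminimal_subset_maximal]) (use closed_operator_maximal in \<open>simp add: closed_operator_def\<close>)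

lemma closable_operator_preminimal: "closable_operator (preminimal_graph A B c)"
  unfolding closable_operator_def
proof
  show "linear_operator (closure (preminimal_graph A B c))"
    unfolding linear_operator_iff
    using single_valued_subset[OF closure_preminimal_subset single_valued_maximal] closure_preminimal linear_graph_adjoint by metis
qed (rule linear_operator_preminimal)

text \<open>The closure is the adjoint of the maximal operator of the adjoint expression, and it is contained
  in the maximal operator; so its domain consists of those elements of the maximal domain that
  satisfy the adjoint relation against the whole maximal domain of the adjoint expression.\<close>

lemma Domain_closure_preminimal:
  "Domain (closure (preminimal_graph A B c)) = abs_l2 ` {u \<in> max_dom A B c.
     \<forall>v\<in>max_dom (cnj \<circ> B) (cnj \<circ> A) (cnj \<circ> c).
       l2_inner (abs_l2 (qexpr A B c u)) (abs_l2 v) =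
       l2_inner (abs_l2 u) (abs_l2 (qexpr (cnj \<circ> B) (cnj \<circ> A) (cnj \<circ> c) v))}" (is "_ = abs_l2 ` ?D")
proof (intro equalityI subsetI)
  fix X assume "X \<in> Domain (closure (preminimal_graph A B c))"
  then obtain F where XF: "(X, F) \<in> closure (preminimal_graph A B c)" by blast
  then have "(X, F) \<in> qop_on (max_dom A B c) A B c"
    using closure_preminimal_subset qop_on_max_dom by blast
  then obtain u where u: "u \<in> max_dom A B c" "X = abs_l2 u" "F = abs_l2 (qexpr A B c u)"
    by (auto simp: qop_on_def)
  have "l2_inner F (abs_l2 v) = l2_inner X (abs_l2 (qexpr (cnj \<circ> B) (cnj \<circ> A) (cnj \<circ> c) v))"
    if "v \<in> max_dom (cnj \<circ> B) (cnj \<circ> A) (cnj \<circ> c)" for v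
  proof -
    have "(abs_l2 v, abs_l2 (qexpr (cnj \<circ> B) (cnj \<circ> A) (cnj \<circ> c) v)) \<in> maximal_graph (cnj \<circ> B) (cnj \<circ> A) (cnj \<circ> c)"
      using that unfolding qop_on_max_dom[symmetric] qop_on_def by blast
    then have "l2_inner (abs_l2 (qexpr (cnj \<circ> B) (cnj \<circ> A) (cnj \<circ> c) v)) X = l2_inner (abs_l2 v) F"
      using XF unfolding closure_preminimal adjoint_op_def by auto
    then show ?thesis by (metis l2_inner_commute)
  qed
  then show "X \<in> abs_l2 ` ?D" using u by blast
next
  fix X assume "X \<in> abs_l2 ` ?D"
  then obtain u where u: "u \<in> ?D" "X = abs_l2 u" by blast
  have "(X, abs_l2 (qexpr A B c u)) \<in> closure (preminimal_graph A B c)"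
    unfolding closure_preminimal adjoint_op_def qop_on_max_dom[symmetric] qop_on_def
  proof safe
    fix v assume "v \<in> max_dom (cnj \<circ> B) (cnj \<circ> A) (cnj \<circ> c)"
    then have "l2_inner (abs_l2 (qexpr A B c u)) (abs_l2 v) =
       l2_inner (abs_l2 u) (abs_l2 (qexpr (cnj \<circ> B) (cnj \<circ> A) (cnj \<circ> c) v))" using u(1) by blast
    then show "l2_inner (abs_l2 (qexpr (cnj \<circ> B) (cnj \<circ> A) (cnj \<circ> c) v)) X = l2_inner (abs_l2 v) (abs_l2 (qexpr A B c u))"
      unfolding u(2) by (metis l2_inner_commute)
  qed
  then show "X \<in> Domain (closure (preminimal_graph A B c))" by blast
qed

end

section \<open>Weak derivatives and the quadratic form\<close>

text \<open>\<open>u' = A u + w\<close> with \<open>u\<close>, \<open>w\<close> continuous inherits local square-integrability from \<open>A\<close>.\<close>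

lemma max_dom_vderiv:
  assumes A: "L2_loc A" and u: "u \<in> max_dom A B c"
  shows "L2_loc (\<lambda>x. vderiv u x)"
proof -
  note q = max_domD(1)[OF u]
  have "L2_loc (\<lambda>x. A x * u x + qderiv1 A u x)"
    by (intro L2_loc_add L2_loc_mult_continuous A L2_loc_continuous quasi_solution_continuous[OF q])
  then show ?thesis
    by (rule L2_loc_cong_AE) (use quasi_solution_vderiv[OF q] in \<open>auto elim: eventually_mono\<close>)
qed

lemma test_function_primitive_of:
  assumes "test_function \<phi>"
  shows "primitive_of (\<lambda>x. complex_of_real (\<phi> x)) (\<lambda>x. complex_of_real (deriv \<phi> x))" "continuous_on UNIV (deriv \<phi>)"
proof -
  have d: "(\<phi> has_real_derivative deriv \<phi> x) (at x)" for x
    using assms unfolding test_function_def DERIV_deriv_iff_field_differentiable by (metis funpow_0)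
  have "(deriv ^^ 1) \<phi> field_differentiable at x" for x
    using assms unfolding test_function_def by blast
  then have "deriv \<phi> field_differentiable at x" for x by simp
  then show cont: "continuous_on UNIV (deriv \<phi>)"
    by (intro continuous_at_imp_continuous_on ballI field_differentiable_imp_continuous_at)
  have "primitive_of \<phi> (deriv \<phi>)"
    unfolding primitive_of_def
  proof (intro conjI allI impI)
    fix a b :: real
    show "deriv \<phi> absolutely_integrable_on {a..b}"
      by (intro absolutely_integrable_continuous_real continuous_on_subset[OF cont]) auto
    assume "a \<le> b"
    then have "(deriv \<phi> has_integral \<phi> b - \<phi> a) {a..b}"
      by (rule fundamental_theorem_of_calculus)
        (use d in \<open>auto simp: has_real_derivative_iff_has_vector_derivative intro: has_vector_derivative_at_within\<close>)
    then show "\<phi> b - \<phi> a = integral {a..b} (deriv \<phi>)" by (simp add: integral_unique)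
  qed
  then show "primitive_of (\<lambda>x. complex_of_real (\<phi> x)) (\<lambda>x. complex_of_real (deriv \<phi> x))"
    by (rule primitive_of_linear[OF _ bounded_linear_of_real])
qed

text \<open>Integration by parts: \<open>u \<phi>\<close> is a compactly supported primitive of \<open>u' \<phi> + u \<phi>'\<close>.\<close>

lemma weak_deriv_AC_loc:
  assumes u: "AC_loc u"
  shows "weak_deriv 1 u (\<lambda>x. vderiv u x)"
  unfolding weak_deriv_def
proof (intro allI impI)
  fix \<phi> assume \<phi>: "test_function \<phi>"
  note p = test_function_primitive_of[OF \<phi>]
  obtain R where R: "R > 0" "\<And>x. R \<le> \<bar>x\<bar> \<Longrightarrow> \<phi> x = 0"
    using \<phi> unfolding test_function_def compactly_supported_iff_bounded_support by blast
  \<comment> \<open>The margin 1 makes \<open>\<phi>\<close> vanish near every point outside the interval, not only at it.\<close>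
  have d0: "deriv \<phi> x = 0" if "x \<notin> {-(R+1)..R+1}" for x
  proof (rule DERIV_imp_deriv)
    have op: "open {x::real. R < \<bar>x\<bar>}" by (intro open_Collect_less continuous_intros)
    have "x \<in> {x::real. R < \<bar>x\<bar>}" using that by auto
    then show "(\<phi> has_field_derivative 0) (at x)"
      by (rule has_field_derivative_transform_within_open[OF DERIV_const op]) (use R(2) in force)
  qed
  have \<phi>0: "\<phi> x = 0" if "x \<notin> {-(R+1)..R+1}" for x using R(2)[of x] that by auto
  have Du: "L1_loc (\<lambda>x. vderiv u x)"
    using AC_loc_primitive_of[OF u] by (simp add: primitive_of_def L1_loc_def)
  have cu: "continuous_on UNIV u" by (rule primitive_of_continuous[OF AC_loc_primitive_of[OF u]])
  have i1: "integrable lebesgue (\<lambda>x. vderiv u x * of_real (\<phi> x))"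
  proof (rule set_integrable_imp_integrable_lebesgue)
    show "set_integrable lebesgue {-(R+1)..R+1} (\<lambda>x. vderiv u x * of_real (\<phi> x))"
      by (intro L1_locD L1_loc_mult_continuous[OF Du] primitive_of_continuous[OF p(1)])
  qed (simp add: \<phi>0 del: atLeastAtMost_iff)
  have i2: "integrable lebesgue (\<lambda>x. u x * of_real (deriv \<phi> x))"
  proof (rule set_integrable_imp_integrable_lebesgue)
    show "set_integrable lebesgue {-(R+1)..R+1} (\<lambda>x. u x * of_real (deriv \<phi> x))"
      by (intro L1_locD L1_loc_mult_continuous[OF L2_loc_imp_L1_loc[OF L2_loc_continuous[OF cu]]] continuous_intros p(2))
  qed (simp add: d0 del: atLeastAtMost_iff)
  have "(\<integral>x. vderiv u x * of_real (\<phi> x) + u x * of_real (deriv \<phi> x) \<partial>lebesgue) = 0"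
    by (rule integral_eq_0_of_compactly_supported_primitive[OF primitive_of_mult[OF AC_loc_primitive_of[OF u] p(1)], of R])
      (use i1 i2 R(2) in auto)
  then have "(\<integral>x. vderiv u x * of_real (\<phi> x) \<partial>lebesgue) + (\<integral>x. u x * of_real (deriv \<phi> x) \<partial>lebesgue) = 0"
    using i1 i2 by simp
  then show "(\<integral>x. u x * of_real ((deriv ^^ 1) \<phi> x) \<partial>lebesgue) = (- 1) ^ 1 * (\<integral>x. vderiv u x * of_real (\<phi> x) \<partial>lebesgue)"
    by (simp add: add_eq_0_iff)
qed

lemma max_dom_subset_W2_loc:
  assumes A: "L2_loc A"
  shows "max_dom A B c \<subseteq> W2_loc 1"
proof
  fix u assume u: "u \<in> max_dom A B c"
  note q = max_domD(1)[OF u]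
  have "weak_deriv 0 u u" by (simp add: weak_deriv_def)
  moreover have "weak_deriv 1 u (\<lambda>x. vderiv u x)" by (rule weak_deriv_AC_loc[OF quasi_solution_qderiv1(2)[OF q]])
  moreover have "L2_loc u" by (rule L2_loc_continuous[OF quasi_solution_continuous(1)[OF q]])
  ultimately show "u \<in> W2_loc 1"
    using max_dom_vderiv[OF A u] by (auto simp: W2_loc_def le_Suc_eq)
qed

text \<open>The function \<open>w cnj u\<close> has compact support, so its derivative \<open>w' cnj u + w cnj u'\<close> integrates to
  zero. Inserting \<open>w = u' - A u\<close> and the equation for \<open>w'\<close>, the terms with \<open>A B\<close> cancel and the
  derivative becomes the integrand \<open>E\<close> of the quadratic form minus \<open>f cnj u\<close>.\<close>

theorem quadratic_form_preminimal:
  assumes A: "L2_loc A" and B: "L2_loc B" and c: "L1_loc c" and u: "u \<in> premin_dom A B c"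
  shows "integrable lebesgue (\<lambda>x. (cmod (vderiv u x))\<^sup>2)"
    and "integrable lebesgue (\<lambda>x. A x * u x * cnj (vderiv u x) + B x * vderiv u x * cnj (u x))"
    and "integrable lebesgue (\<lambda>x. c x * of_real ((cmod (u x))\<^sup>2))"
    and "l2_inner (abs_l2 (qexpr A B c u)) (abs_l2 u) =
         of_real (\<integral>x. (cmod (vderiv u x))\<^sup>2 \<partial>lebesgue)
         - (\<integral>x. A x * u x * cnj (vderiv u x) + B x * vderiv u x * cnj (u x) \<partial>lebesgue)
         + (\<integral>x. c x * of_real ((cmod (u x))\<^sup>2) \<partial>lebesgue)"
proof -
  have um: "u \<in> max_dom A B c" and comp: "compactly_supported u" using u by (auto simp: premin_dom_def)
  note q = max_domD[OF um]
  define w where "w = qderiv1 A u"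
  define f where "f = qexpr A B c u"
  define D where "D x = vderiv u x" for x
  have q1: "quasi_solution A B c f u w" using q(1) by (simp add: w_def f_def)
  note cont = quasi_solution_continuous[OF q1]
  obtain R where R: "R > 0" "\<And>x. R \<le> \<bar>x\<bar> \<Longrightarrow> u x = 0" "\<And>x. R \<le> \<bar>x\<bar> \<Longrightarrow> w x = 0"
    using quasi_solution_compact_support[OF q1 comp] by blast
  have u0: "u x = 0" if "x \<notin> {-(R+1)..R+1}" for x using R(2)[of x] that by auto
  have D0: "D x = 0" if "x \<notin> {-(R+1)..R+1}" for x
    unfolding D_def
  proof (rule vector_derivative_at)
    have op: "open {x::real. R < \<bar>x\<bar>}" by (intro open_Collect_less continuous_intros)
    have "x \<in> {x::real. R < \<bar>x\<bar>}" using that by auto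
    then show "(u has_vector_derivative 0) (at x)"
      by (rule has_vector_derivative_transform_within_open[OF has_vector_derivative_const op]) (use R(2) in force)
  qed
  have D: "sq_int D"
    by (rule sq_int_of_L2_loc[OF _ D0]) (use max_dom_vderiv[OF A um] in \<open>simp_all add: D_def[abs_def]\<close>)
  have Au: "sq_int (\<lambda>x. A x * u x)"
    by (rule sq_int_of_L2_loc[OF L2_loc_mult_continuous[OF A cont(1)], of "-(R+1)" "R+1"]) (simp add: u0 del: atLeastAtMost_iff)
  have Bu: "sq_int (\<lambda>x. (cnj \<circ> B) x * u x)"
    by (rule sq_int_of_L2_loc[OF L2_loc_mult_continuous[OF L2_loc_cnj[OF B] cont(1)], of "-(R+1)" "R+1"]) (simp add: u0 del: atLeastAtMost_iff)
  have i1: "integrable lebesgue (\<lambda>x. (cmod (D x))\<^sup>2)" using D by (simp add: sq_int_def)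
  have i1': "integrable lebesgue (\<lambda>x. complex_of_real ((cmod (D x))\<^sup>2))" using i1 by (rule integrable_of_real)
  have i2: "integrable lebesgue (\<lambda>x. A x * u x * cnj (D x) + B x * D x * cnj (u x))"
    using Bochner_Integration.integrable_add[OF sq_int_inner[OF Au D] sq_int_inner[OF D Bu]] by (simp add: mult_ac)
  have i3: "integrable lebesgue (\<lambda>x. c x * of_real ((cmod (u x))\<^sup>2))"
  proof (rule set_integrable_imp_integrable_lebesgue)
    show "set_integrable lebesgue {-(R+1)..R+1} (\<lambda>x. c x * of_real ((cmod (u x))\<^sup>2))"
      by (intro L1_locD L1_loc_mult_continuous[OF c] continuous_intros cont)
  qed (simp add: u0 del: atLeastAtMost_iff)
  define E where "E x = of_real ((cmod (D x))\<^sup>2) - (A x * u x * cnj (D x) + B x * D x * cnj (u x)) + c x * of_real ((cmod (u x))\<^sup>2)" for x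
  have iE: "integrable lebesgue E"
    unfolding E_def by (rule Bochner_Integration.integrable_add[OF Bochner_Integration.integrable_diff[OF i1' i2] i3])
  have ifu: "integrable lebesgue (\<lambda>x. f x * cnj (u x))" unfolding f_def by (intro sq_int_inner q)
  have prim: "primitive_of (\<lambda>x. w x * cnj (u x)) (\<lambda>x. E x - f x * cnj (u x))"
  proof (rule primitive_of_cong_AE)
    show "primitive_of (\<lambda>x. w x * cnj (u x))
        (\<lambda>x. (- B x * w x - (A x * B x - c x) * u x - f x) * cnj (u x) + w x * cnj (A x * u x + w x))"
      using q1 by (intro primitive_of_mult primitive_of_linear[OF _ bounded_linear_cnj]) (auto simp: quasi_solution_def)
    show "AE x in lebesgue. (- B x * w x - (A x * B x - c x) * u x - f x) * cnj (u x) + w x * cnj (A x * u x + w x) = E x - f x * cnj (u x)"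
      using quasi_solution_vderiv[OF q1]
    proof eventually_elim
      case (elim x)
      then have Dx: "D x = A x * u x + w x" by (simp add: D_def)
      show ?case unfolding E_def complex_norm_square Dx by (simp add: algebra_simps)
    qed
  qed
  have "(\<integral>x. E x - f x * cnj (u x) \<partial>lebesgue) = 0"
    by (rule integral_eq_0_of_compactly_supported_primitive[OF prim _, of R]) (use iE ifu R in auto)
  then have "(\<integral>x. f x * cnj (u x) \<partial>lebesgue) = (\<integral>x. E x \<partial>lebesgue)" using iE ifu by simp
  also have "\<dots> = of_real (\<integral>x. (cmod (D x))\<^sup>2 \<partial>lebesgue) - (\<integral>x. A x * u x * cnj (D x) + B x * D x * cnj (u x) \<partial>lebesgue)
         + (\<integral>x. c x * of_real ((cmod (u x))\<^sup>2) \<partial>lebesgue)"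
  proof -
    show ?thesis
      unfolding E_def Bochner_Integration.integral_add[OF Bochner_Integration.integrable_diff[OF i1' i2] i3]
        Bochner_Integration.integral_diff[OF i1' i2] integral_complex_of_real ..
  qed
  finally show "l2_inner (abs_l2 (qexpr A B c u)) (abs_l2 u) =
         of_real (\<integral>x. (cmod (vderiv u x))\<^sup>2 \<partial>lebesgue)
         - (\<integral>x. A x * u x * cnj (vderiv u x) + B x * vderiv u x * cnj (u x) \<partial>lebesgue)
         + (\<integral>x. c x * of_real ((cmod (u x))\<^sup>2) \<partial>lebesgue)"
    by (simp add: l2_inner_abs q f_def D_def)
  show "integrable lebesgue (\<lambda>x. (cmod (vderiv u x))\<^sup>2)"
    "integrable lebesgue (\<lambda>x. A x * u x * cnj (vderiv u x) + B x * vderiv u x * cnj (u x))"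
    "integrable lebesgue (\<lambda>x. c x * of_real ((cmod (u x))\<^sup>2))"
    using i1 i2 i3 by (simp_all add: D_def)
qed

section \<open>The operators generated by the expression and its formal adjoint\<close>

text \<open>The general results are applied twice, to the coefficients \<open>G\<^sub>1\<close>, \<open>G\<^sub>2\<close>, \<open>s\<close> and to their adjoint
  coefficients \<open>A'\<close>, \<open>B'\<close>, \<open>c'\<close>, whose own adjoint coefficients are \<open>G\<^sub>1\<close>, \<open>G\<^sub>2\<close>, \<open>s\<close> again.\<close>

theorem theorem2p1:
  fixes s Q r :: "real \<Rightarrow> complex"
  assumes s: "L1_loc s" and Q: "L2_loc Q" and r: "L2_loc r"
  shows
    "(densely_defined (op_L00 s Q r) \<and> densely_defined (op_Lp00 s Q r)) \<and>
     (adjoint_op (op_L00 s Q r) = op_Lp s Q r \<and> adjoint_op (op_Lp00 s Q r) = op_L s Q r) \<and>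
     (closed_operator (op_L s Q r) \<and> closed_operator (op_Lp s Q r) \<and>
     closable_operator (op_L00 s Q r) \<and> closable_operator (op_Lp00 s Q r)) \<and>
     (Domain (op_L0 s Q r) =
       abs_l2 ` {u \<in> dom_L s Q r. \<forall>v\<in>dom_Lp s Q r. bracket_inf Q r u v = 0} \<and>
     Domain (op_Lp0 s Q r) =
       abs_l2 ` {v \<in> dom_Lp s Q r. \<forall>u\<in>dom_L s Q r. bracket_inf Q r u v = 0}) \<and>
     (dom_L s Q r \<subseteq> W2_loc 1 \<and> dom_Lp s Q r \<subseteq> W2_loc 1) \<and>
     (dom_L00 s Q r \<subseteq> W2_comp 1 \<and> dom_Lp00 s Q r \<subseteq> W2_comp 1) \<and>
     (\<forall>u\<in>dom_L00 s Q r.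
       integrable lebesgue (\<lambda>x. (cmod (vderiv u x))\<^sup>2) \<and>
       integrable lebesgue (\<lambda>x. G1 Q r x * u x * cnj (vderiv u x) + G2 Q r x * vderiv u x * cnj (u x)) \<and>
       integrable lebesgue (\<lambda>x. s x * of_real ((cmod (u x))\<^sup>2)) \<and>
       l2_inner (abs_l2 (lexpr s Q r u)) (abs_l2 u) =
         of_real (\<integral>x. (cmod (vderiv u x))\<^sup>2 \<partial>lebesgue)
         - (\<integral>x. G1 Q r x * u x * cnj (vderiv u x) + G2 Q r x * vderiv u x * cnj (u x) \<partial>lebesgue)
         + (\<integral>x. s x * of_real ((cmod (u x))\<^sup>2) \<partial>lebesgue))"
proof -
  have ir: "L2_loc (\<lambda>x. r x * \<i>)" "L2_loc (\<lambda>x. r x * - \<i>)"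
    by (intro L2_loc_mult_continuous[OF r] continuous_intros)+
  have A: "L2_loc (G1 Q r)" using L2_loc_add[OF Q ir(1)] by (simp add: G1_def[abs_def] mult.commute)
  have B: "L2_loc (G2 Q r)" using L2_loc_add[OF Q ir(2)] by (simp add: G2_def[abs_def] mult.commute)
  define A' where "A' = cnj \<circ> G2 Q r"
  define B' where "B' = cnj \<circ> G1 Q r"
  define c' where "c' = cnj \<circ> s"
  have A': "L2_loc A'" and B': "L2_loc B'" and c': "L1_loc c'"
    using L2_loc_cnj[OF A] L2_loc_cnj[OF B] L1_loc_cnj[OF s] by (auto simp: A'_def B'_def c'_def)
  have star_star: "cnj \<circ> B' = G1 Q r" "cnj \<circ> A' = G2 Q r" "cnj \<circ> c' = s" by (auto simp: A'_def B'_def c'_def)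
  have doms: "dom_L s Q r = max_dom (G1 Q r) (G2 Q r) s" "dom_Lp s Q r = max_dom A' B' c'"
    "dom_L00 s Q r = premin_dom (G1 Q r) (G2 Q r) s" "dom_Lp00 s Q r = premin_dom A' B' c'"
    by (auto simp: dom_L_def dom_Lp_def dom_L00_def dom_Lp00_def A'_def B'_def c'_def)
  have ops: "op_L s Q r = maximal_graph (G1 Q r) (G2 Q r) s" "op_Lp s Q r = maximal_graph A' B' c'"
    "op_L00 s Q r = preminimal_graph (G1 Q r) (G2 Q r) s" "op_Lp00 s Q r = preminimal_graph A' B' c'"
    unfolding op_L_def op_Lp_def op_L00_def op_Lp00_def doms A'_def[symmetric] B'_def[symmetric] c'_def[symmetric]
    by (rule qop_on_max_dom qop_on_premin_dom)+
  have adj: "adjoint_op (op_L00 s Q r) = op_Lp s Q r" "adjoint_op (op_Lp00 s Q r) = op_L s Q r"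
    unfolding ops using adjoint_preminimal[OF A B s] adjoint_preminimal[OF A' B' c']
    by (simp_all only: star_star) (simp_all only: A'_def B'_def c'_def)
  have form: "bracket_inf Q r u v = l2_inner (abs_l2 (qexpr (G1 Q r) (G2 Q r) s u)) (abs_l2 v) -
      l2_inner (abs_l2 u) (abs_l2 (qexpr A' B' c' v))"
    if "u \<in> dom_L s Q r" "v \<in> dom_Lp s Q r" for u v
    using boundary_form_eq[of u "G1 Q r" "G2 Q r" s v] that
    unfolding doms A'_def B'_def c'_def bracket_inf_def bracket_def[abs_def] by simp
  \<comment> \<open>By \<open>form\<close>, a vanishing boundary form is the adjoint relation.\<close>
  have D0: "Domain (op_L0 s Q r) = abs_l2 ` {u \<in> dom_L s Q r. \<forall>v\<in>dom_Lp s Q r. bracket_inf Q r u v = 0}"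
  proof -
    have "{u \<in> dom_L s Q r. \<forall>v\<in>dom_Lp s Q r. bracket_inf Q r u v = 0} =
      {u \<in> dom_L s Q r. \<forall>v\<in>dom_Lp s Q r. l2_inner (abs_l2 (qexpr (G1 Q r) (G2 Q r) s u)) (abs_l2 v) =
        l2_inner (abs_l2 u) (abs_l2 (qexpr A' B' c' v))}"
      using form by auto
    then show ?thesis
      unfolding op_L0_def ops using Domain_closure_preminimal[OF A B s]
      by (simp only: doms A'_def B'_def c'_def)
  qed
  have Dp0: "Domain (op_Lp0 s Q r) = abs_l2 ` {v \<in> dom_Lp s Q r. \<forall>u\<in>dom_L s Q r. bracket_inf Q r u v = 0}"
  proof -
    have "{v \<in> dom_Lp s Q r. \<forall>u\<in>dom_L s Q r. bracket_inf Q r u v = 0} =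
      {v \<in> dom_Lp s Q r. \<forall>u\<in>dom_L s Q r. l2_inner (abs_l2 (qexpr A' B' c' v)) (abs_l2 u) =
        l2_inner (abs_l2 v) (abs_l2 (qexpr (G1 Q r) (G2 Q r) s u))}"
    proof -
      have "bracket_inf Q r u v = 0 \<longleftrightarrow> l2_inner (abs_l2 (qexpr A' B' c' v)) (abs_l2 u) =
        l2_inner (abs_l2 v) (abs_l2 (qexpr (G1 Q r) (G2 Q r) s u))" if "u \<in> dom_L s Q r" "v \<in> dom_Lp s Q r" for u v
        unfolding form[OF that] right_minus_eq
        by (subst l2_inner_commute, subst (2) l2_inner_commute) auto
      then show ?thesis by auto
    qed
    then show ?thesis
      unfolding op_Lp0_def ops using Domain_closure_preminimal[OF A' B' c'] unfolding star_star doms by simp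
  qed
  have W: "dom_L s Q r \<subseteq> W2_loc 1" "dom_Lp s Q r \<subseteq> W2_loc 1"
    unfolding doms by (rule max_dom_subset_W2_loc[OF A], rule max_dom_subset_W2_loc[OF A'])
  then have Wc: "dom_L00 s Q r \<subseteq> W2_comp 1" "dom_Lp00 s Q r \<subseteq> W2_comp 1"
    unfolding doms by (auto simp: premin_dom_def W2_comp_def)
  show ?thesis
  proof (intro conjI ballI)
    show "densely_defined (op_L00 s Q r)" "densely_defined (op_Lp00 s Q r)"
      unfolding ops by (rule densely_defined_preminimal[OF A B s], rule densely_defined_preminimal[OF A' B' c'])
    show "closed_operator (op_L s Q r)" "closed_operator (op_Lp s Q r)"
      unfolding ops by (rule closed_operator_maximal[OF A B s], rule closed_operator_maximal[OF A' B' c'])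
    show "closable_operator (op_L00 s Q r)" "closable_operator (op_Lp00 s Q r)"
      unfolding ops by (rule closable_operator_preminimal[OF A B s], rule closable_operator_preminimal[OF A' B' c'])
    fix u assume "u \<in> dom_L00 s Q r"
    then have u: "u \<in> premin_dom (G1 Q r) (G2 Q r) s" by (simp add: doms)
    note quad = quadratic_form_preminimal[OF A B s u]
    show "integrable lebesgue (\<lambda>x. (cmod (vderiv u x))\<^sup>2)" by (rule quad(1))
    show "integrable lebesgue (\<lambda>x. G1 Q r x * u x * cnj (vderiv u x) + G2 Q r x * vderiv u x * cnj (u x))" by (rule quad(2))
    show "integrable lebesgue (\<lambda>x. s x * of_real ((cmod (u x))\<^sup>2))" by (rule quad(3))
    show "l2_inner (abs_l2 (lexpr s Q r u)) (abs_l2 u) =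
         of_real (\<integral>x. (cmod (vderiv u x))\<^sup>2 \<partial>lebesgue)
         - (\<integral>x. G1 Q r x * u x * cnj (vderiv u x) + G2 Q r x * vderiv u x * cnj (u x) \<partial>lebesgue)
         + (\<integral>x. s x * of_real ((cmod (u x))\<^sup>2) \<partial>lebesgue)"
      unfolding lexpr_def by (rule quad(4))
  qed (rule adj D0 Dp0 W Wc)+
qed


end
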